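(* Fix integers $d \ge 1$, $h \ge 1$, $m \ge 1$, and let $V_{2,d} \subset \mathbb{P}^{d(d+3)/2}$ be the $d$-Veronese surface over $\mathbb{C}$ and $T(m,V_{2,d})$ its $m$-osculating variety. (I) If $$\frac{(d+2)(d+1)}{2} \le 2(h+1) + (h+1)\frac{(m+2)(m+1)}{2},$$ then $T(m,V_{2,d})$ is $h$-defective in each of the following cases: (a) $h=1$, $m+2 \le d \le 2m+2$; (b) $h=2$, $3(m+2)/2 \le d \le 2m+2$; (c) $h=4$, $2m+4 \le d \le (5m+8)/2$; (d) $h=5$, $12(m+2)/5 \le d \le (5m+8)/2$; (e) $h=6$, $21(m+2)/8 \le d \le (8m+14)/3$; (f) $h=7$, $48(m+2)/17 \le d \le (17m+32)/6$. (II) If instead $$\frac{(d+2)(d+1)}{2} \ge 2(h+1) + (h+1)\frac{(m+2)(m+1)}{2},$$ then $T(m,V_{2,d})$ is $h$-defective in each of the following cases: (a) $h=1$, $m+1 \le d \le 2m$; (b) $h=2$, $3(m+1)/2 \le d \le 2m$; (c) $h=4$, $2m+2 \le d \le (5m+3)/2$; (d) $h=5$, $12(m+1)/5 \le d \le (5m+3)/2$; (e) $h=6$, $21(m+1)/8 \le d \le (8m+6)/3$; (f) $h=7$, $48(m+1)/17 \le d \le (17m+15)/6$.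
   Context: Everything is over $\mathbb{C}$. $V_{2,d} \subset \mathbb{P}^{r}$, $r = \frac{(d+2)(d+1)}{2}-1 = d(d+3)/2$, is the image of $\mathbb{P}^2$ under the Veronese embedding given by all degree $d$ forms. For an integral non-degenerate projective variety $X \subset \mathbb{P}^r$ of dimension $n$, a general (in particular smooth) point $p \in X$ and an integer $m \ge 0$, the $m$-osculating space $T^m_p(X) \subseteq \mathbb{P}^r$ is the linear span of the point $p$ and of all partial derivatives of order at most $m$, at $p$, of (a lift to $\mathbb{C}^{r+1}$ of) a local parametrization of $X$ around $p$; thus $T^0_p(X)=\{p\}$ and $T^1_p(X)$ is the usual projective tangent space. The $m$-osculating variety $T(m,X)$ is the closure in $\mathbb{P}^r$ of the union of the spaces $T^m_p(X)$ for $p$ general in $X$. For a variety $Y \subseteq \mathbb{P}^r$, the $h$-secant variety $\mathrm{Sec}_h(Y)$ is the closure of the union of the linear spans $\langle q_0, \ldots, q_h\rangle$ of $h+1$ general points of $Y$. The expected dimension of $\mathrm{Sec}_h(T(m,V_{2,d}))$ is $$\mathrm{expdim}(\mathrm{Sec}_h(T(m,V_{2,d}))) = \min\left\{2(h+1) + (h+1)\frac{(m+2)(m+1)}{2} - 1,\ \frac{(d+2)(d+1)}{2}-1\right\},$$ and $T(m,V_{2,d})$ is called $h$-defective if $\dim \mathrm{Sec}_h(T(m,V_{2,d})) < \mathrm{expdim}(\mathrm{Sec}_h(T(m,V_{2,d})))$. *)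

theory Defs
  imports
    "HOL-Analysis.Analysis"
    "HOL-Library.Function_Algebras"
    "HOL-Library.Poly_Mapping"
begin

global_interpretation cfun: vector_space "\<lambda>(c :: complex) (v :: 'i \<Rightarrow> complex) i. c * v i"
  by unfold_locales (simp_all add: fun_eq_iff algebra_simps)

definition coord_space :: "'i set \<Rightarrow> ('i \<Rightarrow> complex) set" where
  "coord_space I = {v. \<forall>i. i \<notin> I \<longrightarrow> v i = 0}"

text \<open>A point of projective space is a one-dimensional linear subspace. With \<open>card I = r + 1\<close>,
  the set \<open>proj_space I\<close> is the complex projective space of dimension \<open>r\<close>.\<close>

type_synonym 'i pt = "('i \<Rightarrow> complex) set"

definition proj_space :: "'i set \<Rightarrow> 'i pt set" where
  "proj_space I = {cfun.span {v} | v. v \<in> coord_space I \<and> v \<noteq> 0}"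

definition proj_span :: "'i set \<Rightarrow> ('i \<Rightarrow> complex) set \<Rightarrow> 'i pt set" where
  "proj_span I S = {q \<in> proj_space I. q \<subseteq> cfun.span S}"

definition monomials :: "'i set \<Rightarrow> nat \<Rightarrow> ('i \<Rightarrow>\<^sub>0 nat) set" where
  "monomials I e =
     {\<alpha>. Poly_Mapping.keys \<alpha> \<subseteq> I \<and> (\<Sum>i\<in>Poly_Mapping.keys \<alpha>. Poly_Mapping.lookup \<alpha> i) = e}"

definition eval_monomial :: "('i \<Rightarrow>\<^sub>0 nat) \<Rightarrow> ('i \<Rightarrow> complex) \<Rightarrow> complex" where
  "eval_monomial \<alpha> v = (\<Prod>i\<in>Poly_Mapping.keys \<alpha>. v i ^ Poly_Mapping.lookup \<alpha> i)"

type_synonym 'i cpoly = "('i \<Rightarrow>\<^sub>0 nat) \<Rightarrow>\<^sub>0 complex"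

definition eval_poly :: "'i cpoly \<Rightarrow> ('i \<Rightarrow> complex) \<Rightarrow> complex" where
  "eval_poly f v = (\<Sum>\<alpha>\<in>Poly_Mapping.keys f. Poly_Mapping.lookup f \<alpha> * eval_monomial \<alpha> v)"

definition homogeneous :: "'i set \<Rightarrow> nat \<Rightarrow> 'i cpoly \<Rightarrow> bool" where
  "homogeneous I e f \<longleftrightarrow> Poly_Mapping.keys f \<subseteq> monomials I e"

definition zero_locus :: "'i set \<Rightarrow> 'i cpoly set \<Rightarrow> 'i pt set" where
  "zero_locus I F = {p \<in> proj_space I. \<forall>f\<in>F. \<forall>v\<in>p. eval_poly f v = 0}"

definition zariski_closed :: "'i set \<Rightarrow> 'i pt set \<Rightarrow> bool" where
  "zariski_closed I Z \<longleftrightarrow> (\<exists>F. (\<forall>f\<in>F. \<exists>e. homogeneous I e f) \<and> Z = zero_locus I F)"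

abbreviation zariski_closure :: "'i set \<Rightarrow> 'i pt set \<Rightarrow> 'i pt set" where
  "zariski_closure I S \<equiv> zariski_closed I hull S"

definition irreducible_closed :: "'i set \<Rightarrow> 'i pt set \<Rightarrow> bool" where
  "irreducible_closed I Z \<longleftrightarrow> zariski_closed I Z \<and> Z \<noteq> {} \<and>
     (\<forall>A B. zariski_closed I A \<and> zariski_closed I B \<and> Z = A \<union> B \<longrightarrow> A = Z \<or> B = Z)"

text \<open>Krull dimension of a closed subset; the empty set gets the value 0 here.\<close>

definition proj_dim :: "'i set \<Rightarrow> 'i pt set \<Rightarrow> enat" where
  "proj_dim I Y = Sup {enat n | n. \<exists>Z :: nat \<Rightarrow> 'i pt set.
     (\<forall>k\<le>n. irreducible_closed I (Z k) \<and> Z k \<subseteq> Y) \<and> (\<forall>k<n. Z k \<subset> Z (Suc k))}"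

text \<open>The homogeneous coordinates on the target are indexed by the monomials of degree \<open>d\<close>
  in \<open>x\<^sub>0, \<dots>, x\<^sub>n\<close>.\<close>

abbreviation veronese_index :: "nat \<Rightarrow> nat \<Rightarrow> (nat \<Rightarrow>\<^sub>0 nat) set" where
  "veronese_index n d \<equiv> monomials {..n} d"

definition veronese_map :: "nat \<Rightarrow> nat \<Rightarrow> (nat \<Rightarrow> complex) \<Rightarrow> (nat \<Rightarrow>\<^sub>0 nat) \<Rightarrow> complex" where
  "veronese_map n d x = (\<lambda>\<alpha>. if \<alpha> \<in> veronese_index n d then eval_monomial \<alpha> x else 0)"

definition veronese_variety :: "nat \<Rightarrow> nat \<Rightarrow> (nat \<Rightarrow>\<^sub>0 nat) pt set" where
  "veronese_variety n d =
     {cfun.span {veronese_map n d x} | x. x \<in> coord_space {..n} \<and> x \<noteq> 0}"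

text \<open>Affine \<open>n\<close>-space is \<open>{..<n} \<rightarrow>\<^sub>E UNIV\<close> with its usual (product) topology.\<close>

abbreviation affine_topology :: "nat \<Rightarrow> (nat \<Rightarrow> complex) topology" where
  "affine_topology n \<equiv> product_topology (\<lambda>_. euclidean) {..<n}"

definition partial :: "nat \<Rightarrow> ((nat \<Rightarrow> complex) \<Rightarrow> complex) \<Rightarrow> (nat \<Rightarrow> complex) \<Rightarrow> complex" where
  "partial j f w = deriv (\<lambda>t. f (w(j := t))) (w j)"

fun iter_partial :: "nat list \<Rightarrow> ((nat \<Rightarrow> complex) \<Rightarrow> complex) \<Rightarrow> (nat \<Rightarrow> complex) \<Rightarrow> complex" where
  "iter_partial [] f = f"
| "iter_partial (j # js) f = partial j (iter_partial js f)"

text \<open>A function of several variables is holomorphic iff it has continuous complex partial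
  derivatives of all orders; in one direction this is Osgood's lemma. All orders are asked for
  because \<open>deriv\<close> is meaningful only where the derivative exists.\<close>

definition holomorphic_several :: "nat \<Rightarrow> (nat \<Rightarrow> complex) set \<Rightarrow> ((nat \<Rightarrow> complex) \<Rightarrow> complex) \<Rightarrow> bool" where
  "holomorphic_several n W f \<longleftrightarrow>
     (\<forall>js\<in>lists {..<n}.
        continuous_map (subtopology (affine_topology n) W) euclidean (iter_partial js f) \<and>
        (\<forall>w\<in>W. \<forall>j<n. (\<lambda>t. iter_partial js f (w(j := t))) field_differentiable at (w j)))"

text \<open>The map \<open>\<phi>\<close> lifts a holomorphic embedding of the open set \<open>W\<close> of affine \<open>n\<close>-space onto an
  open subset (in the classical topology) of \<open>X\<close>. The map to projective space is immersive iff
  \<open>\<phi> w\<close> and the first partial derivatives of \<open>\<phi>\<close> at \<open>w\<close> are linearly independent. Such maps exist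
  exactly around the smooth points of \<open>X\<close>, and \<open>n\<close> is then the dimension of \<open>X\<close> there.\<close>

definition local_parametrization ::
  "'i set \<Rightarrow> 'i pt set \<Rightarrow> nat \<Rightarrow> (nat \<Rightarrow> complex) set \<Rightarrow> ((nat \<Rightarrow> complex) \<Rightarrow> 'i \<Rightarrow> complex) \<Rightarrow> bool" where
  "local_parametrization I X n W \<phi> \<longleftrightarrow>
     openin (affine_topology n) W \<and>
     (\<forall>i. holomorphic_several n W (\<lambda>w. \<phi> w i)) \<and>
     (\<forall>w\<in>W. \<phi> w \<in> coord_space I \<and> \<phi> w \<noteq> 0 \<and> cfun.span {\<phi> w} \<in> X) \<and>
     inj_on (\<lambda>w. cfun.span {\<phi> w}) W \<and>
     (\<forall>w\<in>W. \<forall>b c. (\<forall>i. b * \<phi> w i + (\<Sum>j<n. c j * partial j (\<lambda>u. \<phi> u i) w) = 0)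
        \<longrightarrow> b = 0 \<and> (\<forall>j<n. c j = 0)) \<and>
     (\<forall>w\<in>W. \<exists>N. open N \<and> \<phi> w \<in> N \<and>
        (\<forall>v \<in> N \<inter> coord_space I. cfun.span {v} \<in> X
           \<longrightarrow> (\<exists>u\<in>W. cfun.span {v} = cfun.span {\<phi> u})))"

text \<open>The space spanned by the partial derivatives does not depend on the local parametrization,
  so the union below is over equal sets. It is empty if \<open>p\<close> is not a smooth point of \<open>X\<close>.\<close>

definition osculating_space :: "'i set \<Rightarrow> nat \<Rightarrow> 'i pt set \<Rightarrow> 'i pt \<Rightarrow> 'i pt set" where
  "osculating_space I m X p =
     \<Union>{proj_span I {\<lambda>i. iter_partial js (\<lambda>u. \<phi> u i) w | js. js \<in> lists {..<n} \<and> length js \<le> m} | n W \<phi> w.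
          local_parametrization I X n W \<phi> \<and> w \<in> W \<and> p = cfun.span {\<phi> w}}"

text \<open>The closure of the union over a general point of an irreducible \<open>X\<close> is the closure of the
  union over all points of a sufficiently small nonempty open subset. These closures decrease with
  the open subset and become stationary by Noetherianity, so this is the intersection over all
  nonempty open subsets.\<close>

definition osculating_variety :: "'i set \<Rightarrow> nat \<Rightarrow> 'i pt set \<Rightarrow> 'i pt set" where
  "osculating_variety I m X =
     \<Inter>{zariski_closure I (\<Union>p\<in>U. osculating_space I m X p) | U.
          U \<noteq> {} \<and> (\<exists>Z. zariski_closed I Z \<and> U = X - Z)}"

text \<open>Closed subsets of the \<open>(h+1)\<close>-fold product of projective space are the common zero loci of
  multihomogeneous polynomials in variables indexed by \<open>{..h} \<times> I\<close>.\<close>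

definition multihomogeneous :: "'i set \<Rightarrow> nat \<Rightarrow> (nat \<Rightarrow> nat) \<Rightarrow> (nat \<times> 'i) cpoly \<Rightarrow> bool" where
  "multihomogeneous I h e f \<longleftrightarrow>
     (\<forall>\<alpha>\<in>Poly_Mapping.keys f. Poly_Mapping.keys \<alpha> \<subseteq> {..h} \<times> I \<and>
        (\<forall>j\<le>h. (\<Sum>i\<in>I. Poly_Mapping.lookup \<alpha> (j, i)) = e j))"

definition multi_zariski_closed :: "'i set \<Rightarrow> nat \<Rightarrow> (nat \<Rightarrow> 'i pt) set \<Rightarrow> bool" where
  "multi_zariski_closed I h Z \<longleftrightarrow>
     (\<exists>F. (\<forall>f\<in>F. \<exists>e. multihomogeneous I h e f) \<and>
       Z = {q \<in> {..h} \<rightarrow>\<^sub>E proj_space I.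
              \<forall>f\<in>F. \<forall>v. (\<forall>j\<le>h. v j \<in> q j) \<longrightarrow> eval_poly f (\<lambda>(j, i). v j i) = 0})"

text \<open>General \<open>(h+1)\<close>-tuples of points of an irreducible \<open>Y\<close> are treated as general points above.\<close>

definition secant_variety :: "'i set \<Rightarrow> nat \<Rightarrow> 'i pt set \<Rightarrow> 'i pt set" where
  "secant_variety I h Y =
     \<Inter>{zariski_closure I (\<Union>q\<in>U. proj_span I (\<Union>j\<le>h. q j)) | U.
          U \<noteq> {} \<and> (\<exists>Z. multi_zariski_closed I h Z \<and> U = ({..h} \<rightarrow>\<^sub>E Y) - Z)}"

text \<open>Both divisions by 2 are exact.\<close>

definition expected_dim :: "nat \<Rightarrow> nat \<Rightarrow> nat \<Rightarrow> nat" where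
  "expected_dim d m h =
     min (2 * (h + 1) + (h + 1) * ((m + 2) * (m + 1) div 2) - 1) ((d + 2) * (d + 1) div 2 - 1)"

definition osculating_veronese :: "nat \<Rightarrow> nat \<Rightarrow> (nat \<Rightarrow>\<^sub>0 nat) pt set" where
  "osculating_veronese d m = osculating_variety (veronese_index 2 d) m (veronese_variety 2 d)"

definition defective :: "nat \<Rightarrow> nat \<Rightarrow> nat \<Rightarrow> bool" where
  "defective d m h \<longleftrightarrow>
     proj_dim (veronese_index 2 d) (secant_variety (veronese_index 2 d) h (osculating_veronese d m))
       < enat (expected_dim d m h)"

end

(*
  The osculating space of the Veronese surface at L^d is spanned by the forms L^(d-m) F, so the
  secant variety is the closure of the sums of L_l^(d-m) F_l, l = 0..h.  Everything rests on curves
  with prescribed multiplicities at h + 1 points, which exist for all points by counting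
  conditions: the line through 2 points, the conic through 5, the cubic through 7 with one double
  point, and the sextic through 8 double points of which one is triple.

  (II) If the exceptional curve C has D.C <= -2 for the system D of curves of degree d with
  multiplicity m + 1 at the points, then D - C has larger expected dimension than D.  So the
  conditions imposed by the points are dependent, the osculating spaces at h + 1 points are
  dependent, and one linear parameter of the sums above can be dropped.

  (I) Products of the exceptional curves and a curve that exists by counting give a curve of
  degree d with multiplicity m + 2 at the points.  By apolarity it is orthogonal to the tangent
  space of the secant variety (Terracini), so the differential of the parametrization is nowhere
  surjective and the secant variety lies in a hypersurface.

  Krull dimension is bounded through Hilbert functions: along a chain of n + 1 irreducible closed
  sets, multiplication with a form vanishing on one set but not on the next shows that the forms
  of degree e on the last one span a space of dimension at least of order e^n.
*)

theory Submission
  imports Defs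
begin

section \<open>Polynomial functions\<close>

text \<open>Every count is made for all positions of the points, coincident ones included; so for
  upper bounds a single open set suffices in each intersection of closures that defines a variety.
  The exceptional curves C are (-1)-curves on the blown-up plane, hence \<chi>(D) - \<chi>(D - C) =
  D.C + 1, which is the origin of -2; here D.C is d - 2M, 2d - 5M, 3d - 8M or 6d - 17M. Where C
  distinguishes a point, the lower bounds on d come from the sum of its h + 1 versions, which has
  equal multiplicities: degree 3 and multiplicity 2 for three lines, 12 and 5 for six conics, 21 and
  8 for seven cubics, 48 and 17 for eight sextics. The obstacle in (II) is that the redundant
  parameter varies with the points. Forms are therefore tested on finitely many maps at once, one
  for each dropped parameter, and Hilbert functions tolerate such a finite union. In (I) there are
  enough parameters to fill the space, so the degenerate differential has to be turned into an
  algebraic relation; this is the Jacobian criterion, and it uses characteristic 0.\<close>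

abbreviation (input) lookup :: "('i \<Rightarrow>\<^sub>0 'b::zero) \<Rightarrow> 'i \<Rightarrow> 'b" where
  "lookup \<equiv> Poly_Mapping.lookup"

abbreviation (input) keys :: "('i \<Rightarrow>\<^sub>0 'b::zero) \<Rightarrow> 'i set" where
  "keys \<equiv> Poly_Mapping.keys"

abbreviation (input) single :: "'i \<Rightarrow> 'b \<Rightarrow> 'i \<Rightarrow>\<^sub>0 'b::zero" where
  "single \<equiv> Poly_Mapping.single"

text \<open>All existence arguments by counting rest on this: curves, dependencies of osculating
  vectors, forms vanishing on an image, algebraic relations, tangent vectors. The proof is Gaussian
  elimination, one equation at a time.\<close>

lemma underdetermined_system:
  fixes a :: "'t \<Rightarrow> 'x \<Rightarrow> 'k :: field"
  assumes "finite T" "finite A" "card T < card A"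
  shows "\<exists>c. (\<exists>x\<in>A. c x \<noteq> 0) \<and> (\<forall>t\<in>T. (\<Sum>x\<in>A. c x * a t x) = 0)"
  using assms
proof (induction T arbitrary: A a rule: finite_induct)
  case empty
  then have "A \<noteq> {}" by auto
  then show ?case by (intro exI[of _ "\<lambda>_. 1"] conjI) auto
next
  case (insert t T)
  show ?case
  proof (cases "\<forall>x\<in>A. a t x = 0")
    case True
    from insert have "card T < card A" by simp
    from insert.IH[OF \<open>finite A\<close> this, of a] obtain c
      where "\<exists>x\<in>A. c x \<noteq> 0" "\<forall>s\<in>T. (\<Sum>x\<in>A. c x * a s x) = 0" by blast
    with True show ?thesis by (intro exI[of _ c]) simp
  next
    case False
    then obtain y where y: "y \<in> A" "a t y \<noteq> 0" by auto
    \<comment> \<open>Equation \<open>s\<close> after the unknown \<open>y\<close> has been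
      eliminated by means of equation \<open>t\<close>; \<open>c'\<close> below recovers
      \<open>y\<close> from equation \<open>t\<close>.\<close>
    define b where "b s x = a s x - a s y * a t x / a t y" for s x
    have "card T < card (A - {y})" using insert y by simp
    from insert.IH[OF _ this, of b] insert.prems obtain c
      where c: "\<exists>x\<in>A - {y}. c x \<noteq> 0" "\<forall>s\<in>T. (\<Sum>x\<in>A - {y}. c x * b s x) = 0" by auto
    define c' where "c' = c(y := - (\<Sum>x\<in>A - {y}. c x * a t x) / a t y)"
    have split: "(\<Sum>x\<in>A. c' x * a s x) = (\<Sum>x\<in>A - {y}. c x * a s x) + c' y * a s y" for s
    proof -
      have "(\<Sum>x\<in>A. c' x * a s x) = c' y * a s y + (\<Sum>x\<in>A - {y}. c' x * a s x)"
        using y insert.prems by (subst sum.remove[of A y]) auto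
      also have "(\<Sum>x\<in>A - {y}. c' x * a s x) = (\<Sum>x\<in>A - {y}. c x * a s x)"
        by (intro sum.cong) (auto simp: c'_def)
      finally show ?thesis by simp
    qed
    have "(\<Sum>x\<in>A. c' x * a s x) = 0" if "s \<in> insert t T" for s
    proof (cases "s = t")
      case True
      then show ?thesis using y by (simp add: split) (simp add: c'_def)
    next
      case False
      with that c(2) have "0 = (\<Sum>x\<in>A - {y}. c x * b s x)" by simp
      also have "\<dots> = (\<Sum>x\<in>A - {y}. c x * a s x - c x * a t x * (a s y / a t y))"
        by (intro sum.cong) (auto simp: b_def algebra_simps)
      also have "\<dots> = (\<Sum>x\<in>A. c' x * a s x)"
        unfolding split by (simp add: c'_def sum_subtractf sum_distrib_right sum_divide_distrib)
      finally show ?thesis by simp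
    qed
    moreover have "\<exists>x\<in>A. c' x \<noteq> 0" using c(1) by (auto simp: c'_def)
    ultimately show ?thesis by blast
  qed
qed

section \<open>Degrees and values of monomials\<close>

definition mdeg :: "('i \<Rightarrow>\<^sub>0 nat) \<Rightarrow> nat" where
  "mdeg \<alpha> = (\<Sum>i\<in>keys \<alpha>. lookup \<alpha> i)"

lemma mdeg_eq_sum:
  assumes "finite J" "keys \<alpha> \<subseteq> J"
  shows "mdeg \<alpha> = (\<Sum>i\<in>J. lookup \<alpha> i)"
  unfolding mdeg_def by (rule sum.mono_neutral_left) (use assms in \<open>auto simp: in_keys_iff\<close>)

lemma keys_add_nat:
  "keys (\<alpha> + \<beta> :: 'i \<Rightarrow>\<^sub>0 nat) = keys \<alpha> \<union> keys \<beta>"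
  by (auto simp: in_keys_iff lookup_add)

lemma mdeg_add: "mdeg (\<alpha> + \<beta>) = mdeg \<alpha> + mdeg \<beta>"
  by (simp add: mdeg_eq_sum[of "keys \<alpha> \<union> keys \<beta>"] keys_add_nat lookup_add
      sum.distrib)

lemma mdeg_0 [simp]: "mdeg 0 = 0"
  by (simp add: mdeg_def)

lemma mdeg_single [simp]: "mdeg (single i k) = k"
  by (simp add: mdeg_def)

lemma monomials_altdef: "monomials I e = {\<alpha>. keys \<alpha> \<subseteq> I \<and> mdeg \<alpha> = e}"
  by (simp add: monomials_def mdeg_def)

lemma eval_monomial_eq_prod:
  assumes "finite J" "keys \<alpha> \<subseteq> J"
  shows "eval_monomial \<alpha> v = (\<Prod>i\<in>J. v i ^ lookup \<alpha> i)"
  unfolding eval_monomial_def by (rule prod.mono_neutral_left) (use assms in \<open>auto simp: in_keys_iff\<close>)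

lemma eval_monomial_add: "eval_monomial (\<alpha> + \<beta>) v = eval_monomial \<alpha> v * eval_monomial \<beta> v"
  by (simp add: eval_monomial_eq_prod[of "keys \<alpha> \<union> keys \<beta>"] keys_add_nat lookup_add
      power_add prod.distrib)

lemma eval_monomial_0 [simp]: "eval_monomial 0 v = 1"
  by (simp add: eval_monomial_def)

lemma eval_monomial_single [simp]: "eval_monomial (single i k) v = v i ^ k"
  by (simp add: eval_monomial_def)

lemma eval_monomial_cong:
  "(\<And>i. i \<in> keys \<alpha> \<Longrightarrow> u i = v i) \<Longrightarrow> eval_monomial \<alpha> u = eval_monomial \<alpha> v"
  by (simp add: eval_monomial_def)

lemma eval_monomial_scale: "eval_monomial \<alpha> (\<lambda>i. c * v i) = c ^ mdeg \<alpha> * eval_monomial \<alpha> v"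
  by (simp add: eval_monomial_def mdeg_def power_mult_distrib prod.distrib power_sum)

lemma eval_poly_eq_sum:
  assumes "finite K" "keys f \<subseteq> K"
  shows "eval_poly f v = (\<Sum>\<alpha>\<in>K. lookup f \<alpha> * eval_monomial \<alpha> v)"
  unfolding eval_poly_def by (rule sum.mono_neutral_left) (use assms in \<open>auto simp: in_keys_iff\<close>)

lemma eval_poly_0 [simp]: "eval_poly 0 v = 0"
  by (simp add: eval_poly_def)

lemma eval_poly_single [simp]: "eval_poly (single \<alpha> c) v = c * eval_monomial \<alpha> v"
  by (simp add: eval_poly_def)

lemma eval_poly_add: "eval_poly (f + g) v = eval_poly f v + eval_poly g v"
  using keys_add[of f g]
  by (simp add: eval_poly_eq_sum[of "keys f \<union> keys g"] lookup_add
      distrib_right sum.distrib)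

lemma poly_mapping_sum_single:
  "f = (\<Sum>\<alpha>\<in>keys f. single \<alpha> (lookup f \<alpha>))"
proof (rule poly_mapping_eqI)
  fix \<beta>
  show "lookup f \<beta> =
    lookup (\<Sum>\<alpha>\<in>keys f. single \<alpha> (lookup f \<alpha>)) \<beta>"
    by (cases "\<beta> \<in> keys f") (auto simp: lookup_sum lookup_single when_def in_keys_iff)
qed

lemma eval_poly_sum: "eval_poly (sum f A) v = (\<Sum>x\<in>A. eval_poly (f x) v)"
  by (induction A rule: infinite_finite_induct) (auto simp: eval_poly_add)

lemma eval_poly_mult: "eval_poly (f * g) v = eval_poly f v * eval_poly g v"
proof -
  have "eval_poly (f * g) v =
    eval_poly ((\<Sum>\<alpha>\<in>keys f. single \<alpha> (lookup f \<alpha>)) *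
      (\<Sum>\<beta>\<in>keys g. single \<beta> (lookup g \<beta>))) v"
    unfolding poly_mapping_sum_single[of f, symmetric] poly_mapping_sum_single[of g, symmetric] ..
  also have "\<dots> = eval_poly f v * eval_poly g v"
    by (simp add: sum_product mult_single eval_poly_sum eval_monomial_add eval_poly_def[of f]
        eval_poly_def[of g] mult_ac)
  finally show ?thesis .
qed

text \<open>Polynomials are treated as functions because they get translated, restricted and
  composed; over an infinite field the coefficients are still determined. The set \<open>A\<close>
  of admissible exponents makes forms, polynomials of bounded degree and polynomials of given order
  at the origin instances of one notion.\<close>

definition polyfuns :: "('i \<Rightarrow>\<^sub>0 nat) set \<Rightarrow> (('i \<Rightarrow> complex) \<Rightarrow> complex) set" where
  "polyfuns A = {eval_poly f | f. keys f \<subseteq> A}"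

lemma polyfuns_mono: "A \<subseteq> B \<Longrightarrow> polyfuns A \<subseteq> polyfuns B"
  by (auto simp: polyfuns_def)

lemma polyfuns_0: "(\<lambda>v. 0) \<in> polyfuns A"
  unfolding polyfuns_def by (intro CollectI exI[of _ 0]) auto

lemma polyfuns_add: "f \<in> polyfuns A \<Longrightarrow> g \<in> polyfuns A \<Longrightarrow> (\<lambda>v. f v + g v) \<in> polyfuns A"
proof -
  assume "f \<in> polyfuns A" "g \<in> polyfuns A"
  then obtain F G where "f = eval_poly F" "g = eval_poly G"
    "keys F \<subseteq> A" "keys G \<subseteq> A" by (auto simp: polyfuns_def)
  moreover have "keys (F + G) \<subseteq> A" using keys_add[of F G] calculation by blast
  moreover have "(\<lambda>v. f v + g v) = eval_poly (F + G)" using calculation by (auto simp: eval_poly_add)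
  ultimately show ?thesis unfolding polyfuns_def by blast
qed

lemma polyfuns_sum:
  "(\<And>x. x \<in> X \<Longrightarrow> f x \<in> polyfuns A) \<Longrightarrow> (\<lambda>v. \<Sum>x\<in>X. f x v) \<in> polyfuns A"
  by (induction X rule: infinite_finite_induct) (simp_all add: polyfuns_0 polyfuns_add)

lemma polyfuns_mult:
  assumes "f \<in> polyfuns A" "g \<in> polyfuns B" "\<And>\<alpha> \<beta>. \<alpha> \<in> A \<Longrightarrow> \<beta> \<in> B \<Longrightarrow> \<alpha> + \<beta> \<in> C"
  shows "(\<lambda>v. f v * g v) \<in> polyfuns C"
proof -
  obtain F G where *: "f = eval_poly F" "g = eval_poly G"
    "keys F \<subseteq> A" "keys G \<subseteq> B" using assms by (auto simp: polyfuns_def)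
  have "keys (F * G) \<subseteq> C" using keys_mult[of F G] * assms(3) by blast
  moreover have "(\<lambda>v. f v * g v) = eval_poly (F * G)" using * by (auto simp: eval_poly_mult)
  ultimately show ?thesis unfolding polyfuns_def by blast
qed

lemma polyfuns_monomial: "\<alpha> \<in> A \<Longrightarrow> (\<lambda>v. c * eval_monomial \<alpha> v) \<in> polyfuns A"
  unfolding polyfuns_def by (intro CollectI exI[of _ "single \<alpha> c"]) auto

lemma polyfuns_const: "0 \<in> A \<Longrightarrow> (\<lambda>v. c) \<in> polyfuns A"
  using polyfuns_monomial[of 0 A c] by simp

lemma polyfuns_cmult: "f \<in> polyfuns A \<Longrightarrow> (\<lambda>v. c * f v) \<in> polyfuns A"
  by (rule polyfuns_mult[of "\<lambda>_. c" "{0}"]) (auto intro: polyfuns_const)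

lemma polyfuns_expand:
  assumes "f \<in> polyfuns A" "finite A"
  obtains c where "\<And>v. f v = (\<Sum>\<alpha>\<in>A. c \<alpha> * eval_monomial \<alpha> v)"
proof -
  obtain F where F: "f = eval_poly F" "keys F \<subseteq> A" using assms(1) by (auto simp: polyfuns_def)
  show ?thesis by (rule that[of "lookup F"]) (simp add: F eval_poly_eq_sum[OF assms(2)])
qed

lemma polyfuns_expand_finite:
  assumes "f \<in> polyfuns A"
  obtains c K where "finite K" "K \<subseteq> A" "\<And>v. f v = (\<Sum>\<alpha>\<in>K. c \<alpha> * eval_monomial \<alpha> v)"
proof -
  obtain F where F: "f = eval_poly F" "keys F \<subseteq> A" using assms(1) by (auto simp: polyfuns_def)
  show ?thesis
    by (rule that[of "keys F" "lookup F"]) (simp_all add: F eval_poly_def)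
qed

lemma polyfuns_induct [consumes 1, case_names monomial zero add]:
  assumes "f \<in> polyfuns A"
    "\<And>c \<alpha>. \<alpha> \<in> A \<Longrightarrow> P (\<lambda>v. c * eval_monomial \<alpha> v)"
    "P (\<lambda>v. 0)"
    "\<And>f g. P f \<Longrightarrow> P g \<Longrightarrow> P (\<lambda>v. f v + g v)"
  shows "P f"
proof -
  from assms(1) obtain c K where K: "finite K" "K \<subseteq> A" "\<And>v. f v = (\<Sum>\<alpha>\<in>K. c \<alpha> * eval_monomial \<alpha> v)"
    by (rule polyfuns_expand_finite) (rule that)
  have "P (\<lambda>v. \<Sum>\<alpha>\<in>K. c \<alpha> * eval_monomial \<alpha> v)"
    using K(1,2)
  proof (induction K rule: finite_induct)
    case empty
    then show ?case using assms(3) by simp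
  next
    case (insert \<alpha> K)
    then show ?case using assms(4)[OF assms(2)[of \<alpha> "c \<alpha>"], of "\<lambda>v. \<Sum>\<alpha>\<in>K. c \<alpha> * eval_monomial \<alpha> v"]
      by simp
  qed
  moreover have "f = (\<lambda>v. \<Sum>\<alpha>\<in>K. c \<alpha> * eval_monomial \<alpha> v)" using K by auto
  ultimately show ?thesis by simp
qed

lemma polyfuns_cong:
  assumes "f \<in> polyfuns A" "\<And>\<alpha> i. \<alpha> \<in> A \<Longrightarrow> i \<in> keys \<alpha> \<Longrightarrow> u i = v i"
  shows "f u = f v"
  using assms(1)
proof (induction rule: polyfuns_induct)
  case (monomial c \<alpha>)
  then show ?case using eval_monomial_cong[of \<alpha> u v] assms(2) by simp
qed simp_all

lemma polyfuns_pow: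
  assumes "f \<in> polyfuns (A (1::nat))" "0 \<in> A 0" "\<And>a b \<alpha> \<beta>. \<alpha> \<in> A a \<Longrightarrow> \<beta> \<in> A b \<Longrightarrow> \<alpha> + \<beta> \<in> A (a + b)"
  shows "(\<lambda>v. f v ^ k) \<in> polyfuns (A k)"
proof (induction k)
  case 0
  then show ?case using assms by (auto intro: polyfuns_const)
next
  case (Suc k)
  show ?case unfolding power_Suc by (rule polyfuns_mult[OF assms(1) Suc]) (use assms(3)[of _ 1 _ k] in auto)
qed

text \<open>\<open>A\<close> acts as a grading of exponents: if the coordinates of \<Phi> lie in
  level 1, a monomial of degree e in them lies in level e. The levels used later are graded boxes,
  cubes, degree bounds and the constant family \<open>UNIV\<close>.\<close>

lemma polyfuns_compose:
  assumes f: "f \<in> polyfuns B"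
    and \<Phi>: "\<And>\<beta> i. \<beta> \<in> B \<Longrightarrow> i \<in> keys \<beta> \<Longrightarrow> (\<lambda>u. \<Phi> u i) \<in> polyfuns (A (1::nat))"
    and A: "0 \<in> A 0" "\<And>a b \<alpha> \<beta>. \<alpha> \<in> A a \<Longrightarrow> \<beta> \<in> A b \<Longrightarrow> \<alpha> + \<beta> \<in> A (a + b)"
    and B: "\<And>\<beta>. \<beta> \<in> B \<Longrightarrow> A (mdeg \<beta>) \<subseteq> C"
  shows "(\<lambda>u. f (\<Phi> u)) \<in> polyfuns C"
  using f
proof (induction rule: polyfuns_induct)
  case (monomial c \<beta>)
  have "(\<lambda>u. \<Prod>i\<in>K. \<Phi> u i ^ lookup \<beta> i) \<in> polyfuns (A (\<Sum>i\<in>K. lookup \<beta> i))"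
    if "finite K" "K \<subseteq> keys \<beta>" for K
    using that
  proof (induction K rule: finite_induct)
    case empty
    then show ?case using A by (auto intro: polyfuns_const)
  next
    case (insert i K)
    have "(\<lambda>u. \<Phi> u i ^ lookup \<beta> i) \<in> polyfuns (A (lookup \<beta> i))"
      by (rule polyfuns_pow) (use \<Phi> monomial insert A in auto)
    then have "(\<lambda>u. \<Phi> u i ^ lookup \<beta> i * (\<Prod>i\<in>K. \<Phi> u i ^ lookup \<beta> i))
       \<in> polyfuns (A (lookup \<beta> i + (\<Sum>i\<in>K. lookup \<beta> i)))"
      by (rule polyfuns_mult) (use insert A in auto)
    then show ?case using insert by simp
  qed
  from this[of "keys \<beta>"] have "(\<lambda>u. eval_monomial \<beta> (\<Phi> u)) \<in> polyfuns (A (mdeg \<beta>))"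
    by (simp add: eval_monomial_def mdeg_def)
  then have "(\<lambda>u. c * eval_monomial \<beta> (\<Phi> u)) \<in> polyfuns (A (mdeg \<beta>))" by (rule polyfuns_cmult)
  with B[OF monomial] show ?case using polyfuns_mono by blast
qed (simp_all add: polyfuns_0 polyfuns_add)

lemma eval_monomial_split:
  "eval_monomial \<alpha> v = v j ^ lookup \<alpha> j * eval_monomial (Poly_Mapping.update j 0 \<alpha>) v"
proof (cases "j \<in> keys \<alpha>")
  case True
  have "eval_monomial (Poly_Mapping.update j 0 \<alpha>) v =
    (\<Prod>i\<in>keys \<alpha> - {j}. v i ^ lookup \<alpha> i)"
    unfolding eval_monomial_def by (rule prod.cong) (auto simp: keys_update lookup_update)
  then show ?thesis using True by (simp add: eval_monomial_def prod.remove)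
next
  case False
  then have "Poly_Mapping.update j 0 \<alpha> = \<alpha>"
    by (intro poly_mapping_eqI) (auto simp: lookup_update in_keys_iff)
  with False show ?thesis by (simp add: in_keys_iff)
qed

text \<open>Induction on the variables. Letting coordinate \<open>j\<close> vary freely turns the
  sum into a univariate polynomial; each of its coefficients vanishes and is again a sum of
  monomials in the remaining variables.\<close>

lemma eval_monomial_independent:
  assumes "finite J" "finite K" "\<And>\<alpha>. \<alpha> \<in> K \<Longrightarrow> keys \<alpha> \<subseteq> J"
    and "\<And>v. (\<Sum>\<alpha>\<in>K. c \<alpha> * eval_monomial \<alpha> v) = 0" and "\<alpha> \<in> K"
  shows "c \<alpha> = 0"
  using assms
proof (induction J arbitrary: K c \<alpha> rule: finite_induct)
  case empty
  then have "K = {0}" by auto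
  with empty show ?case by simp
next
  case (insert j J)
  define up where "up = Poly_Mapping.update j (0::nat)"
  define k where "k = lookup \<alpha> j"
  define L where "L k = {\<beta>\<in>K. lookup \<beta> j = k}" for k
  obtain B where B: "\<And>\<beta>. \<beta> \<in> K \<Longrightarrow> lookup \<beta> j \<le> B"
    using finite_imageI[OF \<open>finite K\<close>, of "\<lambda>\<beta>. lookup \<beta> j"]
    by (meson finite_nat_set_iff_bounded_le imageI)
  have keys_up: "keys (up \<beta>) \<subseteq> J" if "\<beta> \<in> K" for \<beta>
    using insert.prems(2)[OF that] by (auto simp: up_def keys_update)
  \<comment> \<open>On a slice with fixed exponent of \<open>j\<close>, erasing that exponent loses
    nothing, so the slice can be reindexed by monomials over \<open>J\<close>.\<close>
  have inj: "inj_on up (L k)"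
  proof (rule inj_onI)
    fix x y assume xy: "x \<in> L k" "y \<in> L k" "up x = up y"
    show "x = y"
    proof (rule poly_mapping_eqI)
      fix i
      show "lookup x i = lookup y i"
      proof (cases "i = j")
        case True
        with xy show ?thesis by (simp add: L_def)
      next
        case False
        with arg_cong[OF xy(3), of "\<lambda>z. lookup z i"] show ?thesis
          by (simp add: up_def lookup_update)
      qed
    qed
  qed
  have zero: "(\<Sum>\<beta>\<in>L k. c \<beta> * eval_monomial (up \<beta>) v) = 0" if "k \<le> B" for v k
  proof -
    have "(\<Sum>k\<le>B. (\<Sum>\<beta>\<in>L k. c \<beta> * eval_monomial (up \<beta>) v) * t ^ k) = 0" for t
    proof -
      have "0 = (\<Sum>\<beta>\<in>K. c \<beta> * eval_monomial \<beta> (v(j := t)))" using insert.prems by simp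
      also have "\<dots> = (\<Sum>\<beta>\<in>K. c \<beta> * eval_monomial (up \<beta>) v * t ^ lookup \<beta> j)"
      proof (rule sum.cong[OF refl], goal_cases)
        case (1 \<beta>)
        have "eval_monomial (up \<beta>) (v(j := t)) = eval_monomial (up \<beta>) v"
          by (rule eval_monomial_cong) (use keys_up[OF 1] insert in auto)
        then show ?case by (subst eval_monomial_split[of _ _ j]) (simp flip: up_def)
      qed
      also have "\<dots> = (\<Sum>k\<le>B. (\<Sum>\<beta>\<in>L k. c \<beta> * eval_monomial (up \<beta>) v * t ^ lookup \<beta> j))"
        unfolding L_def using B insert.prems by (intro sum.group[symmetric]) auto
      also have "\<dots> = (\<Sum>k\<le>B. (\<Sum>\<beta>\<in>L k. c \<beta> * eval_monomial (up \<beta>) v) * t ^ k)"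
        by (intro sum.cong refl) (auto simp: L_def sum_distrib_right intro!: sum.cong)
      finally show ?thesis by simp
    qed
    then have "\<forall>k\<le>B. (\<Sum>\<beta>\<in>L k. c \<beta> * eval_monomial (up \<beta>) v) = 0"
      using polyfun_eq_0[of "\<lambda>k. \<Sum>\<beta>\<in>L k. c \<beta> * eval_monomial (up \<beta>) v" B] by simp
    with that show ?thesis by simp
  qed
  have "c (the_inv_into (L k) up (up \<alpha>)) = 0"
  proof (rule insert.IH[of "up ` L k" "\<lambda>\<gamma>. c (the_inv_into (L k) up \<gamma>)" "up \<alpha>"])
    show "finite (up ` L k)" using insert.prems by (simp add: L_def)
    show "keys \<gamma> \<subseteq> J" if "\<gamma> \<in> up ` L k" for \<gamma> using that keys_up by (auto simp: L_def)
    show "up \<alpha> \<in> up ` L k" using insert.prems by (auto simp: L_def k_def)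
    fix v
    have "(\<Sum>\<gamma>\<in>up ` L k. c (the_inv_into (L k) up \<gamma>) * eval_monomial \<gamma> v) =
      (\<Sum>\<beta>\<in>L k. c \<beta> * eval_monomial (up \<beta>) v)"
      by (subst sum.reindex[OF inj]) (auto intro!: sum.cong simp: the_inv_into_f_f[OF inj])
    also have "\<dots> = 0" using zero B insert.prems by (auto simp: k_def)
    finally show "(\<Sum>\<gamma>\<in>up ` L k. c (the_inv_into (L k) up \<gamma>) * eval_monomial \<gamma> v) = 0" .
  qed
  then show ?case using insert.prems by (subst (asm) the_inv_into_f_f[OF inj]) (auto simp: L_def k_def)
qed

lemma polyfuns_line:
  assumes "f \<in> polyfuns A"
  shows "\<exists>p. \<forall>t. poly p t = f (\<lambda>i. a i + t * b i)"
  using assms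
proof (induction rule: polyfuns_induct)
  case (monomial c \<alpha>)
  show ?case
    by (rule exI[of _ "[:c:] * (\<Prod>i\<in>keys \<alpha>. [:a i, b i:] ^ lookup \<alpha> i)"])
      (simp add: poly_prod eval_monomial_def)
next
  case zero
  then show ?case by (intro exI[of _ 0]) simp
next
  case (add f g)
  then show ?case by (metis poly_add)
qed

text \<open>Restricted to the line through \<open>x\<close> and \<open>y\<close>, both functions
  become nonzero univariate polynomials. The witness is kept on this line because it then stays in
  every linear subspace containing \<open>x\<close> and \<open>y\<close>.\<close>

lemma polyfuns_no_zero_divisors:
  assumes "f \<in> polyfuns A" "g \<in> polyfuns B" "f x \<noteq> 0" "g y \<noteq> 0"
  shows "\<exists>t. f (\<lambda>i. x i + t * (y i - x i)) * g (\<lambda>i. x i + t * (y i - x i)) \<noteq> 0"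
proof -
  obtain p q where pq: "\<And>t. poly p t = f (\<lambda>i. x i + t * (y i - x i))"
    "\<And>t. poly q t = g (\<lambda>i. x i + t * (y i - x i))"
    using polyfuns_line[OF assms(1), of x "\<lambda>i. y i - x i"] polyfuns_line[OF assms(2), of x "\<lambda>i. y i - x i"]
    by metis
  from pq(1)[of 0] pq(2)[of 1] assms have "p \<noteq> 0" "q \<noteq> 0" by auto
  then have "p * q \<noteq> 0" by simp
  then obtain t where "poly (p * q) t \<noteq> 0" using poly_all_0_iff_0 by blast
  with pq show ?thesis by auto
qed

lemma polyfuns_prod_nonzero:
  assumes "finite K" "\<And>k. k \<in> K \<Longrightarrow> f k \<in> polyfuns A" "\<And>k. k \<in> K \<Longrightarrow> \<exists>v. f k v \<noteq> 0"
  shows "\<exists>v. \<forall>k\<in>K. f k v \<noteq> 0"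
proof -
  have "(\<lambda>v. \<Prod>k\<in>K. f k v) \<in> polyfuns UNIV \<and> (\<exists>v. (\<Prod>k\<in>K. f k v) \<noteq> 0)"
    using assms
  proof (induction K rule: finite_induct)
    case empty
    then show ?case by (auto intro: polyfuns_const)
  next
    case (insert k K)
    then have 1: "f k \<in> polyfuns A" "(\<lambda>v. \<Prod>k\<in>K. f k v) \<in> polyfuns UNIV" by simp_all
    obtain x where "f k x \<noteq> 0" using insert.prems by blast
    moreover obtain y where "(\<Prod>k\<in>K. f k y) \<noteq> 0" using insert by auto
    ultimately
    have "\<exists>v. f k v * (\<Prod>k\<in>K. f k v) \<noteq> 0"
      using polyfuns_no_zero_divisors[OF 1] by blast
    moreover have "(\<lambda>v. f k v * (\<Prod>k\<in>K. f k v)) \<in> polyfuns UNIV"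
      by (rule polyfuns_mult[OF 1]) simp
    ultimately show ?case using insert.hyps by simp
  qed
  then show ?thesis using assms by auto
qed

section \<open>Krull dimension and Hilbert functions\<close>

abbreviation forms :: "'i set \<Rightarrow> nat \<Rightarrow> (('i \<Rightarrow> complex) \<Rightarrow> complex) set" where
  "forms I e \<equiv> polyfuns (monomials I e)"

definition vanishes :: "(('i \<Rightarrow> complex) \<Rightarrow> complex) \<Rightarrow> 'i pt set \<Rightarrow> bool" where
  "vanishes f Y \<longleftrightarrow> (\<forall>p\<in>Y. \<forall>v\<in>p. f v = 0)"

lemma monomials_0: "monomials I 0 = {0}"
proof -
  have "\<alpha> = 0" if "mdeg \<alpha> = 0" for \<alpha> :: "'i \<Rightarrow>\<^sub>0 nat"
  proof (rule poly_mapping_eqI)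
    fix i
    show "lookup \<alpha> i = lookup 0 i"
      using that by (cases "i \<in> keys \<alpha>") (auto simp: mdeg_def in_keys_iff)
  qed
  then show ?thesis by (auto simp: monomials_altdef)
qed

lemma forms_mult: "f \<in> forms I a \<Longrightarrow> g \<in> forms I b \<Longrightarrow> (\<lambda>v. f v * g v) \<in> forms I (a + b)"
  by (rule polyfuns_mult) (auto simp: monomials_altdef keys_add_nat mdeg_add)

lemma forms_power:
  assumes "f \<in> forms I a"
  shows "(\<lambda>v. f v ^ k) \<in> forms I (a * k)"
proof (induction k)
  case 0
  then show ?case by (auto simp: monomials_0 intro: polyfuns_const)
next
  case (Suc k)
  from forms_mult[OF assms Suc] show ?case by simp
qed

lemma forms_coord: "i \<in> I \<Longrightarrow> (\<lambda>v. v i) \<in> forms I 1"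
  using polyfuns_monomial[of "single i 1" "monomials I 1" 1]
  by (simp add: monomials_altdef)

lemma forms_scale:
  assumes "f \<in> forms I e"
  shows "f (\<lambda>i. c * v i) = c ^ e * f v"
  using assms
  by (induction rule: polyfuns_induct) (simp_all add: eval_monomial_scale monomials_altdef distrib_left)

lemma forms_cong: "f \<in> forms I e \<Longrightarrow> (\<And>i. i \<in> I \<Longrightarrow> u i = v i) \<Longrightarrow> f u = f v"
  by (rule polyfuns_cong[of f "monomials I e" u v]) (auto simp: monomials_altdef)

lemma line_altdef: "cfun.span {v} = range (\<lambda>c i. c * v i)"
  by (simp add: cfun.span_singleton)

lemma proj_spaceE:
  assumes "p \<in> proj_space I"
  obtains v where "v \<in> coord_space I" "v \<noteq> 0" "v \<in> p" "p = range (\<lambda>c i. c * v i)"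
proof -
  obtain v where v: "v \<in> coord_space I" "v \<noteq> 0" "p = cfun.span {v}" using assms by (auto simp: proj_space_def)
  moreover have "v \<in> p" unfolding v by (rule cfun.span_base) simp
  ultimately show ?thesis using that by (simp add: line_altdef)
qed

lemma proj_space_subset_coord: "p \<in> proj_space I \<Longrightarrow> p \<subseteq> coord_space I"
  by (erule proj_spaceE) (auto simp: coord_space_def)

lemma coord_space_mem_point:
  assumes "I \<noteq> {}" "v \<in> coord_space I"
  shows "\<exists>p\<in>proj_space I. v \<in> p"
proof (cases "v = 0")
  case False
  then show ?thesis using assms by (intro bexI[of _ "cfun.span {v}"]) (auto simp: proj_space_def intro: cfun.span_base)
next
  case True
  obtain i where "i \<in> I" using assms by auto
  define b where "b = (\<lambda>j. if j = i then 1 else 0 :: complex)"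
  have "b i \<noteq> 0" by (simp add: b_def)
  then have "b \<noteq> 0" by (metis zero_fun_apply)
  moreover have "b \<in> coord_space I" using \<open>i \<in> I\<close> by (auto simp: coord_space_def b_def)
  ultimately have "cfun.span {b} \<in> proj_space I" unfolding proj_space_def by blast
  moreover have "v \<in> cfun.span {b}" using True cfun.span_zero by simp
  ultimately show ?thesis by blast
qed

section \<open>Closed sets and irreducibility in terms of forms\<close>

lemma forms_eq_homogeneous: "forms I e = {eval_poly f | f. homogeneous I e f}"
  by (simp add: polyfuns_def homogeneous_def)

lemma zariski_closed_subset: "zariski_closed I Z \<Longrightarrow> Z \<subseteq> proj_space I"
  by (auto simp: zariski_closed_def zero_locus_def)

lemma zariski_closed_form:
  assumes "f \<in> forms I e"
  shows "zariski_closed I {p \<in> proj_space I. \<forall>v\<in>p. f v = 0}"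
proof -
  obtain F where "homogeneous I e F" "f = eval_poly F" using assms by (auto simp: forms_eq_homogeneous)
  then show ?thesis unfolding zariski_closed_def by (intro exI[of _ "{F}"]) (auto simp: zero_locus_def)
qed

lemma zariski_closed_Int: "zariski_closed I A \<Longrightarrow> zariski_closed I B \<Longrightarrow> zariski_closed I (A \<inter> B)"
proof -
  assume "zariski_closed I A" "zariski_closed I B"
  then obtain F G where "\<forall>f\<in>F. \<exists>e. homogeneous I e f" "A = zero_locus I F"
    "\<forall>f\<in>G. \<exists>e. homogeneous I e f" "B = zero_locus I G" by (auto simp: zariski_closed_def)
  then show ?thesis unfolding zariski_closed_def by (intro exI[of _ "F \<union> G"]) (auto simp: zero_locus_def)
qed

lemma zariski_closed_proj_space: "zariski_closed I (proj_space I)"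
  unfolding zariski_closed_def by (intro exI[of _ "{}"]) (simp add: zero_locus_def)

lemma zariski_closed_separate:
  assumes "zariski_closed I Z" "p \<in> proj_space I" "p \<notin> Z"
  obtains e f v where "f \<in> forms I e" "vanishes f Z" "v \<in> p" "f v \<noteq> 0"
proof -
  obtain F where F: "\<forall>f\<in>F. \<exists>e. homogeneous I e f" "Z = zero_locus I F"
    using assms(1) by (auto simp: zariski_closed_def)
  with assms(2,3) obtain f v where f: "f \<in> F" "v \<in> p" "eval_poly f v \<noteq> 0"
    by (auto simp: zero_locus_def)
  with F obtain e where "homogeneous I e f" by blast
  then have "eval_poly f \<in> forms I e" by (auto simp: forms_eq_homogeneous)
  moreover have "vanishes (eval_poly f) Z" using F f by (auto simp: vanishes_def zero_locus_def)
  ultimately show ?thesis using that f by blast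
qed

lemma vanishes_hull:
  assumes "f \<in> forms I e" "vanishes f Y" "Y \<subseteq> proj_space I"
  shows "vanishes f (zariski_closure I Y)"
proof -
  have "zariski_closure I Y \<subseteq> {p \<in> proj_space I. \<forall>v\<in>p. f v = 0}"
    using assms by (intro hull_minimal zariski_closed_form) (auto simp: vanishes_def)
  then show ?thesis by (auto simp: vanishes_def)
qed

lemma irreducible_closed_mult:
  assumes "irreducible_closed I Z" "f \<in> forms I a" "g \<in> forms I b" "vanishes (\<lambda>v. f v * g v) Z"
  shows "vanishes f Z \<or> vanishes g Z"
proof -
  let ?V = "\<lambda>f. {p \<in> proj_space I. \<forall>v\<in>p. f v = 0}"
  have Z: "zariski_closed I Z" using assms(1) by (simp add: irreducible_closed_def)
  have "p \<in> ?V f \<or> p \<in> ?V g" if "p \<in> Z" for p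
  proof -
    have p: "p \<in> proj_space I" using zariski_closed_subset[OF Z] that by auto
    then obtain v where v: "v \<in> p" "p = range (\<lambda>c i. c * v i)" by (rule proj_spaceE)
    then have "f v * g v = 0" using assms(4) that by (auto simp: vanishes_def)
    moreover have "\<forall>u\<in>p. h u = 0" if "h v = 0" "h \<in> forms I d" for h d
      using that v forms_scale[of h I d] by auto
    ultimately show ?thesis using p assms(2,3) by auto
  qed
  then have "Z = (Z \<inter> ?V f) \<union> (Z \<inter> ?V g)" by blast
  moreover have "zariski_closed I (Z \<inter> ?V f)" "zariski_closed I (Z \<inter> ?V g)"
    using Z assms(2,3) by (auto intro: zariski_closed_Int zariski_closed_form)
  ultimately have "Z \<inter> ?V f = Z \<or> Z \<inter> ?V g = Z"
    using assms(1) unfolding irreducible_closed_def by blast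
  then show ?thesis by (auto simp: vanishes_def)
qed

text \<open>If neither \<open>A\<close> nor \<open>B\<close> is everything, a form vanishing on
  \<open>A\<close> and one vanishing on \<open>B\<close> are both nonzero at some vector on the line
  that joins their witnesses.\<close>

lemma irreducible_closed_proj_space:
  assumes "I \<noteq> {}"
  shows "irreducible_closed I (proj_space I)"
proof -
  have "A = proj_space I \<or> B = proj_space I"
    if AB: "zariski_closed I A" "zariski_closed I B" "proj_space I = A \<union> B" for A B
  proof (rule ccontr)
    assume "\<not> ?thesis"
    with AB obtain p q where pq: "p \<in> proj_space I" "p \<notin> A" "q \<in> proj_space I" "q \<notin> B" by blast
    obtain a f u where f: "f \<in> forms I a" "vanishes f A" "u \<in> p" "f u \<noteq> 0"
      using zariski_closed_separate[OF AB(1) pq(1,2)] .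
    obtain b g w where g: "g \<in> forms I b" "vanishes g B" "w \<in> q" "g w \<noteq> 0"
      using zariski_closed_separate[OF AB(2) pq(3,4)] .
    obtain t where t: "f (\<lambda>i. u i + t * (w i - u i)) * g (\<lambda>i. u i + t * (w i - u i)) \<noteq> 0"
      using polyfuns_no_zero_divisors[of f _ g _ u w, OF f(1) g(1) f(4) g(4)] by blast
    from subsetD[OF proj_space_subset_coord[OF pq(1)] f(3)] subsetD[OF proj_space_subset_coord[OF pq(3)] g(3)]
 have "(\<lambda>i. u i + t * (w i - u i)) \<in> coord_space I" by (simp add: coord_space_def)
    then obtain r where "r \<in> proj_space I" "(\<lambda>i. u i + t * (w i - u i)) \<in> r"
      using coord_space_mem_point[OF assms] by blast
    with t f(2) g(2) AB(3) show False by (auto simp: vanishes_def)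
  qed
  moreover have "proj_space I \<noteq> {}"
    using coord_space_mem_point[OF assms, of 0] by (auto simp: coord_space_def)
  ultimately show ?thesis by (auto simp: irreducible_closed_def zariski_closed_proj_space)
qed

section \<open>Growth of Hilbert functions along chains\<close>

definition independent_on :: "'i pt set \<Rightarrow> nat \<Rightarrow> (nat \<Rightarrow> ('i \<Rightarrow> complex) \<Rightarrow> complex) \<Rightarrow> bool" where
  "independent_on Z N g \<longleftrightarrow> (\<forall>c. vanishes (\<lambda>v. \<Sum>i<N. c i * g i v) Z \<longrightarrow> (\<forall>i<N. c i = 0))"

lemma independent_onD:
  "independent_on Z N g \<Longrightarrow> vanishes (\<lambda>v. \<Sum>i<N. c i * g i v) Z \<Longrightarrow> i < N \<Longrightarrow> c i = 0"
  unfolding independent_on_def by blast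

lemma independent_on_le: "independent_on Z N g \<Longrightarrow> M \<le> N \<Longrightarrow> independent_on Z M g"
  unfolding independent_on_def
proof (intro allI impI)
  fix c i
  assume *: "\<forall>c. vanishes (\<lambda>v. \<Sum>i<N. c i * g i v) Z \<longrightarrow> (\<forall>i<N. c i = 0)" "M \<le> N"
    "vanishes (\<lambda>v. \<Sum>i<M. c i * g i v) Z" "i < M"
  have "(\<Sum>i<N. (if i < M then c i else 0) * g i v) = (\<Sum>i<M. c i * g i v)" for v
    using *(2) by (intro sum.mono_neutral_cong_right) auto
  with *(3) have "vanishes (\<lambda>v. \<Sum>i<N. (if i < M then c i else 0) * g i v) Z" by simp
  with *(1)[rule_format, of "\<lambda>i. if i < M then c i else 0"]
  have "\<forall>i<N. (if i < M then c i else 0) = 0" by blast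
  moreover have "i < N" using *(2,4) by simp
  ultimately have "(if i < M then c i else 0) = 0" by blast
  with *(4) show "c i = 0" by simp
qed

lemma sum_lessThan_split: "(\<Sum>i<a + b. h i) = (\<Sum>i<a. h i) + (\<Sum>j<b. h (a + j) :: complex)" for a b :: nat
  by (induction b) (simp_all add: add.assoc)

text \<open>\<open>E + n choose n\<close> counts the monomials of degree \<open>E\<close> in
  \<open>n + 1\<close> variables, so up to the scale \<open>A\<close> of degrees \<open>Z n\<close>
  has at least the Hilbert function of a projective space of dimension \<open>n\<close>. Pascal's
  rule is the inductive step: forms independent on \<open>Z n\<close> are put together with
  multiples of a form that vanishes on \<open>Z n\<close>.\<close>

lemma chain_growth:
  assumes "\<And>k. k \<le> n \<Longrightarrow> irreducible_closed I (Z k)" "\<And>k. k < n \<Longrightarrow> Z k \<subset> Z (Suc k)"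
  shows "\<exists>A\<ge>1. \<forall>E. \<exists>g. (\<forall>i<E + n choose n. g i \<in> forms I (A * E)) \<and>
           independent_on (Z n) (E + n choose n) g"
  using assms
proof (induction n)
  case 0
  then have Z: "irreducible_closed I (Z 0)" by simp
  then obtain p where "p \<in> Z 0" "p \<in> proj_space I"
    using zariski_closed_subset by (auto simp: irreducible_closed_def)
  then obtain v where v: "v \<in> coord_space I" "v \<noteq> 0" "v \<in> p" by (meson proj_spaceE)
  then obtain i where i: "v i \<noteq> 0" by (auto simp: fun_eq_iff)
  with v(1) have "i \<in> I" by (auto simp: coord_space_def)
  have "(\<lambda>v. v i ^ E) \<in> forms I E" for E
    using forms_power[OF forms_coord[OF \<open>i \<in> I\<close>], of E] by simp
  moreover have "independent_on (Z 0) 1 (\<lambda>_ v. v i ^ E)" for E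
    using \<open>p \<in> Z 0\<close> v(3) i by (fastforce simp: independent_on_def vanishes_def)
  ultimately show ?case by (intro exI[of _ 1]) (auto intro!: exI[of _ "\<lambda>_ v. v i ^ _"])
next
  case (Suc n)
  then obtain A where A: "A \<ge> 1" and gA: "\<And>E. \<exists>g. (\<forall>i<E + n choose n. g i \<in> forms I (A * E)) \<and>
           independent_on (Z n) (E + n choose n) g" by auto
  have irr: "irreducible_closed I (Z n)" "irreducible_closed I (Z (Suc n))" using Suc.prems(1) by auto
  have step: "Z n \<subset> Z (Suc n)" using Suc.prems(2)[of n] by simp
  then obtain p where p: "p \<in> Z (Suc n)" "p \<notin> Z n" by blast
  then have "p \<in> proj_space I" using irr zariski_closed_subset by (auto simp: irreducible_closed_def)
  with p irr obtain a f v where f: "f \<in> forms I a" "vanishes f (Z n)" "v \<in> p" "f v \<noteq> 0"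
    using zariski_closed_separate[of I "Z n" p] by (metis irreducible_closed_def)
  \<comment> \<open>A form of degree 0 is constant, so it cannot vanish on the nonempty
    \<open>Z n\<close> and be nonzero at \<open>v\<close>.\<close>
  have "a \<ge> 1"
  proof (rule ccontr)
    assume "\<not> a \<ge> 1"
    then have "a = 0" by simp
    then have "f \<in> polyfuns {0}" using f(1) by (simp add: monomials_0)
    obtain q w where "q \<in> Z n" "w \<in> q"
      using irr(1) zariski_closed_subset[of I "Z n"] by (fastforce simp: irreducible_closed_def elim: proj_spaceE)
    then have "f w = 0" using f by (auto simp: vanishes_def)
    moreover have "f v = f w" by (rule polyfuns_cong[OF \<open>f \<in> polyfuns {0}\<close>, of v w]) simp
    ultimately show False using f by simp
  qed
  \<comment> \<open>The power makes the degree \<open>A'\<close> of \<open>F\<close> a multiple of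
    the old scale \<open>A\<close>. Then \<open>F\<close> times forms of degree
    \<open>A' * E\<close> and the forms that \<open>gA\<close> gives for \<open>a * Suc E\<close>
    share the degree \<open>A' * Suc E\<close>.\<close>
  define F where "F = (\<lambda>v. f v ^ A)"
  define A' where "A' = a * A"
  have F: "F \<in> forms I A'" unfolding F_def A'_def by (rule forms_power[OF f(1)])
  have Fn: "vanishes F (Z n)" using f(2) A by (simp add: F_def vanishes_def)
  have FSuc: "\<not> vanishes F (Z (Suc n))" using f p by (auto simp: F_def vanishes_def)
  have "\<exists>g. (\<forall>i<E + Suc n choose Suc n. g i \<in> forms I (A' * E)) \<and>
           independent_on (Z (Suc n)) (E + Suc n choose Suc n) g" for E
  proof (induction E)
    case 0
    have "(\<lambda>v. 1) \<in> forms I 0" by (simp add: monomials_0 polyfuns_const)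
    moreover have "independent_on (Z (Suc n)) 1 (\<lambda>_ v. 1)"
      using p f by (fastforce simp: independent_on_def vanishes_def)
    ultimately show ?case by (intro exI[of _ "\<lambda>_ v. 1"]) simp
  next
    case (Suc E)
    define N0 where "N0 = Suc E + n choose n"
    define N1 where "N1 = E + Suc n choose Suc n"
    obtain g1 where g1: "\<And>i. i < N1 \<Longrightarrow> g1 i \<in> forms I (A' * E)" "independent_on (Z (Suc n)) N1 g1"
      using Suc.IH unfolding N1_def by blast
    obtain g0 where g0: "\<And>i. i < a * Suc E + n choose n \<Longrightarrow> g0 i \<in> forms I (A * (a * Suc E))"
      "independent_on (Z n) (a * Suc E + n choose n) g0" using gA[of "a * Suc E"] by blast
    have "N0 \<le> a * Suc E + n choose n" unfolding N0_def using \<open>a \<ge> 1\<close>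
      by (intro binomial_right_mono) (metis add_le_mono1 mult_1 mult_le_mono1)
    with g0 have g0: "\<And>i. i < N0 \<Longrightarrow> g0 i \<in> forms I (A' * Suc E)" "independent_on (Z n) N0 g0"
      by (auto simp: A'_def mult_ac intro: independent_on_le)
    define g where "g i = (if i < N0 then g0 i else (\<lambda>v. F v * g1 (i - N0) v))" for i
    have N: "Suc E + Suc n choose Suc n = N0 + N1" by (simp add: N0_def N1_def)
    have "g i \<in> forms I (A' * Suc E)" if "i < N0 + N1" for i
      using that g0(1)[of i] forms_mult[OF F g1(1)[of "i - N0"]] by (auto simp: g_def)
    moreover have "independent_on (Z (Suc n)) (N0 + N1) g"
      unfolding independent_on_def
    proof (intro allI impI)
      fix c i
      assume c: "vanishes (\<lambda>v. \<Sum>i<N0 + N1. c i * g i v) (Z (Suc n))" and i: "i < N0 + N1"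
      have eq: "(\<Sum>i<N0 + N1. c i * g i v) =
        (\<Sum>i<N0. c i * g0 i v) + F v * (\<Sum>j<N1. c (N0 + j) * g1 j v)" for v
        by (simp add: sum_lessThan_split g_def sum_distrib_left mult_ac)
      \<comment> \<open>Restriction to \<open>Z n\<close> kills the multiples of \<open>F\<close>,
        which settles the first \<open>N0\<close> coefficients. What remains is a multiple of
        \<open>F\<close>, and \<open>F\<close> cancels because \<open>Z (Suc n)\<close> is
        irreducible.\<close>
      have "vanishes (\<lambda>v. \<Sum>i<N0. c i * g0 i v) (Z n)"
        unfolding vanishes_def
      proof (intro ballI)
        fix q w assume q: "q \<in> Z n" "w \<in> q"
        then have "(\<Sum>i<N0 + N1. c i * g i w) = 0" using c step by (auto simp: vanishes_def)
        with Fn q show "(\<Sum>i<N0. c i * g0 i w) = 0" by (simp add: eq vanishes_def)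
      qed
      from independent_onD[OF g0(2) this] have c0: "\<And>i. i < N0 \<Longrightarrow> c i = 0" .
      with c have "vanishes (\<lambda>v. F v * (\<Sum>j<N1. c (N0 + j) * g1 j v)) (Z (Suc n))" by (simp add: eq)
      moreover have "(\<lambda>v. \<Sum>j<N1. c (N0 + j) * g1 j v) \<in> forms I (A' * E)"
        by (intro polyfuns_sum polyfuns_cmult) (use g1(1) in simp)
      ultimately have "vanishes (\<lambda>v. \<Sum>j<N1. c (N0 + j) * g1 j v) (Z (Suc n))"
        using irreducible_closed_mult[OF irr(2) F, of "\<lambda>v. \<Sum>j<N1. c (N0 + j) * g1 j v" "A' * E"] FSuc
        by blast
      from independent_onD[OF g1(2) this, of "i - N0"] c0 i show "c i = 0" by (cases "i < N0") auto
    qed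
    ultimately show ?case unfolding N by blast
  qed
  moreover have "A' \<ge> 1" using A \<open>a \<ge> 1\<close> by (simp add: A'_def)
  ultimately show ?case by blast
qed

text \<open>If a chain reached \<open>Z (Suc k)\<close>, the number of independent forms would grow
  with order \<open>k + 1\<close> in the degree, against the assumed bound of order
  \<open>k\<close>.\<close>

lemma proj_dim_le:
  assumes "\<And>e N g. (\<And>i. i < N \<Longrightarrow> g i \<in> forms I e) \<Longrightarrow> N > C * (e + 1) ^ k \<Longrightarrow> \<not> independent_on Y N g"
  shows "proj_dim I Y \<le> enat k"
  unfolding proj_dim_def
proof (rule Sup_least, safe)
  fix n :: nat and Z :: "nat \<Rightarrow> 'a pt set"
  assume Z: "\<forall>k\<le>n. irreducible_closed I (Z k) \<and> Z k \<subseteq> Y" "\<forall>k<n. Z k \<subset> Z (Suc k)"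
  show "enat n \<le> enat k"
  proof (rule ccontr)
    assume "\<not> ?thesis"
    then have "Suc k \<le> n" by simp
    with Z obtain A where A: "A \<ge> 1" and gA: "\<And>E. \<exists>g. (\<forall>i<E + Suc k choose Suc k. g i \<in> forms I (A * E)) \<and>
           independent_on (Z (Suc k)) (E + Suc k choose Suc k) g"
      using chain_growth[of "Suc k" I Z] by auto
    have bound: "E + Suc k choose Suc k \<le> C * (A * E + 1) ^ k" for E
    proof (rule ccontr)
      assume "\<not> ?thesis"
      moreover obtain g where g: "\<And>i. i < E + Suc k choose Suc k \<Longrightarrow> g i \<in> forms I (A * E)"
        "independent_on (Z (Suc k)) (E + Suc k choose Suc k) g" using gA by blast
      moreover have "independent_on Y (E + Suc k choose Suc k) g"
        using g(2) Z(1) \<open>Suc k \<le> n\<close> unfolding independent_on_def vanishes_def by blast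
      ultimately show False using assms[of "E + Suc k choose Suc k" g "A * E"] by simp
    qed
    \<comment> \<open>Chosen so that at \<open>E = K\<close> the two estimates combine to
      \<open>(K + 1) ^ Suc k \<le> K * (K + 1) ^ k\<close>.\<close>
    define K where "K = Suc k ^ Suc k * C * A ^ k"
    have "real (K + 1) ^ Suc k \<le> (real (K + Suc k) / real (Suc k)) ^ Suc k * Suc k ^ Suc k"
      by (simp add: power_divide power_mono del: power_Suc)
    also have "\<dots> \<le> real (K + Suc k choose Suc k) * Suc k ^ Suc k"
      using binomial_ge_n_over_k_pow_k[of "Suc k" "K + Suc k", where 'a = real]
      by (intro mult_right_mono) auto
    also have "\<dots> \<le> real (C * (A * K + 1) ^ k) * Suc k ^ Suc k"
      using bound[of K] by (intro mult_right_mono) (auto simp del: power_Suc of_nat_mult)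
    also have "\<dots> \<le> real (C * (A * (K + 1)) ^ k) * Suc k ^ Suc k"
      using A by (intro mult_right_mono of_nat_mono mult_left_mono power_mono) auto
    also have "C * (A * (K + 1)) ^ k * Suc k ^ Suc k = K * (K + 1) ^ k"
      unfolding power_mult_distrib by (simp add: K_def mult_ac del: power_Suc)
    then have "real (C * (A * (K + 1)) ^ k) * Suc k ^ Suc k = real K * real (K + 1) ^ k"
      by (metis of_nat_mult of_nat_power)
    finally have "real (K + 1) * real (K + 1) ^ k \<le> real K * real (K + 1) ^ k" by simp
    then have "real (K + 1) \<le> real K" by (rule mult_right_le_imp_le) simp
    then show False by simp
  qed
qed

text \<open>These exponents occur in a form of degree \<open>e\<close> after substituting a map that
  is linear in the variables of \<open>S\<close> and has degree at most \<open>D\<close> in each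
  variable. Prescribing the total exponent on \<open>S\<close> is what saves one parameter in
  passing from a cone to its projectivization.\<close>

definition graded_box :: "'j set \<Rightarrow> 'j set \<Rightarrow> nat \<Rightarrow> nat \<Rightarrow> ('j \<Rightarrow>\<^sub>0 nat) set" where
  "graded_box J S D e = {\<kappa>. keys \<kappa> \<subseteq> J \<and> (\<forall>j. lookup \<kappa> j \<le> D * e) \<and>
     (\<Sum>j\<in>S. lookup \<kappa> j) = e}"

lemma graded_box_0: "0 \<in> graded_box J S D 0"
  by (simp add: graded_box_def)

lemma graded_box_add: "\<alpha> \<in> graded_box J S D a \<Longrightarrow> \<beta> \<in> graded_box J S D b \<Longrightarrow> \<alpha> + \<beta> \<in> graded_box J S D (a + b)"
  by (auto simp: graded_box_def keys_add_nat lookup_add sum.distrib distrib_left intro: add_mono)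

text \<open>The exponent at one chosen \<open>s\<close> in \<open>S\<close> is determined by the
  others, so an element of the box amounts to \<open>card J - 1\<close> numbers.\<close>

lemma
  assumes "finite J" "S \<subseteq> J" "S \<noteq> {}"
  shows finite_graded_box: "finite (graded_box J S D e)" and card_graded_box: "card (graded_box J S D e) \<le> (D * e + 1) ^ (card J - 1)"
proof -
  obtain s where s: "s \<in> S" using assms by auto
  define P where "P = PiE (J - {s}) (\<lambda>_. {..D * e})"
  have P: "finite P" "card P = (D * e + 1) ^ (card J - 1)"
    using assms s by (auto simp: P_def card_PiE finite_PiE)
  define r where "r = (\<lambda>\<kappa>. restrict (lookup \<kappa>) (J - {s}) :: 'a \<Rightarrow> nat)"
  have inj: "inj_on r (graded_box J S D e)"
  proof (rule inj_onI)
    fix x y assume xy: "x \<in> graded_box J S D e" "y \<in> graded_box J S D e" "r x = r y"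
    have eq: "lookup x j = lookup y j" if "j \<noteq> s" for j
    proof (cases "j \<in> J")
      case True
      with fun_cong[OF xy(3), of j] that show ?thesis by (simp add: r_def)
    next
      case False
      then have "j \<notin> keys x" "j \<notin> keys y" using xy by (auto simp: graded_box_def)
      then show ?thesis by (simp add: in_keys_iff)
    qed
    have "finite S" using assms finite_subset by blast
    then have "lookup z s + (\<Sum>j\<in>S - {s}. lookup z j) = e" if "z \<in> graded_box J S D e" for z
      using that s by (simp add: graded_box_def sum.remove)
    from this[OF xy(1)] this[OF xy(2)] have
      "lookup x s + (\<Sum>j\<in>S - {s}. lookup x j) =
       lookup y s + (\<Sum>j\<in>S - {s}. lookup y j)" by simp
    moreover have "(\<Sum>j\<in>S - {s}. lookup x j) = (\<Sum>j\<in>S - {s}. lookup y j)"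
      by (rule sum.cong) (use eq in auto)
    ultimately show "x = y" using eq by (intro poly_mapping_eqI) (metis add_right_cancel)
  qed
  have sub: "r ` graded_box J S D e \<subseteq> P" by (force simp: r_def P_def graded_box_def)
  show "finite (graded_box J S D e)" using inj sub P(1) by (meson finite_imageD finite_subset)
  show "card (graded_box J S D e) \<le> (D * e + 1) ^ (card J - 1)"
    using card_inj_on_le[OF inj sub P(1)] P(2) by simp
qed

text \<open>The parameters in \<open>S \<tau>\<close> enter homogeneously, so \<open>k + 1\<close> parameters give projective dimension at most \<open>k\<close>.\<close>

lemma proj_dim_le_parameters:
  fixes \<Phi> :: "'t \<Rightarrow> ('j \<Rightarrow> complex) \<Rightarrow> 'i \<Rightarrow> complex"
  assumes X: "finite X"
    and J: "\<And>\<tau>. \<tau> \<in> X \<Longrightarrow> finite (J \<tau>) \<and> S \<tau> \<subseteq> J \<tau> \<and> S \<tau> \<noteq> {} \<and> card (J \<tau>) \<le> k + 1"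
    and \<Phi>: "\<And>\<tau> i. \<tau> \<in> X \<Longrightarrow> i \<in> I \<Longrightarrow> (\<lambda>u. \<Phi> \<tau> u i) \<in> polyfuns (graded_box (J \<tau>) (S \<tau>) D 1)"
    and Y: "\<And>e f. f \<in> forms I e \<Longrightarrow> (\<And>\<tau> u. \<tau> \<in> X \<Longrightarrow> f (\<Phi> \<tau> u) = 0) \<Longrightarrow> vanishes f Y"
  shows "proj_dim I Y \<le> enat k"
proof (rule proj_dim_le[where C = "card X * (D + 1) ^ k"])
  fix e N :: nat and g :: "nat \<Rightarrow> ('i \<Rightarrow> complex) \<Rightarrow> complex"
  assume g: "\<And>i. i < N \<Longrightarrow> g i \<in> forms I e" and N: "N > card X * (D + 1) ^ k * (e + 1) ^ k"
  let ?B = "\<lambda>\<tau>. graded_box (J \<tau>) (S \<tau>) D e"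
  have finB: "finite (?B \<tau>)" if "\<tau> \<in> X" for \<tau> using J[OF that] finite_graded_box by blast
  have "\<exists>c. \<forall>u. g i (\<Phi> \<tau> u) = (\<Sum>\<kappa>\<in>?B \<tau>. c \<kappa> * eval_monomial \<kappa> u)" if "i < N" "\<tau> \<in> X" for i \<tau>
  proof -
    have "(\<lambda>u. g i (\<Phi> \<tau> u)) \<in> polyfuns (?B \<tau>)"
    proof (rule polyfuns_compose[OF g[OF that(1)], of \<Phi>' "\<lambda>e. graded_box (J \<tau>) (S \<tau>) D e" for \<Phi>'])
      show "(\<lambda>u. \<Phi> \<tau> u j) \<in> polyfuns (graded_box (J \<tau>) (S \<tau>) D 1)"
        if "\<beta> \<in> monomials I e" "j \<in> keys \<beta>" for \<beta> j
        using \<Phi>[OF \<open>\<tau> \<in> X\<close>] that by (auto simp: monomials_altdef)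
    qed (auto simp: graded_box_0 graded_box_add monomials_altdef)
    moreover note finB[OF that(2)]
    ultimately obtain c where "\<And>u. g i (\<Phi> \<tau> u) = (\<Sum>\<kappa>\<in>?B \<tau>. c \<kappa> * eval_monomial \<kappa> u)"
      by (rule polyfuns_expand) (rule that)
    then show ?thesis by (intro exI[of _ c] allI)
  qed
  then have "\<forall>i \<tau>. \<exists>c. i < N \<longrightarrow> \<tau> \<in> X \<longrightarrow> (\<forall>u. g i (\<Phi> \<tau> u) = (\<Sum>\<kappa>\<in>?B \<tau>. c \<kappa> * eval_monomial \<kappa> u))"
    by blast
  then obtain E where E: "\<And>i \<tau> u. i < N \<Longrightarrow> \<tau> \<in> X \<Longrightarrow> g i (\<Phi> \<tau> u) = (\<Sum>\<kappa>\<in>?B \<tau>. E i \<tau> \<kappa> * eval_monomial \<kappa> u)"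
    unfolding choice_iff by blast
  have fin: "finite (Sigma X ?B)" using X finB by (rule finite_SigmaI)
  have "card (Sigma X ?B) = (\<Sum>\<tau>\<in>X. card (?B \<tau>))" using X finB by (intro card_SigmaI) auto
  also have "\<dots> \<le> (\<Sum>\<tau>\<in>X. (D + 1) ^ k * (e + 1) ^ k)"
  proof (rule sum_mono)
    fix \<tau> assume "\<tau> \<in> X"
    with J have "card (?B \<tau>) \<le> (D * e + 1) ^ (card (J \<tau>) - 1)" by (intro card_graded_box) auto
    also have "\<dots> \<le> (D * e + 1) ^ k" using J[OF \<open>\<tau> \<in> X\<close>] by (intro power_increasing) auto
    also have "\<dots> \<le> ((D + 1) * (e + 1)) ^ k" by (intro power_mono) auto
    finally show "card (?B \<tau>) \<le> (D + 1) ^ k * (e + 1) ^ k" by (simp only: power_mult_distrib)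
  qed
  also have "\<dots> = card X * (D + 1) ^ k * (e + 1) ^ k" by simp
  finally have "card (Sigma X ?B) < card {..<N}" using N by simp
  \<comment> \<open>There is one equation for each coefficient of each pullback; a solution is a
    combination of the \<open>g i\<close> that vanishes along every
    \<open>\<Phi> \<tau>\<close>.\<close>
  from underdetermined_system[OF fin _ this, of "\<lambda>(\<tau>, \<kappa>) i. E i \<tau> \<kappa>"] obtain c where
    c: "\<exists>i<N. c i \<noteq> 0" "\<And>\<tau> \<kappa>. \<tau> \<in> X \<Longrightarrow> \<kappa> \<in> ?B \<tau> \<Longrightarrow> (\<Sum>i<N. c i * E i \<tau> \<kappa>) = 0"
    by fastforce
  have "(\<lambda>v. \<Sum>i<N. c i * g i v) \<in> forms I e" using g by (intro polyfuns_sum polyfuns_cmult) auto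
  moreover have "(\<Sum>i<N. c i * g i (\<Phi> \<tau> u)) = 0" if "\<tau> \<in> X" for \<tau> u
  proof -
    have "(\<Sum>i<N. c i * g i (\<Phi> \<tau> u)) = (\<Sum>i<N. \<Sum>\<kappa>\<in>?B \<tau>. c i * E i \<tau> \<kappa> * eval_monomial \<kappa> u)"
      using that by (intro sum.cong refl) (simp add: E sum_distrib_left mult.assoc)
    also have "\<dots> = (\<Sum>\<kappa>\<in>?B \<tau>. (\<Sum>i<N. c i * E i \<tau> \<kappa>) * eval_monomial \<kappa> u)"
      by (subst sum.swap) (simp add: sum_distrib_right)
    finally show ?thesis using c(2) that by simp
  qed
  ultimately have "vanishes (\<lambda>v. \<Sum>i<N. c i * g i v) Y" by (rule Y)
  with c(1) show "\<not> independent_on Y N g" using independent_onD[of Y N g c] by blast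
qed

lemma proj_dim_proj_space_le:
  assumes "finite I" "I \<noteq> {}"
  shows "proj_dim I (proj_space I) \<le> enat (card I - 1)"
proof (rule proj_dim_le_parameters[where X = "{()}" and J = "\<lambda>_. I" and S = "\<lambda>_. I" and D = 1 and \<Phi> = "\<lambda>_ u. u"])
  show "(\<lambda>u. u i) \<in> polyfuns (graded_box I I 1 1)" if "i \<in> I" for i
  proof -
    have "single i 1 \<in> graded_box I I 1 1"
      using that assms by (auto simp: graded_box_def lookup_single when_def)
    from polyfuns_monomial[OF this, of 1] show ?thesis by simp
  qed
  show "finite I \<and> I \<subseteq> I \<and> I \<noteq> {} \<and> card I \<le> card I - 1 + 1"
    using assms by (auto simp: card_gt_0_iff Suc_leI)
qed (auto simp: vanishes_def)

text \<open>A chain in \<open>Y\<close> can be prolonged by the whole projective space, because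
  \<open>f\<close> vanishes on its last member. So it is shorter by one than the bound for
  projective space allows.\<close>

lemma proj_dim_hypersurface_le:
  assumes "finite I" "f \<in> forms I e" "f v \<noteq> 0" "vanishes f Y" "Y \<subseteq> proj_space I" "card I \<ge> 2"
  shows "proj_dim I Y \<le> enat (card I - 2)"
  unfolding proj_dim_def
proof (rule Sup_least, safe)
  fix n :: nat and Z :: "nat \<Rightarrow> 'a pt set"
  assume Z: "\<forall>k\<le>n. irreducible_closed I (Z k) \<and> Z k \<subseteq> Y" "\<forall>k<n. Z k \<subset> Z (Suc k)"
  have I: "I \<noteq> {}" using assms by auto
  have "Z n \<noteq> proj_space I"
  proof
    assume *: "Z n = proj_space I"
    \<comment> \<open>\<open>v\<close> is an arbitrary vector. Dropping its coordinates outside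
      \<open>I\<close> keeps the value of \<open>f\<close> and leads into the coordinate
      space.\<close>
    define w where "w = (\<lambda>i. if i \<in> I then v i else 0)"
    have "w \<in> coord_space I" by (auto simp: coord_space_def w_def)
    then obtain p where "p \<in> proj_space I" "w \<in> p" using coord_space_mem_point[OF I] by blast
    then have "f w = 0" using * Z(1) assms(4) by (force simp: vanishes_def)
    moreover have "f w = f v" by (rule forms_cong[OF assms(2), of w v]) (simp add: w_def)
    ultimately show False using assms(3) by simp
  qed
  define Z' where "Z' k = (if k \<le> n then Z k else proj_space I)" for k
  have "\<forall>k\<le>Suc n. irreducible_closed I (Z' k) \<and> Z' k \<subseteq> proj_space I"
    using Z(1) assms(5) irreducible_closed_proj_space[OF I] by (auto simp: Z'_def)
  moreover have "\<forall>k<Suc n. Z' k \<subset> Z' (Suc k)"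
  proof (intro allI impI)
    fix k assume "k < Suc n"
    then consider "k < n" | "k = n" by linarith
    then show "Z' k \<subset> Z' (Suc k)"
    proof cases
      case 1
      then show ?thesis using Z(2) by (simp add: Z'_def)
    next
      case 2
      moreover have "Z n \<subseteq> proj_space I" using Z(1) assms(5) by blast
      ultimately show ?thesis using \<open>Z n \<noteq> proj_space I\<close> by (auto simp: Z'_def)
    qed
  qed
  ultimately have "enat (Suc n) \<le> proj_dim I (proj_space I)"
    unfolding proj_dim_def by (intro Sup_upper) blast
  also have "\<dots> \<le> enat (card I - 1)" by (rule proj_dim_proj_space_le[OF assms(1) I])
  finally show "enat n \<le> enat (card I - 2)" by simp
qed

section \<open>Plane curves with multiple points\<close>

text \<open>Plane curves are handled in the affine chart with coordinates indexed by \<open>bool\<close>;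
  exponents of degree at most \<open>d\<close> form \<open>exponents_below (d + 1)\<close>.\<close>

definition exponents_below :: "nat \<Rightarrow> (bool \<Rightarrow>\<^sub>0 nat) set" where
  "exponents_below M = {\<beta>. mdeg \<beta> < M}"

definition bipow :: "nat \<Rightarrow> nat \<Rightarrow> bool \<Rightarrow>\<^sub>0 nat" where
  "bipow i j = single False i + single True j"

lemma lookup_bipow [simp]:
  "lookup (bipow i j) False = i" "lookup (bipow i j) True = j"
  by (simp_all add: bipow_def lookup_add lookup_single)

lemma bipow_lookup: "bipow (lookup \<beta> False) (lookup \<beta> True) = \<beta>"
  by (rule poly_mapping_eqI) (metis (full_types) lookup_bipow)

lemma mdeg_bool: "mdeg \<beta> = lookup \<beta> False + lookup \<beta> True"
  by (subst mdeg_eq_sum[of UNIV]) (auto simp: UNIV_bool)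

lemma eval_monomial_bool:
  "eval_monomial \<beta> v = v False ^ lookup \<beta> False * v True ^ lookup \<beta> True"
  by (subst eval_monomial_eq_prod[of UNIV]) (auto simp: UNIV_bool)

lemma sum_exponents_below:
  "(\<Sum>\<beta>\<in>exponents_below M. f \<beta>) = (\<Sum>(i, j)\<in>Sigma {..<M} (\<lambda>i. {..<M - i}). f (bipow i j))"
  by (rule sum.reindex_bij_witness[where i = "\<lambda>(i, j). bipow i j"
        and j = "\<lambda>\<beta>. (lookup \<beta> False, lookup \<beta> True)"])
    (auto simp: exponents_below_def mdeg_bool bipow_lookup)

lemma finite_exponents_below [simp]: "finite (exponents_below M)"
proof -
  have "exponents_below M \<subseteq> (\<lambda>(i, j). bipow i j) ` ({..<M} \<times> {..<M})"
  proof
    fix \<beta> assume "\<beta> \<in> exponents_below M"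
    then show "\<beta> \<in> (\<lambda>(i, j). bipow i j) ` ({..<M} \<times> {..<M})"
      by (intro image_eqI[of _ _ "(lookup \<beta> False, lookup \<beta> True)"])
        (auto simp: exponents_below_def mdeg_bool bipow_lookup)
  qed
  then show ?thesis by (rule finite_subset) auto
qed

lemma card_exponents_below: "2 * card (exponents_below M) = M * (M + 1)"
proof -
  have "card (exponents_below M) = (\<Sum>\<beta>\<in>exponents_below M. 1)" by simp
  also have "\<dots> = (\<Sum>i<M. M - i)" unfolding sum_exponents_below by (simp flip: sum.Sigma)
  finally have "card (exponents_below M) = (\<Sum>i<M. M - i)" .
  moreover have "2 * (\<Sum>i<M. M - i) = M * (M + 1)"
    by (induction M) (simp_all add: sum.lessThan_Suc_shift del: sum.lessThan_Suc)
  ultimately show ?thesis by simp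
qed

text \<open>The coefficient of the monomial \<beta> in \<open>q\<close> when the monomial \<kappa>
  is evaluated at \<open>p + q\<close>, that is, a divided partial derivative at \<open>p\<close>.
  The truncated subtraction does no harm: the binomial coefficient is 0 when \<beta> exceeds
  \<kappa>.\<close>

definition taylor_coeff :: "(bool \<Rightarrow>\<^sub>0 nat) \<Rightarrow> (bool \<Rightarrow>\<^sub>0 nat) \<Rightarrow> (bool \<Rightarrow> complex) \<Rightarrow> complex" where
  "taylor_coeff \<beta> \<kappa> p = (\<Prod>b\<in>UNIV. of_nat (lookup \<kappa> b choose lookup \<beta> b) *
     p b ^ (lookup \<kappa> b - lookup \<beta> b))"

lemma taylor_coeff_eq_0: "mdeg \<kappa> < mdeg \<beta> \<Longrightarrow> taylor_coeff \<beta> \<kappa> p = 0"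
  by (force simp: taylor_coeff_def UNIV_bool mdeg_bool)

lemma eval_monomial_taylor:
  assumes "\<kappa> \<in> exponents_below D"
  shows "eval_monomial \<kappa> (\<lambda>b. p b + q b) = (\<Sum>\<beta>\<in>exponents_below D. taylor_coeff \<beta> \<kappa> p * eval_monomial \<beta> q)"
proof -
  define m n where "m = lookup \<kappa> False" and "n = lookup \<kappa> True"
  define t where "t = (\<lambda>(i, j). taylor_coeff (bipow i j) \<kappa> p * eval_monomial (bipow i j) q)"
  have "eval_monomial \<kappa> (\<lambda>b. p b + q b) = (q False + p False) ^ m * (q True + p True) ^ n"
    by (simp add: eval_monomial_bool m_def n_def add.commute)
  also have "\<dots> = (\<Sum>(i, j)\<in>{..m} \<times> {..n}. t (i, j))"
    unfolding binomial_ring sum_product sum.cartesian_product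
    by (intro sum.cong) (auto simp: t_def taylor_coeff_def UNIV_bool eval_monomial_bool m_def n_def mult_ac)
  also have "\<dots> = (\<Sum>(i, j)\<in>Sigma {..<D} (\<lambda>i. {..<D - i}). t (i, j))"
    using assms by (intro sum.mono_neutral_left)
      (auto simp: exponents_below_def mdeg_bool t_def taylor_coeff_def UNIV_bool m_def n_def not_le)
  finally show ?thesis by (simp add: sum_exponents_below t_def)
qed

text \<open>Asking for an expansion at \<open>p\<close> without terms of low order makes
  multiplicities additive under products at once; \<open>mult_ge_iff\<close> translates this into
  linear conditions on coefficients.\<close>

definition mult_ge :: "((bool \<Rightarrow> complex) \<Rightarrow> complex) \<Rightarrow> (bool \<Rightarrow> complex) \<Rightarrow> nat \<Rightarrow> bool" where
  "mult_ge f p M \<longleftrightarrow> (\<lambda>q. f (\<lambda>b. p b + q b)) \<in> polyfuns {\<beta>. M \<le> mdeg \<beta>}"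

lemma mult_ge_mult: "mult_ge f p a \<Longrightarrow> mult_ge g p b \<Longrightarrow> mult_ge (\<lambda>v. f v * g v) p (a + b)"
  unfolding mult_ge_def by (rule polyfuns_mult) (auto simp: mdeg_add)

lemma mult_ge_mono: "mult_ge f p a \<Longrightarrow> b \<le> a \<Longrightarrow> mult_ge f p b"
  unfolding mult_ge_def by (rule subsetD[OF polyfuns_mono[of "{\<beta>. a \<le> mdeg \<beta>}"]]) auto

lemma polyfuns_exponents_below_mult:
  "f \<in> polyfuns (exponents_below (a + 1)) \<Longrightarrow> g \<in> polyfuns (exponents_below (b + 1)) \<Longrightarrow>
    (\<lambda>v. f v * g v) \<in> polyfuns (exponents_below (a + b + 1))"
  by (rule polyfuns_mult) (auto simp: exponents_below_def mdeg_add)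

text \<open>The sums on the right are the coefficients of the Taylor expansion at \<open>p\<close>.
  Independence of monomials identifies them with those of the expansion that \<open>mult_ge\<close>
  provides.\<close>

lemma mult_ge_iff:
  assumes f: "\<And>v. f v = (\<Sum>\<kappa>\<in>exponents_below D. G \<kappa> * eval_monomial \<kappa> v)"
  shows "mult_ge f p M \<longleftrightarrow> (\<forall>\<beta>\<in>exponents_below M. (\<Sum>\<kappa>\<in>exponents_below D. G \<kappa> * taylor_coeff \<beta> \<kappa> p) = 0)"
proof -
  define b where "b \<beta> = (\<Sum>\<kappa>\<in>exponents_below D. G \<kappa> * taylor_coeff \<beta> \<kappa> p)" for \<beta>
  have b0: "b \<beta> = 0" if "\<beta> \<notin> exponents_below D" for \<beta>
    unfolding b_def using that by (intro sum.neutral) (auto simp: exponents_below_def intro!: taylor_coeff_eq_0)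
  have expand: "f (\<lambda>b. p b + q b) = (\<Sum>\<beta>\<in>exponents_below D. b \<beta> * eval_monomial \<beta> q)" for q
  proof -
    have "f (\<lambda>b. p b + q b) =
      (\<Sum>\<kappa>\<in>exponents_below D. \<Sum>\<beta>\<in>exponents_below D. G \<kappa> * taylor_coeff \<beta> \<kappa> p * eval_monomial \<beta> q)"
      unfolding f by (intro sum.cong refl) (simp add: eval_monomial_taylor sum_distrib_left mult.assoc)
    then show ?thesis by (subst (asm) sum.swap) (simp add: b_def sum_distrib_right)
  qed
  have "b \<beta> = 0" if m: "mult_ge f p M" and \<beta>: "\<beta> \<in> exponents_below M" for \<beta>
  proof (cases "\<beta> \<in> exponents_below D")
    case True
    obtain c K where K: "finite K" "K \<subseteq> {\<beta>. M \<le> mdeg \<beta>}"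
      "\<And>q. f (\<lambda>b. p b + q b) = (\<Sum>\<beta>\<in>K. c \<beta> * eval_monomial \<beta> q)"
      using m unfolding mult_ge_def by (rule polyfuns_expand_finite) (rule that)
    \<comment> \<open>Coefficients of the difference of the two expansions, over a common finite set
      of exponents.\<close>
    define c' where "c' \<gamma> = b \<gamma> - (if \<gamma> \<in> K then c \<gamma> else 0)" for \<gamma>
    have "(\<Sum>\<gamma>\<in>exponents_below D \<union> K. c' \<gamma> * eval_monomial \<gamma> q) = 0" for q
    proof -
      have "(\<Sum>\<gamma>\<in>exponents_below D \<union> K. c' \<gamma> * eval_monomial \<gamma> q) =
        (\<Sum>\<gamma>\<in>exponents_below D \<union> K. b \<gamma> * eval_monomial \<gamma> q) -
        (\<Sum>\<gamma>\<in>exponents_below D \<union> K. (if \<gamma> \<in> K then c \<gamma> else 0) * eval_monomial \<gamma> q)"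
        by (simp add: c'_def left_diff_distrib sum_subtractf)
      also have "(\<Sum>\<gamma>\<in>exponents_below D \<union> K. b \<gamma> * eval_monomial \<gamma> q) = (\<Sum>\<gamma>\<in>exponents_below D. b \<gamma> * eval_monomial \<gamma> q)"
        using K(1) b0 by (intro sum.mono_neutral_right) auto
      also have "(\<Sum>\<gamma>\<in>exponents_below D \<union> K. (if \<gamma> \<in> K then c \<gamma> else 0) * eval_monomial \<gamma> q) =
          (\<Sum>\<gamma>\<in>K. c \<gamma> * eval_monomial \<gamma> q)"
        using K(1) by (intro sum.mono_neutral_cong_right) auto
      finally show ?thesis by (simp flip: expand K(3))
    qed
    then have "c' \<beta> = 0"
      by (intro eval_monomial_independent[of UNIV "exponents_below D \<union> K" c' \<beta>]) (use K True in auto)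
    moreover have "\<beta> \<notin> K" using K(2) \<beta> by (auto simp: exponents_below_def)
    ultimately show ?thesis by (simp add: c'_def)
  qed (rule b0)
  moreover have "mult_ge f p M" if "\<forall>\<beta>\<in>exponents_below M. b \<beta> = 0"
  proof -
    have "(\<lambda>q. \<Sum>\<beta>\<in>exponents_below D - exponents_below M. b \<beta> * eval_monomial \<beta> q) \<in> polyfuns {\<beta>. M \<le> mdeg \<beta>}"
      by (intro polyfuns_sum polyfuns_monomial) (auto simp: exponents_below_def)
    moreover have "(\<Sum>\<beta>\<in>exponents_below D. b \<beta> * eval_monomial \<beta> q) =
      (\<Sum>\<beta>\<in>exponents_below D - exponents_below M. b \<beta> * eval_monomial \<beta> q)" for q
      using that by (intro sum.mono_neutral_right) auto
    ultimately show ?thesis unfolding mult_ge_def by (simp add: expand)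
  qed
  ultimately show ?thesis unfolding b_def by blast
qed

lemma exponents_below_independent:
  assumes "\<And>v. (\<Sum>\<kappa>\<in>exponents_below D. G \<kappa> * eval_monomial \<kappa> v) = 0" "\<kappa> \<in> exponents_below D"
  shows "G \<kappa> = 0"
  by (rule eval_monomial_independent[of UNIV "exponents_below D"]) (use assms in auto)

text \<open>A nonzero polynomial of degree at most \<open>d\<close> is a plane curve of degree
  \<open>d\<close> that may contain the line at infinity. The curve may be reducible or nonreduced,
  and the points may coincide.\<close>

definition has_curve :: "nat \<Rightarrow> (nat \<Rightarrow> bool \<Rightarrow> complex) \<Rightarrow> nat \<Rightarrow> (nat \<Rightarrow> nat) \<Rightarrow> bool" where
  "has_curve h p d \<mu> \<longleftrightarrow>
     (\<exists>f\<in>polyfuns (exponents_below (d + 1)). (\<exists>v. f v \<noteq> 0) \<and> (\<forall>l\<le>h. mult_ge f (p l) (\<mu> l)))"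

lemma has_curve_mono:
  assumes "has_curve h p d \<mu>" "d \<le> d'" "\<And>l. l \<le> h \<Longrightarrow> \<mu>' l \<le> \<mu> l"
  shows "has_curve h p d' \<mu>'"
proof -
  have "polyfuns (exponents_below (d + 1)) \<subseteq> polyfuns (exponents_below (d' + 1))"
    using assms(2) by (intro polyfuns_mono) (auto simp: exponents_below_def)
  then show ?thesis using assms unfolding has_curve_def by (meson mult_ge_mono subsetD)
qed

lemma has_curve_add:
  assumes "has_curve h p d \<mu>" "has_curve h p d' \<mu>'"
  shows "has_curve h p (d + d') (\<lambda>l. \<mu> l + \<mu>' l)"
proof -
  obtain f v where f: "f \<in> polyfuns (exponents_below (d + 1))" "f v \<noteq> 0" "\<And>l. l \<le> h \<Longrightarrow> mult_ge f (p l) (\<mu> l)"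
    using assms(1) by (auto simp: has_curve_def)
  obtain g w where g: "g \<in> polyfuns (exponents_below (d' + 1))" "g w \<noteq> 0" "\<And>l. l \<le> h \<Longrightarrow> mult_ge g (p l) (\<mu>' l)"
    using assms(2) by (auto simp: has_curve_def)
  have "\<exists>x. f x * g x \<noteq> 0"
    using polyfuns_no_zero_divisors[of f _ g _ v w, OF f(1) g(1) f(2) g(2)] by blast
  then show ?thesis unfolding has_curve_def
    by (intro bexI[OF _ polyfuns_exponents_below_mult[OF f(1) g(1)]] conjI allI impI mult_ge_mult f(3) g(3))
qed

lemma has_curve_sum:
  assumes "finite X" "\<And>x. x \<in> X \<Longrightarrow> has_curve h p (d x) (\<mu> x)"
  shows "has_curve h p (\<Sum>x\<in>X. d x) (\<lambda>l. \<Sum>x\<in>X. \<mu> x l)"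
  using assms
proof (induction X rule: finite_induct)
  case empty
  have "(\<lambda>v. 1) \<in> polyfuns (exponents_below (0 + 1))" by (rule polyfuns_const) (simp add: exponents_below_def)
  moreover have "mult_ge (\<lambda>v. 1) (p l) 0" for l unfolding mult_ge_def by (rule polyfuns_const) simp
  ultimately show ?case unfolding has_curve_def by (intro bexI[of _ "\<lambda>v. 1"]) auto
next
  case (insert x X)
  then show ?case using has_curve_add[of h p "d x" "\<mu> x" "\<Sum>x\<in>X. d x" "\<lambda>l. \<Sum>x\<in>X. \<mu> x l"] by simp
qed

text \<open>A point of multiplicity \<open>\<mu> l\<close> imposes
  \<open>\<mu> l * (\<mu> l + 1) / 2\<close> linear conditions on the
  \<open>(d + 1) * (d + 2) / 2\<close> coefficients. Both sides are doubled to stay in the natural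
  numbers.\<close>

lemma has_curveI:
  assumes "(\<Sum>l\<le>h. \<mu> l * (\<mu> l + 1)) < (d + 1) * (d + 2)"
  shows "has_curve h p d \<mu>"
proof -
  let ?T = "Sigma {..h} (\<lambda>l. exponents_below (\<mu> l))"
  have "2 * card ?T = (\<Sum>l\<le>h. \<mu> l * (\<mu> l + 1))"
    by (simp add: card_SigmaI sum_distrib_left card_exponents_below del: mult_Suc_right)
  also have "\<dots> < 2 * card (exponents_below (d + 1))" using assms by (simp add: card_exponents_below)
  finally have "card ?T < card (exponents_below (d + 1))" by simp
  from underdetermined_system[OF _ _ this, of "\<lambda>(l, \<beta>) \<kappa>. taylor_coeff \<beta> \<kappa> (p l)"] obtain G \<kappa>
    where \<kappa>: "\<kappa> \<in> exponents_below (d + 1)" "G \<kappa> \<noteq> 0"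
      and G: "\<And>l \<beta>. l \<le> h \<Longrightarrow> \<beta> \<in> exponents_below (\<mu> l) \<Longrightarrow>
        (\<Sum>\<kappa>\<in>exponents_below (d + 1). G \<kappa> * taylor_coeff \<beta> \<kappa> (p l)) = 0"
    by fastforce
  define f where "f v = (\<Sum>\<kappa>\<in>exponents_below (d + 1). G \<kappa> * eval_monomial \<kappa> v)" for v
  have "f \<in> polyfuns (exponents_below (d + 1))" unfolding f_def by (intro polyfuns_sum polyfuns_monomial)
  moreover have "\<exists>v. f v \<noteq> 0" using exponents_below_independent[where D = "d + 1" and G = G and \<kappa> = \<kappa>] \<kappa> unfolding f_def by blast
  moreover have "mult_ge f (p l) (\<mu> l)" if "l \<le> h" for l
    using G[OF that] by (simp add: mult_ge_iff[where D = "d + 1" and G = G, OF f_def])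
  ultimately show ?thesis unfolding has_curve_def by blast
qed

text \<open>Passing from \<open>D\<close> to \<open>D - C\<close>, where \<open>C\<close> is the given curve, increases the expected
  dimension. So \<open>D\<close> has more members than expected, and the conditions imposed by the multiple
  points are dependent.\<close>

lemma taylor_coeffs_dependent:
  fixes p :: "nat \<Rightarrow> bool \<Rightarrow> complex"
  assumes C: "has_curve h p e \<mu>" and "e \<le> d"
    and count: "(d + 1) * (d + 2) + (\<Sum>l\<le>h. (M - \<mu> l) * (M - \<mu> l + 1)) <
      (h + 1) * (M * (M + 1)) + (d - e + 1) * (d - e + 2)"
  obtains a l \<beta> where "l \<le> h" "\<beta> \<in> exponents_below M" "a (l, \<beta>) \<noteq> 0"
    "\<And>\<kappa>. \<kappa> \<in> exponents_below (d + 1) \<Longrightarrow>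
      (\<Sum>(l, \<beta>)\<in>{..h} \<times> exponents_below M. a (l, \<beta>) * taylor_coeff \<beta> \<kappa> (p l)) = 0"
proof -
  obtain f v where f: "f \<in> polyfuns (exponents_below (e + 1))" "f v \<noteq> 0" "\<And>l. l \<le> h \<Longrightarrow> mult_ge f (p l) (\<mu> l)"
    using C by (auto simp: has_curve_def)
  define T T' where "T = exponents_below (d + 1)" and "T' = exponents_below (d - e + 1)"
  have fin [simp]: "finite T" "finite T'" by (simp_all add: T_def T'_def)
  have "\<exists>c. \<forall>v. f v * eval_monomial \<gamma> v = (\<Sum>\<kappa>\<in>T. c \<kappa> * eval_monomial \<kappa> v)" if "\<gamma> \<in> T'" for \<gamma>
  proof -
    have "(\<lambda>v. 1 * eval_monomial \<gamma> v) \<in> polyfuns T'" using that by (rule polyfuns_monomial)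
    then have "(\<lambda>v. f v * eval_monomial \<gamma> v) \<in> polyfuns (exponents_below (e + (d - e) + 1))"
      unfolding T'_def by (intro polyfuns_exponents_below_mult[OF f(1)]) simp
    then have "(\<lambda>v. f v * eval_monomial \<gamma> v) \<in> polyfuns T" using \<open>e \<le> d\<close> by (simp add: T_def)
    from this fin(1) obtain c where "\<And>v. f v * eval_monomial \<gamma> v = (\<Sum>\<kappa>\<in>T. c \<kappa> * eval_monomial \<kappa> v)"
      by (rule polyfuns_expand) (rule that)
    then show ?thesis by blast
  qed
  then obtain F where F: "\<And>\<gamma> v. \<gamma> \<in> T' \<Longrightarrow> f v * eval_monomial \<gamma> v = (\<Sum>\<kappa>\<in>T. F \<gamma> \<kappa> * eval_monomial \<kappa> v)"
    by metis
  define L L' where "L = {..h} \<times> exponents_below M" and "L' = Sigma {..h} (\<lambda>l. exponents_below (M - \<mu> l))"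
  have finL [simp]: "finite L" "finite L'" by (simp_all add: L_def L'_def)
  have "2 * card L = (h + 1) * (M * (M + 1))"
    using card_exponents_below[of M] by (simp add: L_def card_cartesian_product)
  moreover have "2 * card L' = (\<Sum>l\<le>h. (M - \<mu> l) * (M - \<mu> l + 1))"
    by (simp add: L'_def card_SigmaI sum_distrib_left card_exponents_below del: mult_Suc_right)
  moreover have "2 * card T = (d + 1) * (d + 2)" "2 * card T' = (d - e + 1) * (d - e + 2)"
    by (simp_all add: T_def T'_def card_exponents_below)
  ultimately have less: "card (T <+> L') < card (L <+> T')"
    using count by (simp add: card_Plus)
  \<comment> \<open>The unknowns are the coefficients \<open>a\<close> of a combination
    \<open>u\<close> of Taylor functionals and the conjugated coefficients of some \<open>G\<close>
    in D - C. The equations say that \<open>u\<close> is minus the conjugate of the coefficient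
    vector \<open>H\<close> of \<open>f * G\<close>, and that \<open>G\<close> has multiplicity
    \<open>M - \<mu> l\<close> at \<open>p l\<close>. Taking conjugates as unknowns keeps the system
    linear.\<close>
  define eqs where "eqs t x = (case t of
      Inl \<kappa> \<Rightarrow> (case x of Inl (l, \<beta>) \<Rightarrow> taylor_coeff \<beta> \<kappa> (p l) | Inr \<gamma> \<Rightarrow> cnj (F \<gamma> \<kappa>))
    | Inr (l, \<beta>) \<Rightarrow> (case x of Inl _ \<Rightarrow> 0 | Inr \<gamma> \<Rightarrow> cnj (taylor_coeff \<beta> \<gamma> (p l))))"
    for t :: "(bool \<Rightarrow>\<^sub>0 nat) + nat \<times> (bool \<Rightarrow>\<^sub>0 nat)" and x :: "nat \<times> (bool \<Rightarrow>\<^sub>0 nat) + (bool \<Rightarrow>\<^sub>0 nat)"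
  obtain c where c: "\<exists>x\<in>L <+> T'. c x \<noteq> 0" "\<forall>t\<in>T <+> L'. (\<Sum>x\<in>L <+> T'. c x * eqs t x) = 0"
    using underdetermined_system[OF _ _ less, of eqs] by auto
  define a where "a lb = c (Inl lb)" for lb
  define g where "g \<gamma> = cnj (c (Inr \<gamma>))" for \<gamma>
  define H where "H \<kappa> = (\<Sum>\<gamma>\<in>T'. g \<gamma> * F \<gamma> \<kappa>)" for \<kappa>
  define u where "u \<kappa> = (\<Sum>(l, \<beta>)\<in>L. a (l, \<beta>) * taylor_coeff \<beta> \<kappa> (p l))" for \<kappa>
  have uH: "u \<kappa> + cnj (H \<kappa>) = 0" if "\<kappa> \<in> T" for \<kappa>
    using c(2)[rule_format, OF InlI[OF that]]
    by (simp add: sum.Plus eqs_def u_def H_def a_def g_def case_prod_unfold)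
  have gcond: "(\<Sum>\<gamma>\<in>T'. g \<gamma> * taylor_coeff \<beta> \<gamma> (p l)) = 0" if "l \<le> h" "\<beta> \<in> exponents_below (M - \<mu> l)" for l \<beta>
  proof -
    have "(\<Sum>\<gamma>\<in>T'. c (Inr \<gamma>) * cnj (taylor_coeff \<beta> \<gamma> (p l))) = 0"
      using c(2)[rule_format, OF InrI[of "(l, \<beta>)" L' T]] that
      by (simp add: sum.Plus eqs_def) (simp add: L'_def)
    then have "cnj (\<Sum>\<gamma>\<in>T'. c (Inr \<gamma>) * cnj (taylor_coeff \<beta> \<gamma> (p l))) = 0" by simp
    then show ?thesis by (simp add: g_def)
  qed
  define G where "G v = (\<Sum>\<gamma>\<in>T'. g \<gamma> * eval_monomial \<gamma> v)" for v
  have fG: "f v * G v = (\<Sum>\<kappa>\<in>T. H \<kappa> * eval_monomial \<kappa> v)" for v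
  proof -
    have "f v * G v = (\<Sum>\<gamma>\<in>T'. g \<gamma> * (f v * eval_monomial \<gamma> v))"
      by (simp add: G_def sum_distrib_left mult_ac)
    also have "\<dots> = (\<Sum>\<gamma>\<in>T'. \<Sum>\<kappa>\<in>T. g \<gamma> * F \<gamma> \<kappa> * eval_monomial \<kappa> v)"
      by (simp add: F sum_distrib_left mult.assoc)
    also have "\<dots> = (\<Sum>\<kappa>\<in>T. H \<kappa> * eval_monomial \<kappa> v)"
      by (subst sum.swap) (simp add: H_def sum_distrib_right)
    finally show ?thesis .
  qed
  have "(\<Sum>\<kappa>\<in>T. H \<kappa> * taylor_coeff \<beta> \<kappa> (p l)) = 0" if "l \<le> h" "\<beta> \<in> exponents_below M" for l \<beta>
  proof -
    have "mult_ge G (p l) (M - \<mu> l)"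
      using gcond[OF that(1)] by (simp add: mult_ge_iff[where D = "d - e + 1" and G = g] G_def T'_def)
    from mult_ge_mult[OF f(3)[OF that(1)] this] have "mult_ge (\<lambda>v. f v * G v) (p l) M"
      by (rule mult_ge_mono) simp
    with that(2) show ?thesis by (simp add: mult_ge_iff[where D = "d + 1" and G = H] fG T_def)
  qed
  \<comment> \<open>The product \<open>f * G\<close> belongs to D, so all functionals combined in
    \<open>u\<close> annihilate it. As \<open>u\<close> is the negative conjugate of
    \<open>H\<close>, this says that \<open>H\<close> has norm 0.\<close>
  then have "(\<Sum>\<kappa>\<in>T. H \<kappa> * u \<kappa>) = 0"
    unfolding u_def sum_distrib_left
    by (subst sum.swap) (auto simp: L_def case_prod_unfold mult.left_commute[of "H _"] simp flip: sum_distrib_left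
        intro!: sum.neutral)
  moreover have "H \<kappa> * u \<kappa> = - complex_of_real ((cmod (H \<kappa>))\<^sup>2)" if "\<kappa> \<in> T" for \<kappa>
    using uH[OF that] complex_norm_square[of "H \<kappa>"] by (simp add: eq_neg_iff_add_eq_0[symmetric])
  ultimately have "complex_of_real (\<Sum>\<kappa>\<in>T. (cmod (H \<kappa>))\<^sup>2) = 0" by (simp add: sum_negf)
  then have "(\<Sum>\<kappa>\<in>T. (cmod (H \<kappa>))\<^sup>2) = 0" by (simp only: of_real_eq_0_iff)
  then have H0: "H \<kappa> = 0" if "\<kappa> \<in> T" for \<kappa> using that by (simp add: sum_nonneg_eq_0_iff)
  have G0: "G w = 0" for w
  proof (rule ccontr)
    assume "G w \<noteq> 0"
    have "G \<in> polyfuns T'" unfolding G_def by (intro polyfuns_sum polyfuns_monomial)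
    from polyfuns_no_zero_divisors[of f _ G _ v w, OF f(1) this f(2) \<open>G w \<noteq> 0\<close>] show False
      by (simp add: fG H0)
  qed
  have "g \<gamma> = 0" if "\<gamma> \<in> T'" for \<gamma>
    using exponents_below_independent[where D = "d - e + 1" and G = g and \<kappa> = \<gamma>] G0 that by (simp add: G_def T'_def)
  \<comment> \<open>With \<open>G\<close> gone, the nontrivial solution must be visible in
    \<open>a\<close>.\<close>
  then have "\<forall>\<gamma>\<in>T'. c (Inr \<gamma>) = 0" by (simp add: g_def)
  with c(1) obtain l \<beta> where "(l, \<beta>) \<in> L" "a (l, \<beta>) \<noteq> 0" by (auto simp: a_def)
  moreover have "u \<kappa> = 0" if "\<kappa> \<in> T" for \<kappa> using uH[OF that] H0[OF that] by simp
  ultimately show ?thesis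
    by (intro that[of l \<beta> a]) (simp_all add: L_def T_def u_def)
qed

section \<open>Exceptional curves and the numerical cases\<close>

lemma sum_single_other: "j \<le> h \<Longrightarrow> (\<Sum>l\<le>h. if l = j then x else y) = x + h * y" for x y j h :: nat
proof -
  assume "j \<le> h"
  then have "(\<Sum>l\<le>h. if l = j then x else y) = x + (\<Sum>l\<in>{..h} - {j}. y)"
    by (subst sum.remove[of _ j]) auto
  also have "\<dots> = x + h * y" using \<open>j \<le> h\<close> by simp
  finally show ?thesis .
qed

lemma has_curve_exceptional:
  assumes "x * (x + 1) + h * (y * (y + 1)) < (e + 1) * (e + 2)" "j \<le> h"
  shows "has_curve h p e (\<lambda>l. if l = j then x else y)"
proof (rule has_curveI)
  have "(\<Sum>l\<le>h. (if l = j then x else y) * ((if l = j then x else y) + 1)) =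
    (\<Sum>l\<le>h. if l = j then x * (x + 1) else y * (y + 1))" by (intro sum.cong) auto
  with assms show "(\<Sum>l\<le>h. (if l = j then x else y) * ((if l = j then x else y) + 1)) < (e + 1) * (e + 2)"
    by (simp add: sum_single_other)
qed

text \<open>Powers of the product of the \<open>h + 1\<close> exceptional curves, times a curve that exists by
  counting conditions.\<close>

lemma has_curve_homogeneous:
  assumes exc: "x * (x + 1) + h * (y * (y + 1)) < (e + 1) * (e + 2)"
    and k: "x + h * y = k" "k > 0"
    and rest: "\<And>r d. r < k \<Longrightarrow> (h + 1) * e * r \<le> k * d \<Longrightarrow> (h + 1) * (r * (r + 1)) < (d + 1) * (d + 2)"
    and d: "(h + 1) * e * M \<le> k * d"
  shows "has_curve h p d (\<lambda>_. M)"
proof -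
  define s where "s = (h + 1) * e"
  have "has_curve h p (\<Sum>j\<in>{..h}. e) (\<lambda>l. \<Sum>j\<in>{..h}. if l = j then x else y)"
    by (intro has_curve_sum has_curve_exceptional[OF exc]) auto
  moreover have "(\<Sum>j\<in>{..h}. if l = j then x else y) = k" if "l \<le> h" for l
    using sum_single_other[OF that, of x y] k(1) by (simp add: eq_commute)
  ultimately have 1: "has_curve h p s (\<lambda>_. k)"
    by (intro has_curve_mono[where \<mu>' = "\<lambda>_. k"]) (auto simp: s_def)
  \<comment> \<open>Division with remainder: \<open>q\<close> copies of the product of all
    exceptional curves give multiplicity \<open>k * q\<close>, and the remaining
    \<open>r < k\<close> is reached by counting in degree \<open>d - s * q\<close>.\<close>
  define q r where "q = M div k" and "r = M mod k"
  have M: "M = k * q + r" by (simp add: q_def r_def)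
  have 2: "has_curve h p (s * q) (\<lambda>_. k * q)"
    using has_curve_sum[of "{..<q}" h p "\<lambda>_. s" "\<lambda>_ _. k"] 1 by (simp add: mult.commute)
  have le: "k * (s * q) + s * r \<le> k * d" using d by (simp add: M s_def algebra_simps)
  then have "k * (s * q) \<le> k * d" by (rule add_leD1)
  then have "s * q \<le> d" using k(2) by (metis nat_mult_le_cancel1)
  then have "s * r \<le> k * (d - s * q)" using le by (simp add: diff_mult_distrib2)
  then have "has_curve h p (d - s * q) (\<lambda>_. r)"
    using rest[of r "d - s * q"] k(2) by (intro has_curveI) (simp add: s_def r_def)
  from has_curve_add[OF 2 this] show ?thesis using \<open>s * q \<le> d\<close> by (simp add: M)
qed

text \<open>After multiplication by \<open>k\<^sup>2\<close> the degree enters only through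
  \<open>k * d\<close>, which can be replaced by its lower bound \<open>s * r\<close>. This leaves
  an inequality in \<open>r\<close> alone.\<close>

lemma rest_count:
  fixes k r s d n :: nat
  assumes "s * r \<le> k * d" "k\<^sup>2 * n * (r * (r + 1)) < (s * r + k) * (s * r + 2 * k)"
  shows "n * (r * (r + 1)) < (d + 1) * (d + 2)"
proof -
  have "(s * r + k) * (s * r + 2 * k) \<le> (k * d + k) * (k * d + 2 * k)"
    using assms(1) by (intro mult_mono) auto
  also have "\<dots> = k\<^sup>2 * ((d + 1) * (d + 2))" by (simp add: algebra_simps power2_eq_square)
  finally have "k\<^sup>2 * (n * (r * (r + 1))) < k\<^sup>2 * ((d + 1) * (d + 2))"
    using assms(2) by (simp only: mult.assoc)
  then show ?thesis by (rule mult_less_cancel1[THEN iffD1, THEN conjunct2])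
qed

text \<open>The line through two points and the conic through five already treat all points alike,
  so their powers suffice. In the other cases the curve has multiplicity \<open>x\<close> at one
  distinguished point and \<open>y\<close> at the rest, and the product over all choices of that
  point has multiplicity \<open>k = x + h * y\<close> everywhere.\<close>

lemma has_curve_cases:
  assumes "h = 1 \<and> M \<le> d \<or> h = 2 \<and> 3 * M \<le> 2 * d \<or> h = 4 \<and> 2 * M \<le> d \<or>
    h = 5 \<and> 12 * M \<le> 5 * d \<or> h = 6 \<and> 21 * M \<le> 8 * d \<or> h = 7 \<and> 48 * M \<le> 17 * d"
  shows "has_curve h p d (\<lambda>_. M)"
  using assms
proof (elim disjE conjE)
  assume h: "h = 1" and d: "M \<le> d"
  have "has_curve h p 1 (\<lambda>l. if l = 0 then 1 else 1)" by (rule has_curve_exceptional) (simp_all add: h)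
  then have "has_curve h p (\<Sum>i<M. 1) (\<lambda>l. \<Sum>i<M. 1)" by (intro has_curve_sum) simp_all
  then show ?thesis by (rule has_curve_mono) (use d in simp_all)
next
  assume h: "h = 2" and d: "3 * M \<le> 2 * d"
  have "3 * (r * (r + 1)) < (d + 1) * (d + 2)" if "r < 2" "3 * r \<le> 2 * d" for r d :: nat
    using that by (intro rest_count[of 3 r 2 d]) (auto simp: less_2_cases_iff)
  then show ?thesis unfolding h
    by (intro has_curve_homogeneous[where x = 0 and y = 1 and e = 1 and k = 2]) (use d in simp_all)
next
  assume h: "h = 4" and d: "2 * M \<le> d"
  have "has_curve h p 2 (\<lambda>l. if l = 0 then 1 else 1)" by (rule has_curve_exceptional) (simp_all add: h)
  then have "has_curve h p (\<Sum>i<M. 2) (\<lambda>l. \<Sum>i<M. 1)" by (intro has_curve_sum) simp_all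
  then show ?thesis by (rule has_curve_mono) (use d in simp_all)
next
  assume h: "h = 5" and d: "12 * M \<le> 5 * d"
  have "6 * (r * (r + 1)) < (d + 1) * (d + 2)" if "r < 5" "12 * r \<le> 5 * d" for r d :: nat
  proof (rule rest_count[OF that(2)])
    \<comment> \<open>The leading coefficient 150 on the left exceeds 144 on the right, so the
      inequality fails for large \<open>r\<close>. The excess \<open>6 * r * r\<close> is at most
      \<open>30 * r\<close>, exactly the difference of the linear terms. The same happens below with
      \<open>7 * r * r \<le> 56 * r\<close> and \<open>8 * r * r \<le> 136 * r\<close>.\<close>
    have "r * r \<le> 5 * r" using that(1) by simp
    then show "5\<^sup>2 * 6 * (r * (r + 1)) < (12 * r + 5) * (12 * r + 2 * 5)"
      unfolding power2_eq_square distrib_left distrib_right by linarith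
  qed
  then show ?thesis unfolding h
    by (intro has_curve_homogeneous[where x = 0 and y = 1 and e = 2 and k = 5]) (use d in simp_all)
next
  assume h: "h = 6" and d: "21 * M \<le> 8 * d"
  have "7 * (r * (r + 1)) < (d + 1) * (d + 2)" if "r < 8" "21 * r \<le> 8 * d" for r d :: nat
  proof (rule rest_count[OF that(2)])
    have "r * r \<le> 8 * r" using that(1) by simp
    then show "8\<^sup>2 * 7 * (r * (r + 1)) < (21 * r + 8) * (21 * r + 2 * 8)"
      unfolding power2_eq_square distrib_left distrib_right by linarith
  qed
  then show ?thesis unfolding h
    by (intro has_curve_homogeneous[where x = 2 and y = 1 and e = 3 and k = 8]) (use d in simp_all)
next
  assume h: "h = 7" and d: "48 * M \<le> 17 * d"
  have "8 * (r * (r + 1)) < (d + 1) * (d + 2)" if "r < 17" "48 * r \<le> 17 * d" for r d :: nat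
  proof (rule rest_count[OF that(2)])
    have "r * r \<le> 17 * r" using that(1) by simp
    then show "17\<^sup>2 * 8 * (r * (r + 1)) < (48 * r + 17) * (48 * r + 2 * 17)"
      unfolding power2_eq_square distrib_left distrib_right by linarith
  qed
  then show ?thesis unfolding h
    by (intro has_curve_homogeneous[where x = 3 and y = 2 and e = 6 and k = 17]) (use d in simp_all)
qed

text \<open>The upper bounds on \<open>d\<close> say D.C \<le> -2 for the exceptional curve C, so
  \<chi>(D - C) > \<chi>(D). Written over the integers, the quadratic terms in \<open>d\<close> and
  \<open>M\<close> cancel, and each case becomes a linear inequality.\<close>

lemma taylor_coeffs_dependent_cases:
  fixes p :: "nat \<Rightarrow> bool \<Rightarrow> complex"
  assumes cases: "h = 1 \<and> M \<le> d \<and> d + 2 \<le> 2 * M \<or> h = 2 \<and> 3 * M \<le> 2 * d \<and> d + 2 \<le> 2 * M \<or>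
     h = 4 \<and> 2 * M \<le> d \<and> 2 * d + 2 \<le> 5 * M \<or> h = 5 \<and> 12 * M \<le> 5 * d \<and> 2 * d + 2 \<le> 5 * M \<or>
     h = 6 \<and> 21 * M \<le> 8 * d \<and> 3 * d + 2 \<le> 8 * M \<or> h = 7 \<and> 48 * M \<le> 17 * d \<and> 6 * d + 2 \<le> 17 * M"
    and M: "M \<ge> 2"
  obtains a l \<beta> where "l \<le> h" "\<beta> \<in> exponents_below M" "a (l, \<beta>) \<noteq> 0"
    "\<And>\<kappa>. \<kappa> \<in> exponents_below (d + 1) \<Longrightarrow>
      (\<Sum>(l, \<beta>)\<in>{..h} \<times> exponents_below M. a (l, \<beta>) * taylor_coeff \<beta> \<kappa> (p l)) = 0"
proof -
  note result = that
  have *: ?thesis if exc: "x * (x + 1) + h * (y * (y + 1)) < (e + 1) * (e + 2)" and "e \<le> d" "x \<le> M" "y \<le> M"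
    and count: "(int d + 1) * (int d + 2) + (int M - int x) * (int M - int x + 1) +
      int h * ((int M - int y) * (int M - int y + 1)) <
      (int h + 1) * (int M * (int M + 1)) + (int d - int e + 1) * (int d - int e + 2)" for x y e
  proof (rule taylor_coeffs_dependent[OF has_curve_exceptional[OF exc le0, of p] \<open>e \<le> d\<close>])
    have "(\<Sum>l\<le>h. (M - (if l = 0 then x else y)) * (M - (if l = 0 then x else y) + 1)) =
      (\<Sum>l\<le>h. if l = 0 then (M - x) * (M - x + 1) else (M - y) * (M - y + 1))" by (intro sum.cong) auto
    moreover have "int ((d + 1) * (d + 2) + ((M - x) * (M - x + 1) + h * ((M - y) * (M - y + 1)))) <
       int ((h + 1) * (M * (M + 1)) + (d - e + 1) * (d - e + 2))"
      using count \<open>e \<le> d\<close> \<open>x \<le> M\<close> \<open>y \<le> M\<close>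
      by (simp only: of_nat_add of_nat_mult of_nat_diff of_nat_1 of_nat_numeral)
    ultimately show "(d + 1) * (d + 2) +
       (\<Sum>l\<le>h. (M - (if l = 0 then x else y)) * (M - (if l = 0 then x else y) + 1)) <
       (h + 1) * (M * (M + 1)) + (d - e + 1) * (d - e + 2)"
      by (simp only: of_nat_less_iff sum_single_other[of 0 h] le0)
  qed (rule result)
  from cases show ?thesis
  proof (elim disjE conjE)
    assume h: "h = 1" and "M \<le> d" "d + 2 \<le> 2 * M"
    then show ?thesis using M by (intro *[of 1 1 1]) (auto simp: algebra_simps)
  next
    assume h: "h = 2" and "3 * M \<le> 2 * d" "d + 2 \<le> 2 * M"
    then show ?thesis using M by (intro *[of 0 1 1]) (auto simp: algebra_simps)
  next
    assume h: "h = 4" and "2 * M \<le> d" "2 * d + 2 \<le> 5 * M"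
    then show ?thesis using M by (intro *[of 1 1 2]) (auto simp: algebra_simps)
  next
    assume h: "h = 5" and "12 * M \<le> 5 * d" "2 * d + 2 \<le> 5 * M"
    then show ?thesis using M by (intro *[of 0 1 2]) (auto simp: algebra_simps)
  next
    assume h: "h = 6" and "21 * M \<le> 8 * d" "3 * d + 2 \<le> 8 * M"
    then show ?thesis using M by (intro *[of 2 1 3]) (auto simp: algebra_simps)
  next
    assume h: "h = 7" and "48 * M \<le> 17 * d" "6 * d + 2 \<le> 17 * M"
    \<comment> \<open>The triple point of the sextic requires this: \<open>M = 2\<close> would give
      both \<open>d \<ge> 6\<close> and \<open>d \<le> 5\<close>.\<close>
    then have "M \<ge> 3" using M by arith
    with h \<open>48 * M \<le> 17 * d\<close> \<open>6 * d + 2 \<le> 17 * M\<close> show ?thesis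
      by (intro *[of 3 2 6]) (auto simp: algebra_simps)
  qed
qed

section \<open>The Jacobian criterion\<close>

text \<open>Total degree is the measure by which a relation of minimal degree is chosen; the bounds
  on single exponents in \<open>cube\<close> allow exact counting.\<close>

abbreviation polys :: "'i set \<Rightarrow> nat \<Rightarrow> (('i \<Rightarrow> complex) \<Rightarrow> complex) set" where
  "polys J D \<equiv> polyfuns {\<kappa>. keys \<kappa> \<subseteq> J \<and> mdeg \<kappa> \<le> D}"

abbreviation cube :: "'i set \<Rightarrow> nat \<Rightarrow> ('i \<Rightarrow>\<^sub>0 nat) set" where
  "cube J B \<equiv> {\<kappa>. keys \<kappa> \<subseteq> J \<and> (\<forall>i. lookup \<kappa> i \<le> B)}"

lemma cube_subset_polys:
  assumes "finite J"
  shows "polyfuns (cube J B) \<subseteq> polys J (card J * B)"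
proof (rule polyfuns_mono, safe)
  fix \<kappa> :: "'a \<Rightarrow>\<^sub>0 nat"
  assume "keys \<kappa> \<subseteq> J" "\<forall>i. lookup \<kappa> i \<le> B"
  then show "mdeg \<kappa> \<le> card J * B"
    using sum_bounded_above[of J "lookup \<kappa>" B] by (simp add: mdeg_eq_sum[OF assms])
qed

lemma
  assumes "finite J"
  shows finite_cube: "finite (cube J B)" and card_cube: "card (cube J B) = (B + 1) ^ card J"
proof -
  define P where "P = PiE J (\<lambda>_. {..B})"
  have P: "finite P" "card P = (B + 1) ^ card J"
    using assms by (auto simp: P_def card_PiE finite_PiE)
  define r where "r = (\<lambda>\<kappa>. restrict (lookup \<kappa>) J :: 'a \<Rightarrow> nat)"
  have "bij_betw r (cube J B) P"
  proof (rule bij_betw_byWitness[where f' = "\<lambda>g. Abs_poly_mapping (\<lambda>i. if i \<in> J then g i else 0)"])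
    have lookup: "lookup (Abs_poly_mapping (\<lambda>i. if i \<in> J then g i else 0)) =
      (\<lambda>i. if i \<in> J then g i else (0 :: nat))" for g
      by (rule lookup_Abs_poly_mapping) (use assms in \<open>auto intro: rev_finite_subset\<close>)
    show "\<forall>\<kappa>\<in>cube J B. Abs_poly_mapping (\<lambda>i. if i \<in> J then r \<kappa> i else 0) = \<kappa>"
    proof
      fix \<kappa> assume "\<kappa> \<in> cube J B"
      then show "Abs_poly_mapping (\<lambda>i. if i \<in> J then r \<kappa> i else 0) = \<kappa>"
        by (intro poly_mapping_eqI) (auto simp: lookup r_def in_keys_iff)
    qed
    show "\<forall>g\<in>P. r (Abs_poly_mapping (\<lambda>i. if i \<in> J then g i else 0)) = g"
      by (auto simp: r_def P_def lookup fun_eq_iff PiE_def extensional_def)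
    show "r ` cube J B \<subseteq> P" by (force simp: r_def P_def)
    show "(\<lambda>g. Abs_poly_mapping (\<lambda>i. if i \<in> J then g i else 0)) ` P \<subseteq> cube J B"
      by (auto simp: P_def lookup in_keys_iff PiE_def Pi_def split: if_splits)
  qed
  with P show "finite (cube J B)" "card (cube J B) = (B + 1) ^ card J"
    by (auto simp: bij_betw_finite bij_betw_same_card)
qed

text \<open>\<open>f'\<close> is a gradient of \<open>f\<close>, described by its effect along
  arbitrary differentiable curves. Lines would not suffice: relations are differentiated along the
  image of a line under nonlinear polynomials.\<close>

definition chain_rule ::
  "'i set \<Rightarrow> (('i \<Rightarrow> complex) \<Rightarrow> complex) \<Rightarrow> ('i \<Rightarrow> ('i \<Rightarrow> complex) \<Rightarrow> complex) \<Rightarrow> bool" where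
  "chain_rule J f f' \<longleftrightarrow> (\<forall>\<gamma> \<gamma>' t. (\<forall>i\<in>J. ((\<lambda>s. \<gamma> s i) has_field_derivative \<gamma>' i) (at t)) \<longrightarrow>
     ((\<lambda>s. f (\<gamma> s)) has_field_derivative (\<Sum>i\<in>J. f' i (\<gamma> t) * \<gamma>' i)) (at t))"

lemma chain_ruleD:
  "chain_rule J f f' \<Longrightarrow> (\<And>i. i \<in> J \<Longrightarrow> ((\<lambda>s. \<gamma> s i) has_field_derivative \<gamma>' i) (at t)) \<Longrightarrow>
     ((\<lambda>s. f (\<gamma> s)) has_field_derivative (\<Sum>i\<in>J. f' i (\<gamma> t) * \<gamma>' i)) (at t)"
  unfolding chain_rule_def by blast

lemma eval_monomial_lower:
  assumes "finite J" "keys \<kappa> \<subseteq> J" "i \<in> J" "lookup \<kappa> i \<noteq> 0"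
  shows "eval_monomial (\<kappa> - single i 1) v =
      v i ^ (lookup \<kappa> i - 1) * (\<Prod>j\<in>J - {i}. v j ^ lookup \<kappa> j)"
    and "keys (\<kappa> - single i 1) \<subseteq> J"
    and "mdeg (\<kappa> - single i 1) = mdeg \<kappa> - 1"
proof -
  show keys: "keys (\<kappa> - single i 1) \<subseteq> J"
    using assms by (auto simp: in_keys_iff lookup_minus subset_iff)
  have "(\<Prod>j\<in>J - {i}. v j ^ lookup (\<kappa> - single i 1) j) =
    (\<Prod>j\<in>J - {i}. v j ^ lookup \<kappa> j)"
    by (intro prod.cong) (auto simp: lookup_minus lookup_single)
  then show "eval_monomial (\<kappa> - single i 1) v =
      v i ^ (lookup \<kappa> i - 1) * (\<Prod>j\<in>J - {i}. v j ^ lookup \<kappa> j)"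
    unfolding eval_monomial_eq_prod[OF assms(1) keys] prod.remove[OF assms(1,3)]
    by (simp add: lookup_minus del: One_nat_def)
  have "\<kappa> = (\<kappa> - single i 1) + single i 1"
    using assms(4) by (intro poly_mapping_eqI) (auto simp: lookup_add lookup_minus lookup_single when_def)
  then have "mdeg \<kappa> = mdeg (\<kappa> - single i 1) + 1"
    by (metis mdeg_add mdeg_single)
  then show "mdeg (\<kappa> - single i 1) = mdeg \<kappa> - 1" by simp
qed

lemma polys_chain_rule:
  assumes "finite J" "f \<in> polys J D"
  shows "\<exists>f'. (\<forall>i\<in>J. f' i \<in> polys J (D - 1)) \<and> chain_rule J f f'"
  using assms(2)
proof (induction rule: polyfuns_induct)
  case (monomial c \<kappa>)
  define l where "l = lookup \<kappa>"
  define f' where "f' i = (if l i = 0 then (\<lambda>v. 0)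
    else (\<lambda>v. (c * of_nat (l i)) * eval_monomial (\<kappa> - single i 1) v))" for i
  have "f' i \<in> polys J (D - 1)" if "i \<in> J" for i
  proof (cases "l i = 0")
    case False
    then show ?thesis
      using monomial that eval_monomial_lower(2,3)[OF assms(1), of \<kappa> i]
      by (auto simp: f'_def l_def intro!: polyfuns_monomial diff_le_mono)
  qed (auto simp: f'_def polyfuns_0)
  moreover have "chain_rule J (\<lambda>v. c * eval_monomial \<kappa> v) f'"
    unfolding chain_rule_def
  proof (intro allI impI)
    fix \<gamma> :: "complex \<Rightarrow> 'a \<Rightarrow> complex" and \<gamma>' t
    assume \<gamma>: "\<forall>i\<in>J. ((\<lambda>s. \<gamma> s i) has_field_derivative \<gamma>' i) (at t)"
    have "((\<lambda>s. c * (\<Prod>i\<in>J. \<gamma> s i ^ l i)) has_field_derivative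
      c * (\<Sum>i\<in>J. (of_nat (l i) * (\<gamma>' i * \<gamma> t i ^ (l i - 1))) * (\<Prod>j\<in>J - {i}. \<gamma> t j ^ l j))) (at t)"
    proof (intro DERIV_cmult has_field_derivative_prod)
      fix i assume "i \<in> J"
      with \<gamma> have "((\<lambda>s. \<gamma> s i ^ l i) has_field_derivative of_nat (l i) * (\<gamma>' i * \<gamma> t i ^ (l i - Suc 0))) (at t)"
        by (intro DERIV_power) auto
      then show "((\<lambda>s. \<gamma> s i ^ l i) has_field_derivative of_nat (l i) * (\<gamma>' i * \<gamma> t i ^ (l i - 1))) (at t)"
        by simp
    qed
    moreover have "c * (\<Sum>i\<in>J. (of_nat (l i) * (\<gamma>' i * \<gamma> t i ^ (l i - 1))) * (\<Prod>j\<in>J - {i}. \<gamma> t j ^ l j)) =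
      (\<Sum>i\<in>J. f' i (\<gamma> t) * \<gamma>' i)"
      unfolding sum_distrib_left
    proof (rule sum.cong[OF refl])
      fix i assume "i \<in> J"
      then show "c * ((of_nat (l i) * (\<gamma>' i * \<gamma> t i ^ (l i - 1))) * (\<Prod>j\<in>J - {i}. \<gamma> t j ^ l j)) = f' i (\<gamma> t) * \<gamma>' i"
        using monomial eval_monomial_lower(1)[OF assms(1), of \<kappa> i "\<gamma> t"] by (simp add: f'_def l_def)
    qed
    moreover have "(\<lambda>s. c * eval_monomial \<kappa> (\<gamma> s)) = (\<lambda>s. c * (\<Prod>i\<in>J. \<gamma> s i ^ l i))"
      using monomial by (simp add: eval_monomial_eq_prod[OF assms(1)] l_def)
    ultimately show "((\<lambda>s. c * eval_monomial \<kappa> (\<gamma> s)) has_field_derivative (\<Sum>i\<in>J. f' i (\<gamma> t) * \<gamma>' i)) (at t)"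
      by (simp only:)
  qed
  ultimately show ?case by blast
next
  case zero
  show ?case by (intro exI[of _ "\<lambda>_ _. 0"]) (auto simp: chain_rule_def polyfuns_0)
next
  case (add f g)
  then obtain f' g' where *: "\<forall>i\<in>J. f' i \<in> polys J (D - 1)" "chain_rule J f f'"
    "\<forall>i\<in>J. g' i \<in> polys J (D - 1)" "chain_rule J g g'" by blast
  have "chain_rule J (\<lambda>v. f v + g v) (\<lambda>i v. f' i v + g' i v)"
    unfolding chain_rule_def distrib_right sum.distrib
    by (intro allI impI DERIV_add chain_ruleD[OF *(2)] chain_ruleD[OF *(4)]) blast+
  with * show ?case by (intro exI[of _ "\<lambda>i v. f' i v + g' i v"]) (auto intro: polyfuns_add)
qed

section \<open>Algebraic dependence and separable relations\<close>

definition alg_dependent ::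
  "('x \<Rightarrow> ('u \<Rightarrow> complex) \<Rightarrow> complex) \<Rightarrow> 'x set \<Rightarrow> bool" where
  "alg_dependent \<psi> X \<longleftrightarrow> (\<exists>D. \<exists>P\<in>polys X D. (\<exists>v. P v \<noteq> 0) \<and> (\<forall>u. P (\<lambda>x. \<psi> x u) = 0))"

text \<open>The monomials in the \<psi>'s with exponents up to \<open>B\<close> number
  \<open>(B + 1) ^ card X\<close>, while they lie in a space whose dimension is of order
  \<open>B ^ card J\<close> only. For large \<open>B\<close> they are linearly dependent.\<close>

lemma alg_dependent_count:
  assumes "finite X" "finite J" "card J < card X" and \<psi>: "\<And>x. x \<in> X \<Longrightarrow> \<psi> x \<in> polyfuns (cube J E)"
  shows "alg_dependent \<psi> X"
proof -
  define M where "M = E * card X + 1"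
  \<comment> \<open>With this choice the space of dimension
    \<open>(E * (card X * B) + 1) ^ card J\<close> is bounded by
    \<open>B * (B + 1) ^ card J\<close>, just below \<open>(B + 1) ^ Suc (card J)\<close>.\<close>
  define B where "B = M ^ card J"
  let ?C = "cube J (E * (card X * B))"
  have "card ?C = (E * (card X * B) + 1) ^ card J" using assms by (simp add: card_cube)
  also have "\<dots> \<le> (M * (B + 1)) ^ card J" by (intro power_mono) (auto simp: M_def algebra_simps)
  also have "\<dots> = B * (B + 1) ^ card J" by (simp only: power_mult_distrib B_def)
  also have "\<dots> < (B + 1) * (B + 1) ^ card J" by simp
  also have "\<dots> = (B + 1) ^ Suc (card J)" by simp
  also have "\<dots> \<le> (B + 1) ^ card X" using assms by (intro power_increasing) auto
  also have "\<dots> = card (cube X B)" using assms by (simp add: card_cube)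
  finally have less: "card ?C < card (cube X B)" .
  have "\<exists>c. \<forall>u. eval_monomial \<kappa> (\<lambda>x. \<psi> x u) = (\<Sum>\<nu>\<in>?C. c \<nu> * eval_monomial \<nu> u)" if "\<kappa> \<in> cube X B" for \<kappa>
  proof -
    have deg: "mdeg \<kappa> \<le> card X * B"
      using that sum_bounded_above[of X "lookup \<kappa>" B] by (simp add: mdeg_eq_sum[OF assms(1)])
    have "(\<lambda>v. 1 * eval_monomial \<kappa> v) \<in> polyfuns {\<kappa>}" by (rule polyfuns_monomial) simp
    then have mono: "eval_monomial \<kappa> \<in> polyfuns {\<kappa>}" by simp
    have "(\<lambda>u. eval_monomial \<kappa> (\<lambda>x. \<psi> x u)) \<in> polyfuns ?C"
    proof (rule polyfuns_compose[OF mono, of "\<lambda>u x. \<psi> x u" "\<lambda>e. cube J (E * e)"])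
      show "(\<lambda>u. \<psi> i u) \<in> polyfuns (cube J (E * 1))" if "\<beta> \<in> {\<kappa>}" "i \<in> keys \<beta>" for \<beta> i
        using that \<open>\<kappa> \<in> cube X B\<close> \<psi>[of i] by auto
      show "cube J (E * mdeg \<beta>) \<subseteq> ?C" if "\<beta> \<in> {\<kappa>}" for \<beta>
      proof -
        have "E * mdeg \<beta> \<le> E * (card X * B)" using that deg by (intro mult_left_mono) auto
        then show ?thesis by (auto intro: order_trans)
      qed
      show "\<alpha> + \<beta> \<in> cube J (E * (a + b))" if "\<alpha> \<in> cube J (E * a)" "\<beta> \<in> cube J (E * b)" for a b \<alpha> \<beta>
        using that by (simp add: keys_add_nat lookup_add distrib_left add_mono)
    qed simp
    moreover have "finite ?C" using assms by (simp add: finite_cube)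
    ultimately obtain c where "\<And>u. eval_monomial \<kappa> (\<lambda>x. \<psi> x u) = (\<Sum>\<nu>\<in>?C. c \<nu> * eval_monomial \<nu> u)"
      by (rule polyfuns_expand) (rule that)
    then show ?thesis by (intro exI[of _ c] allI)
  qed
  then have "\<forall>\<kappa>\<in>cube X B. \<exists>c. \<forall>u. eval_monomial \<kappa> (\<lambda>x. \<psi> x u) = (\<Sum>\<nu>\<in>?C. c \<nu> * eval_monomial \<nu> u)"
    by blast
  from bchoice[OF this] obtain a where a: "\<And>\<kappa> u. \<kappa> \<in> cube X B \<Longrightarrow>
      eval_monomial \<kappa> (\<lambda>x. \<psi> x u) = (\<Sum>\<nu>\<in>?C. a \<kappa> \<nu> * eval_monomial \<nu> u)" by blast
  obtain c where c: "\<exists>\<kappa>\<in>cube X B. c \<kappa> \<noteq> 0" "\<forall>\<nu>\<in>?C. (\<Sum>\<kappa>\<in>cube X B. c \<kappa> * a \<kappa> \<nu>) = 0"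
    using underdetermined_system[OF finite_cube[OF assms(2)] finite_cube[OF assms(1)] less, of "\<lambda>\<nu> \<kappa>. a \<kappa> \<nu>"]
    by blast
  define P where "P v = (\<Sum>\<kappa>\<in>cube X B. c \<kappa> * eval_monomial \<kappa> v)" for v
  have "P \<in> polyfuns (cube X B)" unfolding P_def by (intro polyfuns_sum polyfuns_monomial)
  then have "P \<in> polys X (card X * B)" using cube_subset_polys[OF assms(1)] by blast
  moreover have "\<exists>v. P v \<noteq> 0"
  proof (rule ccontr)
    assume "\<not> ?thesis"
    then have "c \<kappa> = 0" if "\<kappa> \<in> cube X B" for \<kappa>
      using that by (intro eval_monomial_independent[OF assms(1) finite_cube[OF assms(1)], of B c \<kappa>])
        (auto simp: P_def)
    with c(1) show False by blast
  qed
  moreover have "P (\<lambda>x. \<psi> x u) = 0" for u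
  proof -
    have "P (\<lambda>x. \<psi> x u) = (\<Sum>\<kappa>\<in>cube X B. \<Sum>\<nu>\<in>?C. c \<kappa> * a \<kappa> \<nu> * eval_monomial \<nu> u)"
      unfolding P_def by (intro sum.cong refl) (simp add: a sum_distrib_left mult.assoc)
    also have "\<dots> = (\<Sum>\<nu>\<in>?C. (\<Sum>\<kappa>\<in>cube X B. c \<kappa> * a \<kappa> \<nu>) * eval_monomial \<nu> u)"
      by (subst sum.swap) (simp add: sum_distrib_right)
    finally show ?thesis using c(2) by simp
  qed
  ultimately show ?thesis unfolding alg_dependent_def by blast
qed

lemma polys_remove_variable:
  "f \<in> polys X D \<Longrightarrow> (\<lambda>v. f (v(k := 0))) \<in> polys (X - {k}) D"
proof (induction rule: polyfuns_induct)
  case (monomial c \<kappa>)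
  show ?case
  proof (cases "k \<in> keys \<kappa>")
    case True
    then have "(\<lambda>v. c * eval_monomial \<kappa> (v(k := 0))) = (\<lambda>v. 0)"
      by (auto simp: eval_monomial_split[of \<kappa> _ k] in_keys_iff)
    then show ?thesis by (simp only: polyfuns_0)
  next
    case False
    then have "eval_monomial \<kappa> (v(k := 0)) = eval_monomial \<kappa> v" for v
      by (intro eval_monomial_cong) auto
    moreover have "(\<lambda>v. c * eval_monomial \<kappa> v) \<in> polys (X - {k}) D"
      by (rule polyfuns_monomial) (use monomial False in auto)
    ultimately show ?thesis by (simp only:)
  qed
qed (auto simp: polyfuns_0 intro: polyfuns_add)

text \<open>A relation of minimal degree is separable in the new variable, as the characteristic is 0.\<close>

lemma separable_relation:
  assumes "finite X" "k \<notin> X" "\<not> alg_dependent \<psi> X" "alg_dependent \<psi> (insert k X)"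
  obtains P P' D where "chain_rule (insert k X) P P'" "\<And>u. P (\<lambda>x. \<psi> x u) = 0"
    "P' k \<in> polys (insert k X) D" "\<exists>u. P' k (\<lambda>x. \<psi> x u) \<noteq> 0"
proof -
  let ?R = "\<lambda>D P. P \<in> polys (insert k X) D \<and> (\<exists>v. P v \<noteq> 0) \<and> (\<forall>u. P (\<lambda>x. \<psi> x u) = 0)"
  define D where "D = (LEAST D. \<exists>P. ?R D P)"
  have "\<exists>D P. ?R D P" using assms(4) unfolding alg_dependent_def by blast
  then have "\<exists>P. ?R D P" unfolding D_def by (rule LeastI_ex)
  then obtain P v where P: "P \<in> polys (insert k X) D" "P v \<noteq> 0" "\<And>u. P (\<lambda>x. \<psi> x u) = 0" by blast
  have minimal: "\<not> ?R D' Q" if "D' < D" for D' Q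
    using not_less_Least[of D' "\<lambda>D. \<exists>P. ?R D P"] that unfolding D_def by blast
  have "D \<noteq> 0"
  proof
    assume "D = 0"
    then have "{\<kappa>. keys \<kappa> \<subseteq> insert k X \<and> mdeg \<kappa> \<le> D} = {0}"
      using monomials_0[of "insert k X"] by (auto simp: monomials_altdef)
    then have "P v = P (\<lambda>x. \<psi> x undefined)"
      using P(1) by (intro polyfuns_cong[of P "{0}"]) auto
    with P show False by simp
  qed
  obtain P' where P': "\<forall>i\<in>insert k X. P' i \<in> polys (insert k X) (D - 1)" "chain_rule (insert k X) P P'"
    using polys_chain_rule[OF _ P(1)] assms(1) by auto
  have "\<exists>u. P' k (\<lambda>x. \<psi> x u) \<noteq> 0"
  proof (rule ccontr)
    assume "\<not> ?thesis"
    \<comment> \<open>The partial derivative would be a relation of smaller degree, so by minimality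
      it is the zero function.\<close>
    then have zero: "P' k w = 0" for w using minimal[of "D - 1" "P' k"] \<open>D \<noteq> 0\<close> P'(1) by auto
    \<comment> \<open>A polynomial with zero derivative in direction \<open>k\<close> is constant
      along that direction. So \<open>P\<close> would be a relation among the old elements
      \<open>X\<close> alone.\<close>
    have indep: "P w = P (w(k := 0))" for w
    proof -
      define b where "b = (\<lambda>i. if i = k then 1 else 0 :: complex)"
      obtain q where q: "\<And>t. poly q t = P (\<lambda>i. (w(k := 0)) i + t * b i)" using polyfuns_line[OF P(1)] by metis
      have "poly (pderiv q) t = 0" for t
      proof -
        have "((\<lambda>t. P (\<lambda>i. (w(k := 0)) i + t * b i)) has_field_derivative
          (\<Sum>i\<in>insert k X. P' i (\<lambda>i. (w(k := 0)) i + t * b i) * b i)) (at t)"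
          by (rule chain_ruleD[OF P'(2), of "\<lambda>t i. (w(k := 0)) i + t * b i"]) (auto intro!: derivative_eq_intros)
        moreover have "(\<Sum>i\<in>insert k X. P' i (\<lambda>i. (w(k := 0)) i + t * b i) * b i) = 0"
          using zero by (intro sum.neutral) (auto simp: b_def)
        ultimately have "(poly q has_field_derivative 0) (at t)" by (simp add: q[abs_def])
        with poly_DERIV[of q t] show ?thesis using DERIV_unique by blast
      qed
      then have "pderiv q = 0" using poly_all_0_iff_0 by blast
      then obtain a where "q = [:a:]" using pderiv_iszero by blast
      then have "poly q (w k) = poly q 0" by simp
      moreover have "(\<lambda>i. (w(k := 0)) i + w k * b i) = w" "(\<lambda>i. (w(k := 0)) i + 0 * b i) = w(k := 0)"
        by (auto simp: b_def)
      ultimately show ?thesis by (simp only: q)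
    qed
    have "insert k X - {k} = X" using assms(2) by simp
    then have "P \<in> polys X D" using polys_remove_variable[OF P(1), of k] by (simp flip: indep)
    with P assms(3) show False unfolding alg_dependent_def by blast
  qed
  moreover have "P' k \<in> polys (insert k X) (D - 1)" using P'(1) by blast
  ultimately show ?thesis by (intro that[OF P'(2) P(3), of "D - 1"])
qed

lemma alg_dependent_Inl:
  assumes "alg_dependent \<psi> (Inl ` I)"
  shows "alg_dependent (\<lambda>i. \<psi> (Inl i)) I"
proof -
  obtain D P v where P: "P \<in> polys (Inl ` I) D" "P v \<noteq> 0" "\<And>u. P (\<lambda>x. \<psi> x u) = 0"
    using assms unfolding alg_dependent_def by blast
  define Q where "Q w = P (case_sum w (\<lambda>_. 0))" for w
  have cong: "P (case_sum (\<lambda>i. w (Inl i)) (\<lambda>_. 0)) = P w" for w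
    by (rule polyfuns_cong[OF P(1)]) auto
  have "Q \<in> polys I D" unfolding Q_def
  proof (rule polyfuns_compose[OF P(1), of _ "\<lambda>e. {\<kappa>. keys \<kappa> \<subseteq> I \<and> mdeg \<kappa> \<le> e}"])
    fix \<beta> x
    assume "\<beta> \<in> {\<kappa>. keys \<kappa> \<subseteq> Inl ` I \<and> mdeg \<kappa> \<le> D}" "x \<in> keys \<beta>"
    then obtain i where "x = Inl i" "i \<in> I" by auto
    then show "(\<lambda>u. case x of Inl i \<Rightarrow> u i | Inr _ \<Rightarrow> 0) \<in> polys I 1"
      using polyfuns_monomial[of "single i 1" "{\<kappa>. keys \<kappa> \<subseteq> I \<and> mdeg \<kappa> \<le> 1}" 1] by simp
  qed (auto simp: keys_add_nat mdeg_add)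
  moreover have "Q (\<lambda>i. v (Inl i)) \<noteq> 0" using P(2) by (simp add: Q_def cong)
  moreover have "Q (\<lambda>i. \<psi> (Inl i) u) = 0" for u using cong[of "\<lambda>x. \<psi> x u"] P(3) by (simp add: Q_def)
  ultimately show ?thesis unfolding alg_dependent_def by blast
qed

text \<open>Adjoin a maximal set of coordinates that keeps \<open>\<Phi>\<close> algebraically independent. The separable relations
  then show that a tangent vector killed by the differentials of \<open>\<Phi>\<close> and of these coordinates is
  0, whereas a redundant differential leaves fewer equations than unknowns.\<close>

lemma alg_dependent_jacobian:
  fixes \<Phi> :: "'i \<Rightarrow> ('j \<Rightarrow> complex) \<Rightarrow> complex"
  assumes "finite I" "finite J" and \<Phi>: "\<And>i. i \<in> I \<Longrightarrow> \<Phi> i \<in> polyfuns (cube J E)"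
    and degenerate: "\<And>u. \<exists>G. (\<exists>i\<in>I. G i \<noteq> 0) \<and>
      (\<forall>\<xi>. ((\<lambda>t. \<Sum>i\<in>I. G i * \<Phi> i (\<lambda>j. u j + t * \<xi> j)) has_field_derivative 0) (at 0))"
  shows "alg_dependent \<Phi> I"
proof (rule ccontr)
  assume indep: "\<not> alg_dependent \<Phi> I"
  \<comment> \<open>\<open>Inl i\<close> stands for the component \<open>\<Phi> i\<close>,
    \<open>Inr j\<close> for the coordinate \<open>j\<close> itself.\<close>
  define \<psi> where "\<psi> = case_sum \<Phi> (\<lambda>j u. u j)"
  define X where "X S = Inl ` I \<union> Inr ` S" for S :: "'j set"
  define good where "good S \<longleftrightarrow> S \<subseteq> J \<and> \<not> alg_dependent \<psi> (X S)" for S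
  have "good {}" using indep alg_dependent_Inl[of \<psi> I] by (auto simp: good_def X_def \<psi>_def)
  moreover have "\<forall>S. good S \<longrightarrow> card S < card J + 1"
    using assms(2) by (auto simp: good_def less_Suc_eq_le intro: card_mono)
  ultimately obtain S where S: "good S" and max: "\<And>S'. good S' \<Longrightarrow> card S' \<le> card S"
    using ex_has_greatest_nat[of good "{}" card "card J + 1"] by blast
  have SJ: "S \<subseteq> J" "finite S" "\<not> alg_dependent \<psi> (X S)" using S assms(2) finite_subset by (auto simp: good_def)
  have finX: "finite (X S)" using assms SJ by (simp add: X_def)
  have "\<psi> x \<in> polyfuns (cube J (E + 1))" if "x \<in> X S" for x
  proof (cases x)
    case (Inl i)
    then have "\<psi> x \<in> polyfuns (cube J E)" using \<Phi>[of i] that by (auto simp: \<psi>_def X_def)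
    then show ?thesis using polyfuns_mono[of "cube J E" "cube J (E + 1)"] by (auto intro: le_SucI)
  next
    case (Inr j)
    then have "single j 1 \<in> cube J (E + 1)"
      using that SJ by (auto simp: X_def lookup_single when_def)
    from polyfuns_monomial[OF this, of 1] show ?thesis using Inr by (simp add: \<psi>_def)
  qed
  then have "card (X S) \<le> card J"
    using alg_dependent_count[OF finX assms(2)] SJ(3) not_le by blast
  moreover have "card (X S) = card I + card S"
    unfolding X_def using assms SJ by (subst card_Un_disjoint) (auto simp: card_image)
  ultimately have card: "card I + card S \<le> card J" by simp
  define R where "R k P P' \<longleftrightarrow> chain_rule (insert (Inr k) (X S)) P P' \<and> (\<forall>u. P (\<lambda>x. \<psi> x u) = 0) \<and>
      (\<exists>D. P' (Inr k) \<in> polys (insert (Inr k) (X S)) D) \<and> (\<exists>u. P' (Inr k) (\<lambda>x. \<psi> x u) \<noteq> 0)" for k P P'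
  have "\<exists>P P'. R k P P'" if "k \<in> J - S" for k
  proof -
    have kX: "Inr k \<notin> X S" using that by (auto simp: X_def)
    have "\<not> good (insert k S)" using max[of "insert k S"] SJ that by auto
    then have dep: "alg_dependent \<psi> (insert (Inr k) (X S))" using SJ that by (simp add: good_def X_def)
    show ?thesis
    proof (rule separable_relation[OF finX kX SJ(3) dep])
      fix P P' D
      assume "chain_rule (insert (Inr k) (X S)) P P'" "\<And>u. P (\<lambda>x. \<psi> x u) = 0"
        "P' (Inr k) \<in> polys (insert (Inr k) (X S)) D" "\<exists>u. P' (Inr k) (\<lambda>x. \<psi> x u) \<noteq> 0"
      then have "R k P P'" unfolding R_def by blast
      then show ?thesis by blast
    qed
  qed
  then have "\<forall>k\<in>J - S. \<exists>P P'. R k P P'" by blast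
  from bchoice[OF this] obtain P where "\<forall>k\<in>J - S. \<exists>P'. R k (P k) P'" by blast
  from bchoice[OF this] obtain P' where "\<forall>k\<in>J - S. R k (P k) (P' k)" by blast
  then have rel:
    "\<And>k. k \<in> J - S \<Longrightarrow> chain_rule (insert (Inr k) (X S)) (P k) (P' k)"
    "\<And>k u. k \<in> J - S \<Longrightarrow> P k (\<lambda>x. \<psi> x u) = 0"
    "\<And>k. k \<in> J - S \<Longrightarrow> \<exists>D. P' k (Inr k) \<in> polys (insert (Inr k) (X S)) D"
    "\<And>k. k \<in> J - S \<Longrightarrow> \<exists>u. P' k (Inr k) (\<lambda>x. \<psi> x u) \<noteq> 0"
    unfolding R_def by blast+
  have \<psi>poly: "\<psi> x \<in> polyfuns UNIV" if "x \<in> Inl ` I \<union> range Inr" for x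
  proof (cases x)
    case (Inl i)
    then show ?thesis using \<Phi>[of i] that polyfuns_mono[of "cube J E" UNIV] by (auto simp: \<psi>_def)
  next
    case (Inr j)
    then show ?thesis using polyfuns_monomial[of "single j 1" UNIV 1] by (simp add: \<psi>_def)
  qed
  \<comment> \<open>One point has to serve all \<open>k\<close> at once. The degeneracy, assumed at
    every point, is then applied at this \<open>u\<close>.\<close>
  have "\<exists>u. \<forall>k\<in>J - S. P' k (Inr k) (\<lambda>x. \<psi> x u) \<noteq> 0"
  proof (rule polyfuns_prod_nonzero[where A = UNIV])
    fix k assume k: "k \<in> J - S"
    obtain D where D: "P' k (Inr k) \<in> polys (insert (Inr k) (X S)) D" using rel(3)[OF k] by blast
    show "(\<lambda>u. P' k (Inr k) (\<lambda>x. \<psi> x u)) \<in> polyfuns UNIV"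
      by (rule polyfuns_compose[OF D, of "\<lambda>u x. \<psi> x u" "\<lambda>_. UNIV"])
        (auto simp: X_def intro!: \<psi>poly)
  qed (use rel(4) assms(2) in auto)
  then obtain u where u: "\<And>k. k \<in> J - S \<Longrightarrow> P' k (Inr k) (\<lambda>x. \<psi> x u) \<noteq> 0" by blast
  have "\<exists>d. chain_rule J (\<Phi> i) d" if "i \<in> I" for i
    using polys_chain_rule[OF assms(2), of "\<Phi> i" "card J * E"] \<Phi>[OF that] cube_subset_polys[OF assms(2), of E] by blast
  then have "\<forall>i\<in>I. \<exists>d. chain_rule J (\<Phi> i) d" by blast
  from bchoice[OF this] obtain d where d: "\<And>i. i \<in> I \<Longrightarrow> chain_rule J (\<Phi> i) (d i)" by blast
  have line: "((\<lambda>t. u j + t * \<xi> j) has_field_derivative \<xi> j) (at 0)" for j \<xi>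
    by (auto intro!: derivative_eq_intros)
  have deriv: "((\<lambda>t. \<Phi> i (\<lambda>j. u j + t * \<xi> j)) has_field_derivative (\<Sum>j\<in>J. d i j u * \<xi> j)) (at 0)"
    if "i \<in> I" for i \<xi>
    using chain_ruleD[OF d[OF that], of "\<lambda>t j. u j + t * \<xi> j" \<xi> 0] line by simp
  obtain G i0 where G: "i0 \<in> I" "G i0 \<noteq> 0"
    "\<And>\<xi>. ((\<lambda>t. \<Sum>i\<in>I. G i * \<Phi> i (\<lambda>j. u j + t * \<xi> j)) has_field_derivative 0) (at 0)"
    using degenerate[of u] by blast
  have "card I > 0" using assms(1) G(1) by (auto simp: card_gt_0_iff)
  \<comment> \<open>Because of the linear relation \<open>G\<close> between the differentials, the
    equation for \<open>i0\<close> follows from the others and can be left out of the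
    system.\<close>
  then have "card ((I - {i0}) <+> S) < card J"
    using card assms(1) SJ(2) G(1) by (simp add: card_Plus card_Diff_singleton)
  from underdetermined_system[OF _ assms(2) this,
      of "\<lambda>x j. case x of Inl i \<Rightarrow> d i j u | Inr s \<Rightarrow> if j = s then 1 else 0"] assms SJ
  obtain \<xi> where \<xi>: "\<exists>j\<in>J. \<xi> j \<noteq> 0"
    and eqs: "\<forall>x\<in>(I - {i0}) <+> S. (\<Sum>j\<in>J. \<xi> j * (case x of Inl i \<Rightarrow> d i j u | Inr s \<Rightarrow> if j = s then 1 else 0)) = 0"
    by auto
  have eqI: "(\<Sum>j\<in>J. d i j u * \<xi> j) = 0" if "i \<in> I" "i \<noteq> i0" for i
    using eqs[rule_format, of "Inl i"] that by (simp add: InlI mult.commute)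
  have eqS: "\<xi> s = 0" if "s \<in> S" for s
  proof -
    have "(\<Sum>j\<in>J. \<xi> j * (if j = s then 1 else 0)) = 0" using eqs[rule_format, of "Inr s"] that by (simp add: InrI)
    moreover have "s \<in> J" using that SJ by auto
    ultimately show ?thesis using assms(2) by (simp add: if_distrib sum.delta cong: if_cong)
  qed
  have "((\<lambda>t. \<Sum>i\<in>I. G i * \<Phi> i (\<lambda>j. u j + t * \<xi> j)) has_field_derivative
      (\<Sum>i\<in>I. G i * (\<Sum>j\<in>J. d i j u * \<xi> j))) (at 0)"
    by (intro DERIV_sum DERIV_cmult deriv)
  with G(3) have "(\<Sum>i\<in>I. G i * (\<Sum>j\<in>J. d i j u * \<xi> j)) = 0" using DERIV_unique by blast
  moreover have "(\<Sum>i\<in>I. G i * (\<Sum>j\<in>J. d i j u * \<xi> j)) = G i0 * (\<Sum>j\<in>J. d i0 j u * \<xi> j)"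
    using G(1) assms(1) eqI by (subst sum.remove[of I i0]) auto
  ultimately have eqI: "(\<Sum>j\<in>J. d i j u * \<xi> j) = 0" if "i \<in> I" for i
    using eqI[OF that] G(2) by (cases "i = i0") auto
  have "\<xi> k = 0" if k: "k \<in> J" "k \<notin> S" for k
  proof -
    define \<gamma>' where "\<gamma>' = case_sum (\<lambda>i. \<Sum>j\<in>J. d i j u * \<xi> j) \<xi>"
    have kX: "Inr k \<notin> X S" using k by (auto simp: X_def)
    \<comment> \<open>The relation is differentiated along \<xi>. All terms from \<open>X S\<close>
      vanish by the equations, and the factor of the last one is nonzero at \<open>u\<close>, which
      forces \<open>\<xi> k = 0\<close>.\<close>
    have "((\<lambda>t. P k (\<lambda>x. \<psi> x (\<lambda>j. u j + t * \<xi> j))) has_field_derivative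
      (\<Sum>x\<in>insert (Inr k) (X S). P' k x (\<lambda>x. \<psi> x (\<lambda>j. u j + 0 * \<xi> j)) * \<gamma>' x)) (at 0)"
    proof (rule chain_ruleD[OF rel(1), of k "\<lambda>t x. \<psi> x (\<lambda>j. u j + t * \<xi> j)"])
      fix x assume "x \<in> insert (Inr k) (X S)"
      then show "((\<lambda>t. \<psi> x (\<lambda>j. u j + t * \<xi> j)) has_field_derivative \<gamma>' x) (at 0)"
        using deriv[of _ \<xi>] line[of _ \<xi>] by (auto simp: \<psi>_def \<gamma>'_def X_def)
    qed (use k in auto)
    moreover have "(\<lambda>t. P k (\<lambda>x. \<psi> x (\<lambda>j. u j + t * \<xi> j))) = (\<lambda>t. 0)" using rel(2)[of k] k by auto
    ultimately have "((\<lambda>t. 0) has_field_derivative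
      (\<Sum>x\<in>insert (Inr k) (X S). P' k x (\<lambda>x. \<psi> x u) * \<gamma>' x)) (at 0)" by simp
    then have "(\<Sum>x\<in>insert (Inr k) (X S). P' k x (\<lambda>x. \<psi> x u) * \<gamma>' x) = 0"
      using DERIV_unique DERIV_const by blast
    moreover have "\<gamma>' x = 0" if "x \<in> X S" for x using that eqI eqS by (auto simp: X_def \<gamma>'_def)
    ultimately have "P' k (Inr k) (\<lambda>x. \<psi> x u) * \<gamma>' (Inr k) = 0" using finX kX by simp
    then show ?thesis using u[of k] k by (simp add: \<gamma>'_def)
  qed
  with eqS \<xi> show False by blast
qed

section \<open>Osculating spaces of the Veronese surface\<close>

definition line_open :: "nat \<Rightarrow> (nat \<Rightarrow> complex) set \<Rightarrow> bool" where
  "line_open n W \<longleftrightarrow> (\<forall>w\<in>W. \<forall>j<n. \<forall>\<^sub>F t in nhds (w j). w(j := t) \<in> W)"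

lemma line_open_openin:
  assumes "openin (affine_topology n) W"
  shows "line_open n W"
  unfolding line_open_def
proof (intro ballI allI impI)
  fix w j assume w: "w \<in> W" and j: "j < n"
  have ext: "w \<in> extensional {..<n}"
    using w openin_subset[OF assms] by (auto simp: PiE_def)
  have "continuous_map euclidean (affine_topology n) (\<lambda>t. w(j := t))"
    unfolding continuous_map_componentwise
  proof (intro conjI ballI)
    show "(\<lambda>t. w(j := t)) ` topspace euclidean \<subseteq> extensional {..<n}"
      using ext j by (auto simp: extensional_def)
    show "continuous_map euclidean euclidean (\<lambda>t. (w(j := t)) k)" if "k \<in> {..<n}" for k
      by (cases "k = j") auto
  qed
  from openin_continuous_map_preimage[OF this assms] have "open {t. w(j := t) \<in> W}" by simp
  with w show "\<forall>\<^sub>F t in nhds (w j). w(j := t) \<in> W"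
    using eventually_nhds_in_open[of "{t. w(j := t) \<in> W}" "w j"] by simp
qed

definition line_differentiable :: "nat \<Rightarrow> (nat \<Rightarrow> complex) set \<Rightarrow> ((nat \<Rightarrow> complex) \<Rightarrow> complex) \<Rightarrow> bool" where
  "line_differentiable n W f \<longleftrightarrow> (\<forall>w\<in>W. \<forall>j<n. (\<lambda>t. f (w(j := t))) field_differentiable at (w j))"

text \<open>The recursion peels off the derivative taken first, so the sum and product rules apply
  directly; \<open>iter_partial\<close> peels off the one taken last, and
  \<open>iter_partial_snoc\<close> mediates.\<close>

primrec smooth_upto :: "nat \<Rightarrow> (nat \<Rightarrow> complex) set \<Rightarrow> nat \<Rightarrow> ((nat \<Rightarrow> complex) \<Rightarrow> complex) \<Rightarrow> bool" where
  "smooth_upto n W 0 f \<longleftrightarrow> line_differentiable n W f"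
| "smooth_upto n W (Suc k) f \<longleftrightarrow> line_differentiable n W f \<and> (\<forall>j<n. smooth_upto n W k (partial j f))"

primrec order_ge :: "nat \<Rightarrow> (nat \<Rightarrow> complex) \<Rightarrow> nat \<Rightarrow> ((nat \<Rightarrow> complex) \<Rightarrow> complex) \<Rightarrow> bool" where
  "order_ge n w 0 f \<longleftrightarrow> True"
| "order_ge n w (Suc k) f \<longleftrightarrow> f w = 0 \<and> (\<forall>j<n. order_ge n w k (partial j f))"

lemma partial_has_derivative:
  assumes "line_differentiable n W f" "w \<in> W" "j < n"
  shows "((\<lambda>t. f (w(j := t))) has_field_derivative partial j f w) (at (w j))"
  using assms unfolding line_differentiable_def partial_def by (simp add: DERIV_deriv_iff_field_differentiable)

lemma line_differentiable_diff: "smooth_upto n W k f \<Longrightarrow> line_differentiable n W f"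
  by (cases k) auto

lemma smooth_upto_Suc: "smooth_upto n W (Suc k) f \<Longrightarrow> smooth_upto n W k f"
  by (induction k arbitrary: f) (auto simp: line_differentiable_diff)

lemma smooth_upto_subset: "smooth_upto n W k f \<Longrightarrow> V \<subseteq> W \<Longrightarrow> smooth_upto n V k f"
  by (induction k arbitrary: f) (auto simp: line_differentiable_def)

lemma order_ge_Suc: "order_ge n w (Suc k) f \<Longrightarrow> order_ge n w k f"
  by (induction k arbitrary: f) auto

lemma iter_partial_snoc: "iter_partial (js @ [j]) f = iter_partial js (partial j f)"
  by (induction js) auto

lemma iter_partial_order_ge:
  assumes "order_ge n w k f" "js \<in> lists {..<n}" "length js < k"
  shows "iter_partial js f w = 0"
  using assms
proof (induction js arbitrary: f k rule: rev_induct)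
  case Nil
  then show ?case by (cases k) auto
next
  case (snoc j js)
  then obtain k' where "k = Suc k'" by (cases k) auto
  with snoc.IH[of k' "partial j f"] snoc.prems show ?case by (simp add: iter_partial_snoc)
qed

lemma smooth_upto_iter_partial:
  assumes "\<And>k. smooth_upto n W k f" "js \<in> lists {..<n}"
  shows "smooth_upto n W k (iter_partial js f)"
  using assms(2)
proof (induction js arbitrary: k)
  case Nil
  then show ?case using assms by simp
next
  case (Cons j js)
  then show ?case using Cons.IH[of "Suc k"] by simp
qed

lemma smooth_upto_holomorphic:
  assumes "\<And>js. js \<in> lists {..<n} \<Longrightarrow> line_differentiable n W (iter_partial js f)"
  shows "smooth_upto n W k f"
  using assms
proof (induction k arbitrary: f)
  case 0
  then show ?case using 0[of "[]"] by simp
next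
  case (Suc k)
  have "smooth_upto n W k (partial j f)" if "j < n" for j
    by (rule Suc.IH) (use Suc.prems[of "_ @ [j]"] that in \<open>simp add: iter_partial_snoc\<close>)
  then show ?case using Suc.prems[of "[]"] by simp
qed

context
  fixes n :: nat and W :: "(nat \<Rightarrow> complex) set"
  assumes W: "line_open n W"
begin

lemma ev_eq:
  assumes "\<And>w. w \<in> W \<Longrightarrow> f w = g w" "w \<in> W" "j < n"
  shows "\<forall>\<^sub>F t in nhds (w j). f (w(j := t)) = g (w(j := t))"
proof -
  have "\<forall>\<^sub>F t in nhds (w j). w(j := t) \<in> W" using W assms unfolding line_open_def by blast
  then show ?thesis by eventually_elim (use assms in auto)
qed

lemma partial_cong:
  assumes "\<And>w. w \<in> W \<Longrightarrow> f w = g w" "w \<in> W" "j < n"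
  shows "partial j f w = partial j g w"
  unfolding partial_def by (rule deriv_cong_ev[OF ev_eq[OF assms] refl])

lemma partial_eqI:
  assumes "((\<lambda>t. f (w(j := t))) has_field_derivative D) (at (w j))"
  shows "partial j f w = D"
  unfolding partial_def using assms by (rule DERIV_imp_deriv)

lemma line_differentiable_cong:
  assumes "\<And>w. w \<in> W \<Longrightarrow> f w = g w" "line_differentiable n W f"
  shows "line_differentiable n W g"
  unfolding line_differentiable_def
proof (intro ballI allI impI)
  fix w j assume w: "w \<in> W" "j < n"
  from ev_eq[of f g, OF assms(1) w] partial_has_derivative[OF assms(2) w]
  have "((\<lambda>t. g (w(j := t))) has_field_derivative partial j f w) (at (w j))"
    by (subst DERIV_cong_ev[OF refl _ refl, symmetric])
  then show "(\<lambda>t. g (w(j := t))) field_differentiable at (w j)"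
    by (auto simp: field_differentiable_def)
qed

lemma smooth_upto_cong:
  "(\<And>w. w \<in> W \<Longrightarrow> f w = g w) \<Longrightarrow> smooth_upto n W k f \<Longrightarrow> smooth_upto n W k g"
proof (induction k arbitrary: f g)
  case 0
  then show ?case using line_differentiable_cong[of f g] by simp
next
  case (Suc k)
  have "smooth_upto n W k (partial j g)" if "j < n" for j
    by (rule Suc.IH[of "partial j f"]) (use Suc.prems that partial_cong[of f g] in auto)
  then show ?case using Suc.prems line_differentiable_cong[of f g] by simp
qed

lemma order_ge_cong:
  "(\<And>w. w \<in> W \<Longrightarrow> f w = g w) \<Longrightarrow> w \<in> W \<Longrightarrow> order_ge n w k f \<Longrightarrow> order_ge n w k g"
proof (induction k arbitrary: f g)
  case (Suc k)
  have "order_ge n w k (partial j g)" if "j < n" for j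
    by (rule Suc.IH[of "partial j f"]) (use Suc.prems that partial_cong[of f g] in auto)
  then show ?case using Suc.prems by simp
qed simp

lemma iter_partial_cong:
  assumes "\<And>w. w \<in> W \<Longrightarrow> f w = g w" "js \<in> lists {..<n}" "w \<in> W"
  shows "iter_partial js f w = iter_partial js g w"
  using assms(2,3)
proof (induction js arbitrary: w)
  case (Cons j js)
  then have "partial j (iter_partial js f) w = partial j (iter_partial js g) w"
    by (intro partial_cong) auto
  then show ?case by simp
qed (simp add: assms(1))

lemma partial_sum:
  assumes "\<And>x. x \<in> X \<Longrightarrow> line_differentiable n W (f x)" "w \<in> W" "j < n"
  shows "((\<lambda>t. \<Sum>x\<in>X. c x * f x (w(j := t))) has_field_derivative (\<Sum>x\<in>X. c x * partial j (f x) w)) (at (w j))"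
  by (intro DERIV_sum DERIV_cmult partial_has_derivative[OF assms(1) assms(2,3)])

lemma iter_partial_sum:
  assumes "\<And>x k. x \<in> X \<Longrightarrow> smooth_upto n W k (f x)" "js \<in> lists {..<n}" "w \<in> W"
  shows "iter_partial js (\<lambda>u. \<Sum>x\<in>X. c x * f x u) w = (\<Sum>x\<in>X. c x * iter_partial js (f x) w)"
  using assms(2,3)
proof (induction js arbitrary: w)
  case (Cons j js)
  then have js: "js \<in> lists {..<n}" "j < n" by auto
  have "iter_partial (j # js) (\<lambda>u. \<Sum>x\<in>X. c x * f x u) w =
    partial j (\<lambda>u. \<Sum>x\<in>X. c x * iter_partial js (f x) u) w"
    unfolding iter_partial.simps by (rule partial_cong) (use Cons js in auto)
  also have "\<dots> = (\<Sum>x\<in>X. c x * partial j (iter_partial js (f x)) w)"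
  proof (rule partial_eqI, rule partial_sum)
    show "line_differentiable n W (iter_partial js (f x))" if "x \<in> X" for x
      using smooth_upto_iter_partial[OF assms(1)[OF that] js(1), of 0] by simp
  qed (use Cons.prems js in auto)
  finally show ?case by simp
qed simp

lemma partial_add:
  assumes "line_differentiable n W f" "line_differentiable n W g" "w \<in> W" "j < n"
  shows "((\<lambda>t. f (w(j := t)) + g (w(j := t))) has_field_derivative partial j f w + partial j g w) (at (w j))"
  by (intro DERIV_add partial_has_derivative[OF assms(1,3,4)] partial_has_derivative[OF assms(2,3,4)])

lemma partial_mult:
  assumes "line_differentiable n W f" "line_differentiable n W g" "w \<in> W" "j < n"
  shows "((\<lambda>t. f (w(j := t)) * g (w(j := t))) has_field_derivative
    partial j f w * g w + partial j g w * f w) (at (w j))"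
  using DERIV_mult[OF partial_has_derivative[OF assms(1,3,4)] partial_has_derivative[OF assms(2,3,4)]] by simp

lemma partial_inverse:
  assumes "line_differentiable n W f" "w \<in> W" "j < n" "f w \<noteq> 0"
  shows "((\<lambda>t. inverse (f (w(j := t)))) has_field_derivative
    - 1 * (partial j f w * (inverse (f w) * inverse (f w)))) (at (w j))"
  using DERIV_inverse_fun[OF partial_has_derivative[OF assms(1-3)]] assms(4) by (simp add: mult_ac power2_eq_square)

lemma line_differentiableI:
  assumes "\<And>w j. w \<in> W \<Longrightarrow> j < n \<Longrightarrow> ((\<lambda>t. f (w(j := t))) has_field_derivative D w j) (at (w j))"
  shows "line_differentiable n W f"
  unfolding line_differentiable_def using assms by (auto simp: field_differentiable_def)

lemma smooth_upto_add:
  "smooth_upto n W k f \<Longrightarrow> smooth_upto n W k g \<Longrightarrow> smooth_upto n W k (\<lambda>w. f w + g w)"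
proof (induction k arbitrary: f g)
  case 0
  then show ?case using line_differentiableI[OF partial_add[of f g]] by simp
next
  case (Suc k)
  then have d: "line_differentiable n W f" "line_differentiable n W g" by auto
  have "smooth_upto n W k (partial j (\<lambda>w. f w + g w))" if "j < n" for j
  proof (rule smooth_upto_cong)
    show "smooth_upto n W k (\<lambda>w. partial j f w + partial j g w)" using Suc that by auto
    show "partial j f w + partial j g w = partial j (\<lambda>w. f w + g w) w" if "w \<in> W" for w
      by (rule partial_eqI[symmetric]) (rule partial_add[OF d that \<open>j < n\<close>])
  qed
  then show ?case using line_differentiableI[OF partial_add[OF d]] by simp
qed

lemma smooth_upto_mult:
  "smooth_upto n W k f \<Longrightarrow> smooth_upto n W k g \<Longrightarrow> smooth_upto n W k (\<lambda>w. f w * g w)"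
proof (induction k arbitrary: f g)
  case 0
  then show ?case using line_differentiableI[OF partial_mult[of f g]] by simp
next
  case (Suc k)
  then have d: "line_differentiable n W f" "line_differentiable n W g" by auto
  have "smooth_upto n W k (partial j (\<lambda>w. f w * g w))" if "j < n" for j
  proof (rule smooth_upto_cong)
    show "smooth_upto n W k (\<lambda>w. partial j f w * g w + partial j g w * f w)"
      using Suc that smooth_upto_Suc by (intro smooth_upto_add Suc.IH) auto
    show "partial j f w * g w + partial j g w * f w = partial j (\<lambda>w. f w * g w) w" if "w \<in> W" for w
      by (rule partial_eqI[symmetric]) (rule partial_mult[OF d that \<open>j < n\<close>])
  qed
  then show ?case using line_differentiableI[OF partial_mult[OF d]] by simp
qed

lemma smooth_upto_const: "smooth_upto n W k (\<lambda>_. c)"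
proof (induction k arbitrary: c)
  case 0
  show ?case by (simp add: line_differentiable_def)
next
  case (Suc k)
  have "partial j (\<lambda>_. c) = (\<lambda>_. 0)" for j by (simp add: partial_def fun_eq_iff)
  with Suc show ?case by (simp add: line_differentiable_def)
qed

lemma smooth_upto_power: "smooth_upto n W k f \<Longrightarrow> smooth_upto n W k (\<lambda>w. f w ^ i)"
  by (induction i) (auto intro: smooth_upto_const smooth_upto_mult)

lemma smooth_upto_inverse:
  assumes "\<And>w. w \<in> W \<Longrightarrow> f w \<noteq> 0"
  shows "smooth_upto n W k f \<Longrightarrow> smooth_upto n W k (\<lambda>w. inverse (f w))"
proof (induction k)
  case 0
  then show ?case using line_differentiableI[OF partial_inverse[of f]] assms by simp
next
  case (Suc k)
  then have d: "line_differentiable n W f" by auto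
  have "smooth_upto n W k (partial j (\<lambda>w. inverse (f w)))" if "j < n" for j
  proof (rule smooth_upto_cong)
    show "smooth_upto n W k (\<lambda>w. - 1 * (partial j f w * (inverse (f w) * inverse (f w))))"
      using Suc that smooth_upto_Suc by (intro smooth_upto_mult smooth_upto_const) auto
    show "- 1 * (partial j f w * (inverse (f w) * inverse (f w))) = partial j (\<lambda>w. inverse (f w)) w"
      if "w \<in> W" for w
      by (rule partial_eqI[symmetric]) (rule partial_inverse[OF d that \<open>j < n\<close> assms[OF that]])
  qed
  then show ?case using line_differentiableI[OF partial_inverse[OF d]] assms by simp
qed

lemma order_ge_add:
  assumes "w \<in> W"
  shows "smooth_upto n W k f \<Longrightarrow> smooth_upto n W k g \<Longrightarrow> order_ge n w k f \<Longrightarrow> order_ge n w k g \<Longrightarrow>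
    order_ge n w k (\<lambda>w. f w + g w)"
proof (induction k arbitrary: f g)
  case (Suc k)
  then have d: "line_differentiable n W f" "line_differentiable n W g" by auto
  have "order_ge n w k (partial j (\<lambda>w. f w + g w))" if "j < n" for j
  proof (rule order_ge_cong[OF _ assms])
    show "order_ge n w k (\<lambda>w. partial j f w + partial j g w)" using Suc that by auto
    show "partial j f w + partial j g w = partial j (\<lambda>w. f w + g w) w" if "w \<in> W" for w
      by (rule partial_eqI[symmetric]) (rule partial_add[OF d that \<open>j < n\<close>])
  qed
  with Suc show ?case by simp
qed simp

text \<open>By the Leibniz rule a derivative of the product is a sum of two products, in each of
  which only one order drops by 1.\<close>

lemma order_ge_mult:
  assumes "w \<in> W"
  shows "smooth_upto n W (a + b) f \<Longrightarrow> smooth_upto n W (a + b) g \<Longrightarrow> order_ge n w a f \<Longrightarrow> order_ge n w b g \<Longrightarrow>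
    order_ge n w (a + b) (\<lambda>w. f w * g w)"
proof (induction "a + b" arbitrary: a b f g)
  case (Suc k)
  then have s: "smooth_upto n W (Suc k) f" "smooth_upto n W (Suc k) g"
    and d: "line_differentiable n W f" "line_differentiable n W g" by (auto simp flip: Suc.hyps(2))
  have half: "order_ge n w k (\<lambda>w. partial j f w * g w)"
    if "j < n" "a + b = Suc k" "smooth_upto n W (Suc k) f" "smooth_upto n W (Suc k) g"
      "order_ge n w a f" "order_ge n w b g" for j a b f g
  proof (cases a)
    case 0
    \<comment> \<open>No order of \<open>f\<close> can be lost here; the order of \<open>g\<close>
      alone exceeds what is asked for.\<close>
    then have b: "b = Suc k" using that by simp
    show ?thesis
      using Suc.hyps(1)[of 0 k "partial j f" g] that order_ge_Suc[of n w k g] smooth_upto_Suc[of n W k g]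
      by (simp add: b)
  next
    case (Suc a')
    then show ?thesis
      using Suc.hyps(1)[of a' b "partial j f" g] that smooth_upto_Suc[of n W k g] by simp
  qed
  have "order_ge n w k (partial j (\<lambda>w. f w * g w))" if "j < n" for j
  proof (rule order_ge_cong[OF _ assms])
    show "order_ge n w k (\<lambda>w. partial j f w * g w + partial j g w * f w)"
    proof (rule order_ge_add[OF assms])
      show "order_ge n w k (\<lambda>w. partial j f w * g w)"
        using half[of j a b f g] Suc s that by simp
      show "order_ge n w k (\<lambda>w. partial j g w * f w)"
        using half[of j b a g f] Suc s that by (simp add: add.commute)
    qed (use s that smooth_upto_Suc in \<open>auto intro!: smooth_upto_mult\<close>)
    show "partial j f w * g w + partial j g w * f w = partial j (\<lambda>w. f w * g w) w" if "w \<in> W" for w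
      by (rule partial_eqI[symmetric]) (rule partial_mult[OF d that \<open>j < n\<close>])
  qed
  moreover have "f w * g w = 0" using Suc by (cases a; cases b) auto
  ultimately show ?case by (simp flip: Suc.hyps(2))
qed simp

lemma order_ge_power:
  assumes "w \<in> W" "\<And>k. smooth_upto n W k f" "f w = 0"
  shows "order_ge n w i (\<lambda>w. f w ^ i)"
proof (induction i)
  case (Suc i)
  have "order_ge n w (1 + i) (\<lambda>w. f w * f w ^ i)"
    by (intro order_ge_mult assms smooth_upto_power) (use assms Suc in auto)
  then show ?case by simp
qed simp

end

text \<open>Continuity in each variable separately is enough, which is why openness is recorded only
  along coordinate lines.\<close>

lemma line_open_nonzero:
  assumes "line_open n W" "line_differentiable n W A"
  shows "line_open n {w \<in> W. A w \<noteq> 0}"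
  unfolding line_open_def
proof (intro ballI allI impI)
  fix w j assume w: "w \<in> {w \<in> W. A w \<noteq> 0}" and j: "j < n"
  have "isCont (\<lambda>t. A (w(j := t))) (w j)"
    using w j assms(2) DERIV_isCont partial_has_derivative by blast
  then have "((\<lambda>t. A (w(j := t))) \<longlongrightarrow> A w) (nhds (w j))"
    using tendsto_at_iff_tendsto_nhds[of "\<lambda>t. A (w(j := t))" "w j"] by (simp add: isCont_def)
  then have "\<forall>\<^sub>F t in nhds (w j). A (w(j := t)) \<noteq> 0"
    using w by (intro tendsto_imp_eventually_ne) auto
  moreover have "\<forall>\<^sub>F t in nhds (w j). w(j := t) \<in> W"
    using assms(1) w j by (auto simp: line_open_def)
  ultimately show "\<forall>\<^sub>F t in nhds (w j). w(j := t) \<in> {w \<in> W. A w \<noteq> 0}"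
    by eventually_elim auto
qed

section \<open>The Veronese surface in the chart \<open>x 0 \<noteq> 0\<close>\<close>

definition dehomogenize :: "(nat \<Rightarrow>\<^sub>0 nat) \<Rightarrow> bool \<Rightarrow>\<^sub>0 nat" where
  "dehomogenize \<alpha> = bipow (lookup \<alpha> 1) (lookup \<alpha> 2)"

text \<open>The divided partial derivative of order \<open>\<beta>\<close> of the Veronese map at the point with affine
  coordinates \<open>p\<close>.\<close>

definition osculating_vector ::
  "nat \<Rightarrow> (bool \<Rightarrow>\<^sub>0 nat) \<Rightarrow> (bool \<Rightarrow> complex) \<Rightarrow> (nat \<Rightarrow>\<^sub>0 nat) \<Rightarrow> complex" where
  "osculating_vector d \<beta> p = (\<lambda>\<alpha>. if \<alpha> \<in> veronese_index 2 d then taylor_coeff \<beta> (dehomogenize \<alpha>) p else 0)"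

lemma atMost_2: "{..2::nat} = {0, 1, 2}"
  by auto

lemma mdeg_3: "keys \<alpha> \<subseteq> {..2} \<Longrightarrow>
    mdeg \<alpha> = lookup \<alpha> 0 + lookup \<alpha> 1 + lookup \<alpha> (2::nat)"
  by (subst mdeg_eq_sum[of "{..2}"]) (auto simp: atMost_2)

lemma eval_monomial_3: "keys \<alpha> \<subseteq> {..2} \<Longrightarrow>
    eval_monomial \<alpha> x = x 0 ^ lookup \<alpha> 0 * x 1 ^ lookup \<alpha> 1 *
      x (2::nat) ^ lookup \<alpha> 2"
  by (subst eval_monomial_eq_prod[of "{..2}"]) (auto simp: atMost_2)

lemma dehomogenize_mem: "\<alpha> \<in> veronese_index 2 d \<Longrightarrow> dehomogenize \<alpha> \<in> exponents_below (d + 1)"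
  by (simp add: exponents_below_def mdeg_bool dehomogenize_def monomials_altdef) (auto simp: mdeg_3)

abbreviation affine_point :: "(nat \<Rightarrow> complex) \<Rightarrow> bool \<Rightarrow> complex" where
  "affine_point x \<equiv> (\<lambda>b. (if b then x 2 else x 1) / x 0)"

lemma veronese_map_affine:
  assumes "\<alpha> \<in> veronese_index 2 d" "x 0 \<noteq> 0"
  shows "veronese_map 2 d x \<alpha> = x 0 ^ d * eval_monomial (dehomogenize \<alpha>) (affine_point x)"
proof -
  have k: "keys \<alpha> \<subseteq> {..2}" "mdeg \<alpha> = d" using assms(1) by (auto simp: monomials_altdef)
  have "x 0 ^ d = x 0 ^ lookup \<alpha> 0 * x 0 ^ lookup \<alpha> 1 * x 0 ^ lookup \<alpha> 2"
    using k mdeg_3[OF k(1)] by (simp flip: power_add)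
  then show ?thesis
    using assms by (simp add: veronese_map_def eval_monomial_3[OF k(1)] eval_monomial_bool dehomogenize_def
        power_divide)
qed

text \<open>An arbitrary parametrization is not compared with the standard one. Instead \<phi> is
  written as \<open>A\<close> times the Veronese map at its affine coordinates \<open>q\<close>, and
  this is Taylor expanded at \<open>p\<close>. The factor \<open>\<psi> \<beta>\<close> of the
  osculating vector of order \<beta> vanishes to order \<open>mdeg \<beta>\<close> at
  \<open>w0\<close>, so derivatives of order at most \<open>m\<close> see only the vectors of order
  at most \<open>m\<close>.\<close>

lemma iter_partial_osculating:
  assumes "d \<ge> 1"
    and param: "local_parametrization (veronese_index 2 d) (veronese_variety 2 d) n W \<phi>"
    and w0: "w0 \<in> W" "cfun.span {\<phi> w0} = cfun.span {veronese_map 2 d x}" "x 0 \<noteq> 0"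
    and js: "js \<in> lists {..<n}" "length js \<le> m"
  shows "\<exists>b. \<forall>\<alpha>. iter_partial js (\<lambda>u. \<phi> u \<alpha>) w0 =
    (\<Sum>\<beta>\<in>exponents_below (m + 1). b \<beta> * osculating_vector d \<beta> (affine_point x) \<alpha>)"
proof -
  \<comment> \<open>The coordinates \<open>x 0 ^ d\<close> and \<open>x 0 ^ (d - 1) * x i\<close>;
    their ratios recover the affine coordinates of a point of the chart.\<close>
  define \<alpha>0 where "\<alpha>0 = single (0::nat) d"
  define \<alpha>b where "\<alpha>b b = single (0::nat) (d - 1) + single (if b then 2 else 1) 1" for b
  have \<alpha>0: "\<alpha>0 \<in> veronese_index 2 d" "dehomogenize \<alpha>0 = 0"
    by (auto simp: \<alpha>0_def monomials_altdef dehomogenize_def lookup_single bipow_def)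
  have \<alpha>b: "\<alpha>b b \<in> veronese_index 2 d" "dehomogenize (\<alpha>b b) = single b 1" for b
    using assms(1) by (cases b; auto simp: \<alpha>b_def monomials_altdef dehomogenize_def lookup_single lookup_add
        bipow_def mdeg_add keys_add_nat when_def)+
  define A where "A w = \<phi> w \<alpha>0" for w
  define W' where "W' = {w \<in> W. A w \<noteq> 0}"
  define q where "q w b = \<phi> w (\<alpha>b b) * inverse (A w)" for w b
  define p where "p = affine_point x"
  have line: "line_open n W" using param line_open_openin by (auto simp: local_parametrization_def)
  have smooth: "smooth_upto n W k (\<lambda>w. \<phi> w \<alpha>)" for k \<alpha>
    by (rule smooth_upto_holomorphic)
      (use param in \<open>auto simp: local_parametrization_def holomorphic_several_def line_differentiable_def\<close>)
  have coords: "\<phi> w \<alpha> = A w * eval_monomial (dehomogenize \<alpha>) (affine_point y)"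
    if "\<phi> w = (\<lambda>\<alpha>. c * veronese_map 2 d y \<alpha>)" "y 0 \<noteq> 0" "\<alpha> \<in> veronese_index 2 d" for w c y \<alpha>
    using that \<alpha>0 by (simp add: A_def veronese_map_affine)
  have q_eq: "A w \<noteq> 0 \<Longrightarrow> q w = affine_point y"
    if "\<phi> w = (\<lambda>\<alpha>. c * veronese_map 2 d y \<alpha>)" "y 0 \<noteq> 0" for w c y
    using coords[OF that \<alpha>b(1)] \<alpha>b(2) by (auto simp: q_def fun_eq_iff)
  have param_eq: "\<phi> w \<alpha> = A w * eval_monomial (dehomogenize \<alpha>) (q w)"
    if w: "w \<in> W'" and \<alpha>: "\<alpha> \<in> veronese_index 2 d" for w \<alpha>
  proof -
    have "cfun.span {\<phi> w} \<in> veronese_variety 2 d"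
      using param w by (auto simp: local_parametrization_def W'_def)
    then obtain y where "cfun.span {\<phi> w} = cfun.span {veronese_map 2 d y}" by (auto simp: veronese_variety_def)
    then have "\<phi> w \<in> cfun.span {veronese_map 2 d y}" using cfun.span_base[of "\<phi> w" "{\<phi> w}"] by simp
    then obtain c where c: "\<phi> w = (\<lambda>\<alpha>. c * veronese_map 2 d y \<alpha>)" by (auto simp: line_altdef)
    have "A w \<noteq> 0" using w by (simp add: W'_def)
    moreover have "A w = c * y 0 ^ d"
      using \<alpha>0(1) by (simp add: A_def c veronese_map_def \<alpha>0_def)
    ultimately have "y 0 \<noteq> 0" using assms(1) by auto
    with coords[OF c this \<alpha>] q_eq[OF c this] \<open>A w \<noteq> 0\<close> show ?thesis by simp
  qed
  have w0': "w0 \<in> W'" "q w0 = p"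
  proof -
    have "\<phi> w0 \<in> cfun.span {veronese_map 2 d x}" using w0(2) cfun.span_base[of "\<phi> w0" "{\<phi> w0}"] by simp
    then obtain c where c: "\<phi> w0 = (\<lambda>\<alpha>. c * veronese_map 2 d x \<alpha>)" by (auto simp: line_altdef)
    have "\<phi> w0 \<noteq> 0" using param w0 by (auto simp: local_parametrization_def)
    then have "c \<noteq> 0" using c by (auto simp: fun_eq_iff)
    moreover have "A w0 = c * x 0 ^ d"
      using \<alpha>0(1) by (simp add: A_def c veronese_map_def \<alpha>0_def)
    ultimately have "A w0 \<noteq> 0" using w0(3) by simp
    with q_eq[OF c w0(3)] w0(1) show "w0 \<in> W'" "q w0 = p" by (auto simp: W'_def p_def)
  qed
  have line': "line_open n W'"
    unfolding W'_def by (rule line_open_nonzero[OF line]) (use smooth[of 0 \<alpha>0] in \<open>simp add: A_def[abs_def]\<close>)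
  have smooth': "smooth_upto n W' k (\<lambda>w. \<phi> w \<alpha>)" for k \<alpha>
    by (rule smooth_upto_subset[OF smooth]) (auto simp: W'_def)
  have smA: "smooth_upto n W' k A" for k unfolding A_def[abs_def] by (rule smooth')
  have smq: "smooth_upto n W' k (\<lambda>w. q w b + - p b)" for k b
    unfolding q_def
    by (intro smooth_upto_add[OF line'] smooth_upto_mult[OF line'] smooth_upto_inverse[OF line'] smooth' smA
        smooth_upto_const[OF line']) (simp add: W'_def)
  define pw where "pw \<beta> b w = (q w b + - p b) ^ lookup \<beta> b" for \<beta> b w
  have smpw: "smooth_upto n W' k (pw \<beta> b)" for k \<beta> b
    unfolding pw_def[abs_def] by (rule smooth_upto_power[OF line' smq])
  have ordpw: "order_ge n w0 (lookup \<beta> b) (pw \<beta> b)" for \<beta> b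
    unfolding pw_def[abs_def] by (rule order_ge_power[OF line' w0'(1) smq]) (simp add: w0')
  define \<psi> where "\<psi> \<beta> w = A w * (pw \<beta> False w * pw \<beta> True w)" for \<beta> w
  have smpp: "smooth_upto n W' k (\<lambda>w. pw \<beta> False w * pw \<beta> True w)" for k \<beta>
    by (intro smooth_upto_mult[OF line'] smpw)
  have sm\<psi>: "smooth_upto n W' k (\<psi> \<beta>)" for k \<beta>
    unfolding \<psi>_def[abs_def] by (intro smooth_upto_mult[OF line'] smA smpp)
  have "order_ge n w0 (mdeg \<beta>) (\<lambda>w. pw \<beta> False w * pw \<beta> True w)" for \<beta>
    unfolding mdeg_bool by (intro order_ge_mult[OF line' w0'(1)] smpw ordpw)
  then have ord\<psi>: "order_ge n w0 (mdeg \<beta>) (\<psi> \<beta>)" for \<beta>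
    using order_ge_mult[OF line' w0'(1), of 0 "mdeg \<beta>" A] smA smpp unfolding \<psi>_def[abs_def] by simp
  have expand: "\<phi> w \<alpha> = (\<Sum>\<beta>\<in>exponents_below (d + 1). osculating_vector d \<beta> p \<alpha> * \<psi> \<beta> w)"
    if w: "w \<in> W'" for w \<alpha>
  proof (cases "\<alpha> \<in> veronese_index 2 d")
    case True
    have "eval_monomial (dehomogenize \<alpha>) (q w) =
      eval_monomial (dehomogenize \<alpha>) (\<lambda>b. p b + (q w b + - p b))" by simp
    also have "\<dots> = (\<Sum>\<beta>\<in>exponents_below (d + 1). taylor_coeff \<beta> (dehomogenize \<alpha>) p *
      eval_monomial \<beta> (\<lambda>b. q w b + - p b))"
      by (rule eval_monomial_taylor[OF dehomogenize_mem[OF True]])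
    finally show ?thesis
      unfolding param_eq[OF w True]
      using True by (simp add: osculating_vector_def sum_distrib_left \<psi>_def pw_def eval_monomial_bool mult_ac)
  next
    case False
    moreover have "\<phi> w \<in> coord_space (veronese_index 2 d)"
      using param w by (auto simp: local_parametrization_def W'_def)
    ultimately show ?thesis by (simp add: coord_space_def osculating_vector_def)
  qed
  \<comment> \<open>If \<open>m > d\<close>, the sum up to order \<open>m\<close> has more terms
    than the Taylor expansion; the extra coefficients are set to 0.\<close>
  define b where "b \<beta> = (if \<beta> \<in> exponents_below (d + 1) then iter_partial js (\<psi> \<beta>) w0 else 0)" for \<beta>
  have "iter_partial js (\<lambda>u. \<phi> u \<alpha>) w0 =
    (\<Sum>\<beta>\<in>exponents_below (m + 1). b \<beta> * osculating_vector d \<beta> p \<alpha>)" for \<alpha>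
  proof -
    have "iter_partial js (\<lambda>u. \<phi> u \<alpha>) w0 =
      iter_partial js (\<lambda>w. \<Sum>\<beta>\<in>exponents_below (d + 1). osculating_vector d \<beta> p \<alpha> * \<psi> \<beta> w) w0"
      by (rule iter_partial_cong[OF line' expand js(1) w0'(1)])
    also have "\<dots> = (\<Sum>\<beta>\<in>exponents_below (d + 1). osculating_vector d \<beta> p \<alpha> * iter_partial js (\<psi> \<beta>) w0)"
      by (rule iter_partial_sum[OF line' sm\<psi> js(1) w0'(1)])
    also have "\<dots> = (\<Sum>\<beta>\<in>exponents_below (d + 1) \<union> exponents_below (m + 1). b \<beta> * osculating_vector d \<beta> p \<alpha>)"
      by (intro sum.mono_neutral_cong_left) (auto simp: b_def mult.commute)
    also have "\<dots> = (\<Sum>\<beta>\<in>exponents_below (m + 1). b \<beta> * osculating_vector d \<beta> p \<alpha>)"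
    proof (intro sum.mono_neutral_right ballI)
      fix \<beta> assume "\<beta> \<in> (exponents_below (d + 1) \<union> exponents_below (m + 1)) - exponents_below (m + 1)"
      then have "length js < mdeg \<beta>" using js(2) by (auto simp: exponents_below_def)
      from iter_partial_order_ge[OF ord\<psi> js(1) this] show "b \<beta> * osculating_vector d \<beta> p \<alpha> = 0"
        by (simp add: b_def)
    qed auto
    finally show ?thesis .
  qed
  then show ?thesis unfolding p_def by blast
qed

lemma bij_betw_dehomogenize:
  "bij_betw dehomogenize (veronese_index 2 d) (exponents_below (d + 1))"
proof (rule bij_betw_byWitness[where f' = "\<lambda>\<kappa>. single 0 (d - mdeg \<kappa>) +
    (single 1 (lookup \<kappa> False) + single 2 (lookup \<kappa> True))"])
  show "\<forall>\<alpha>\<in>veronese_index 2 d. single 0 (d - mdeg (dehomogenize \<alpha>)) +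
    (single 1 (lookup (dehomogenize \<alpha>) False) +
     single 2 (lookup (dehomogenize \<alpha>) True)) = \<alpha>"
  proof
    fix \<alpha> assume "\<alpha> \<in> veronese_index 2 d"
    then have k: "keys \<alpha> \<subseteq> {..2}" "mdeg \<alpha> = d" by (auto simp: monomials_altdef)
    then have "lookup \<alpha> i = 0" if "i > 2" for i using that by (auto simp: in_keys_iff)
    moreover have "d - mdeg (dehomogenize \<alpha>) = lookup \<alpha> 0"
      using k mdeg_3[OF k(1)] by (simp add: mdeg_bool dehomogenize_def)
    ultimately show "single 0 (d - mdeg (dehomogenize \<alpha>)) +
      (single 1 (lookup (dehomogenize \<alpha>) False) +
       single 2 (lookup (dehomogenize \<alpha>) True)) = \<alpha>"
      by (intro poly_mapping_eqI) (auto simp: lookup_add lookup_single when_def dehomogenize_def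
          less_Suc_eq numeral_2_eq_2 not_less_eq)
  qed
  show "\<forall>\<kappa>\<in>exponents_below (d + 1). dehomogenize (single 0 (d - mdeg \<kappa>) +
    (single 1 (lookup \<kappa> False) + single 2 (lookup \<kappa> True))) = \<kappa>"
    by (simp add: dehomogenize_def lookup_add lookup_single bipow_lookup)
  show "dehomogenize ` veronese_index 2 d \<subseteq> exponents_below (d + 1)" using dehomogenize_mem by blast
  show "(\<lambda>\<kappa>. single 0 (d - mdeg \<kappa>) + (single 1 (lookup \<kappa> False) +
    single 2 (lookup \<kappa> True))) ` exponents_below (d + 1) \<subseteq> veronese_index 2 d"
    by (auto simp: monomials_altdef keys_add_nat mdeg_add exponents_below_def mdeg_bool split: if_splits)
qed

lemma finite_veronese_index: "finite (veronese_index 2 d)"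
  using bij_betw_finite[OF bij_betw_dehomogenize] by simp

lemma card_veronese_index: "2 * card (veronese_index 2 d) = (d + 1) * (d + 2)"
  using bij_betw_same_card[OF bij_betw_dehomogenize, of d] card_exponents_below[of "d + 1"] by simp

lemma sum_veronese_index:
  "(\<Sum>\<alpha>\<in>veronese_index 2 d. g (dehomogenize \<alpha>)) = (\<Sum>\<kappa>\<in>exponents_below (d + 1). g \<kappa>)"
  by (rule sum.reindex_bij_betw[OF bij_betw_dehomogenize])

definition osculating_cone ::
  "nat \<Rightarrow> nat \<Rightarrow> (bool \<Rightarrow> complex) \<Rightarrow> ((nat \<Rightarrow>\<^sub>0 nat) \<Rightarrow> complex) set" where
  "osculating_cone d m p = range (\<lambda>b \<alpha>. \<Sum>\<beta>\<in>exponents_below (m + 1). b \<beta> * osculating_vector d \<beta> p \<alpha>)"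

lemma subspace_osculating_cone: "cfun.subspace (osculating_cone d m p)"
proof (rule cfun.subspaceI)
  show "0 \<in> osculating_cone d m p"
    unfolding osculating_cone_def by (rule range_eqI[of _ _ "\<lambda>_. 0"]) (simp add: fun_eq_iff)
next
  fix x y assume "x \<in> osculating_cone d m p" "y \<in> osculating_cone d m p"
  then obtain b c where
    "x = (\<lambda>\<alpha>. \<Sum>\<beta>\<in>exponents_below (m + 1). b \<beta> * osculating_vector d \<beta> p \<alpha>)"
    "y = (\<lambda>\<alpha>. \<Sum>\<beta>\<in>exponents_below (m + 1). c \<beta> * osculating_vector d \<beta> p \<alpha>)"
    by (auto simp: osculating_cone_def)
  then show "x + y \<in> osculating_cone d m p"
    unfolding osculating_cone_def
    by (intro range_eqI[of _ _ "\<lambda>\<beta>. b \<beta> + c \<beta>"]) (simp add: fun_eq_iff distrib_right sum.distrib)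
next
  fix c x assume "x \<in> osculating_cone d m p"
  then obtain b where "x = (\<lambda>\<alpha>. \<Sum>\<beta>\<in>exponents_below (m + 1). b \<beta> * osculating_vector d \<beta> p \<alpha>)"
    by (auto simp: osculating_cone_def)
  then show "(\<lambda>i. c * x i) \<in> osculating_cone d m p"
    unfolding osculating_cone_def
    by (intro range_eqI[of _ _ "\<lambda>\<beta>. c * b \<beta>"]) (simp add: fun_eq_iff sum_distrib_left mult.assoc)
qed

lemma osculating_space_subset:
  assumes "d \<ge> 1" "x 0 \<noteq> 0"
    and q: "q \<in> osculating_space (veronese_index 2 d) m (veronese_variety 2 d) (cfun.span {veronese_map 2 d x})"
  shows "q \<in> proj_space (veronese_index 2 d)" "q \<subseteq> osculating_cone d m (affine_point x)"
proof -
  obtain n W \<phi> w where \<phi>: "local_parametrization (veronese_index 2 d) (veronese_variety 2 d) n W \<phi>" "w \<in> W"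
    "cfun.span {veronese_map 2 d x} = cfun.span {\<phi> w}"
    and q': "q \<in> proj_span (veronese_index 2 d)
      {\<lambda>i. iter_partial js (\<lambda>u. \<phi> u i) w | js. js \<in> lists {..<n} \<and> length js \<le> m}"
    using q unfolding osculating_space_def by blast
  show "q \<in> proj_space (veronese_index 2 d)" using q' by (simp add: proj_span_def)
  have "{\<lambda>i. iter_partial js (\<lambda>u. \<phi> u i) w | js. js \<in> lists {..<n} \<and> length js \<le> m}
      \<subseteq> osculating_cone d m (affine_point x)"
  proof
    fix v assume "v \<in> {\<lambda>i. iter_partial js (\<lambda>u. \<phi> u i) w | js. js \<in> lists {..<n} \<and> length js \<le> m}"
    then obtain js where v: "v = (\<lambda>i. iter_partial js (\<lambda>u. \<phi> u i) w)"
      and js: "js \<in> lists {..<n}" "length js \<le> m" by auto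
    obtain b where "\<And>\<alpha>. iter_partial js (\<lambda>u. \<phi> u \<alpha>) w =
      (\<Sum>\<beta>\<in>exponents_below (m + 1). b \<beta> * osculating_vector d \<beta> (affine_point x) \<alpha>)"
      using iter_partial_osculating[OF assms(1) \<phi>(1,2) \<phi>(3)[symmetric] assms(2) js] by blast
    then show "v \<in> osculating_cone d m (affine_point x)"
      unfolding osculating_cone_def v by (intro range_eqI[of _ _ b]) (simp add: fun_eq_iff)
  qed
  from cfun.span_minimal[OF this subspace_osculating_cone] q'
  show "q \<subseteq> osculating_cone d m (affine_point x)" by (auto simp: proj_span_def)
qed

lemma zariski_closure_subset: "Y \<subseteq> proj_space I \<Longrightarrow> zariski_closure I Y \<subseteq> proj_space I"
  by (intro hull_minimal zariski_closed_proj_space)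

lemma line_scale: "c \<noteq> 0 \<Longrightarrow> cfun.span {\<lambda>i. c * v i} = cfun.span {v}"
  using cfun.span_image_scale[of "{v}" "\<lambda>_. c"] by simp

lemma veronese_map_coord: "veronese_map n d x \<in> coord_space (veronese_index n d)"
  by (simp add: coord_space_def veronese_map_def)

lemma veronese_map_pure: "veronese_map 2 d x (single 0 d) = x 0 ^ d"
  by (simp add: veronese_map_def monomials_altdef)

lemma veronese_point:
  assumes "x \<in> coord_space {..2}" "x 0 \<noteq> 0"
  shows "cfun.span {veronese_map 2 d x} \<in> veronese_variety 2 d"
    "cfun.span {veronese_map 2 d x} \<in> proj_space (veronese_index 2 d)"
proof -
  have "x \<noteq> 0" using assms(2) by auto
  then show "cfun.span {veronese_map 2 d x} \<in> veronese_variety 2 d"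
    using assms(1) by (auto simp: veronese_variety_def)
  have "veronese_map 2 d x (single 0 d) \<noteq> 0" using assms(2) by (simp add: veronese_map_pure)
  then have "veronese_map 2 d x \<noteq> 0" by (metis zero_fun_apply)
  then show "cfun.span {veronese_map 2 d x} \<in> proj_space (veronese_index 2 d)"
    using veronese_map_coord by (auto simp: proj_space_def)
qed

lemma veronese_variety_subset: "veronese_variety 2 d \<subseteq> proj_space (veronese_index 2 d)"
proof
  fix p assume "p \<in> veronese_variety 2 d"
  then obtain x where x: "p = cfun.span {veronese_map 2 d x}" "x \<in> coord_space {..2}" "x \<noteq> 0"
    by (auto simp: veronese_variety_def)
  then obtain i where i: "x i \<noteq> 0" by (auto simp: fun_eq_iff)
  with x(2) have "i \<le> 2" by (auto simp: coord_space_def)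
  with i have "veronese_map 2 d x (single i d) \<noteq> 0"
    by (simp add: veronese_map_def monomials_altdef)
  then have "veronese_map 2 d x \<noteq> 0" by (metis zero_fun_apply)
  with x(1) veronese_map_coord show "p \<in> proj_space (veronese_index 2 d)" by (auto simp: proj_space_def)
qed

definition origin :: "nat \<Rightarrow> complex" where
  "origin = (\<lambda>i. if i = 0 then 1 else 0)"

lemma origin: "origin \<in> coord_space {..2}" "origin 0 = 1"
  by (auto simp: origin_def coord_space_def)

text \<open>The osculating variety is an intersection over open sets, hence contained in the closure
  that belongs to one of them: the part of the surface with \<open>x 0 \<noteq> 0\<close>, where the
  osculating cones are known.\<close>

lemma vanishes_osculating_variety:
  assumes "d \<ge> 1" and f: "f \<in> forms (veronese_index 2 d) e"
    and zero: "\<And>p v. v \<in> osculating_cone d m p \<Longrightarrow> f v = 0"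
  shows "vanishes f (osculating_veronese d m)" "osculating_veronese d m \<subseteq> proj_space (veronese_index 2 d)"
proof -
  let ?I = "veronese_index 2 d" and ?V = "veronese_variety 2 d"
  define \<alpha>0 where "\<alpha>0 = single (0::nat) d"
  define Z where "Z = {p \<in> proj_space ?I. \<forall>v\<in>p. v \<alpha>0 = 0}"
  have "\<alpha>0 \<in> ?I" by (auto simp: \<alpha>0_def monomials_altdef)
  from zariski_closed_form[OF forms_coord[OF this]] have Z: "zariski_closed ?I Z" by (simp add: Z_def)
  define Y where "Y = (\<Union>p\<in>?V - Z. osculating_space ?I m ?V p)"
  have "cfun.span {veronese_map 2 d origin} \<notin> Z"
    using cfun.span_base[of "veronese_map 2 d origin" "{veronese_map 2 d origin}"]
    by (auto simp: Z_def \<alpha>0_def veronese_map_pure origin intro!: bexI[of _ "veronese_map 2 d origin"])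
  then have "?V - Z \<noteq> {}" using veronese_point[of origin d] origin by auto
  with Z have sub: "osculating_veronese d m \<subseteq> zariski_closure ?I Y"
    unfolding osculating_veronese_def osculating_variety_def Y_def by (intro Inter_lower) blast
  have Y: "q \<in> proj_space ?I \<and> (\<forall>v\<in>q. f v = 0)" if q: "q \<in> Y" for q
  proof -
    obtain p where p: "p \<in> ?V" "p \<notin> Z" "q \<in> osculating_space ?I m ?V p" using q by (auto simp: Y_def)
    then obtain x where x: "p = cfun.span {veronese_map 2 d x}" by (auto simp: veronese_variety_def)
    have "x 0 \<noteq> 0"
    proof
      assume "x 0 = 0"
      then have van: "\<forall>v\<in>p. v \<alpha>0 = 0"
        using assms(1) by (auto simp: x line_altdef \<alpha>0_def veronese_map_pure)
      obtain n W \<phi> w where "local_parametrization ?I ?V n W \<phi>" "w \<in> W" "p = cfun.span {\<phi> w}"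
        using p(3) unfolding osculating_space_def by blast
      then have "p \<in> proj_space ?I" by (auto simp: local_parametrization_def proj_space_def)
      with van p(2) show False by (simp add: Z_def)
    qed
    from osculating_space_subset[of d x q m, OF assms(1) this] p(3) zero show ?thesis by (auto simp: x)
  qed
  then show "osculating_veronese d m \<subseteq> proj_space ?I" using zariski_closure_subset[of Y ?I] sub by blast
  have "vanishes f (zariski_closure ?I Y)" using Y by (intro vanishes_hull[OF f]) (auto simp: vanishes_def)
  with sub show "vanishes f (osculating_veronese d m)" by (auto simp: vanishes_def)
qed

text \<open>The osculating variety has to be shown to be nonempty, since otherwise the intersection
  defining its secant variety is over the empty family.\<close>

definition affine_chart :: "(nat \<Rightarrow> complex) \<Rightarrow> nat \<Rightarrow> complex" where
  "affine_chart w = (\<lambda>i. if i = 0 then 1 else if i = 1 then w 0 else if i = 2 then w 1 else 0)"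

lemma affine_chart: "affine_chart w \<in> coord_space {..2}" "affine_chart w 0 = 1"
  by (auto simp: affine_chart_def coord_space_def)

lemma veronese_map_eq_chart:
  assumes "x 0 \<noteq> 0"
  shows "veronese_map 2 d x = (\<lambda>\<alpha>. x 0 ^ d * veronese_map 2 d (affine_chart (\<lambda>j\<in>{..<2}. x (j + 1) / x 0)) \<alpha>)"
proof
  fix \<alpha>
  define y where "y = affine_chart (\<lambda>j\<in>{..<2}. x (j + 1) / x 0)"
  have "affine_point y = affine_point x" "y 0 = 1" by (auto simp: y_def affine_chart_def numeral_2_eq_2)
  then have "veronese_map 2 d x \<alpha> = x 0 ^ d * veronese_map 2 d y \<alpha>"
    using veronese_map_affine[of \<alpha> d x] veronese_map_affine[of \<alpha> d y] assms
    by (cases "\<alpha> \<in> veronese_index 2 d") (simp_all only: power_one mult_1, simp_all add: veronese_map_def)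
  then show "veronese_map 2 d x \<alpha> = x 0 ^ d * veronese_map 2 d (affine_chart (\<lambda>j\<in>{..<2}. x (j + 1) / x 0)) \<alpha>"
    by (simp add: y_def)
qed

section \<open>The standard chart as a local parametrization\<close>

abbreviation plane_monomial :: "complex \<Rightarrow> nat \<Rightarrow> nat \<Rightarrow> (nat \<Rightarrow> complex) \<Rightarrow> complex" where
  "plane_monomial c a b \<equiv> (\<lambda>w. c * w 0 ^ a * w 1 ^ b)"

lemma veronese_map_affine_chart:
  "(\<lambda>w. veronese_map 2 d (affine_chart w) \<alpha>) = plane_monomial (if \<alpha> \<in> veronese_index 2 d then 1 else 0)
     (lookup \<alpha> 1) (lookup \<alpha> 2)"
proof (cases "\<alpha> \<in> veronese_index 2 d")
  case True
  then have "keys \<alpha> \<subseteq> {..2}" by (simp add: monomials_altdef)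
  with True show ?thesis by (simp add: fun_eq_iff veronese_map_def eval_monomial_3 affine_chart_def)
qed (simp add: veronese_map_def)

lemma plane_monomial_derivative:
  assumes "j < 2"
  shows "((\<lambda>t. plane_monomial c a b (w(j := t))) has_field_derivative
    (if j = 0 then plane_monomial (c * of_nat a) (a - 1) b else plane_monomial (c * of_nat b) a (b - 1)) w) (at (w j))"
proof (cases "j = 0")
  case True
  then show ?thesis by (auto intro!: derivative_eq_intros)
next
  case False
  then have "j = 1" using assms by simp
  then show ?thesis by (auto intro!: derivative_eq_intros)
qed

lemma partial_plane_monomial:
  assumes "j < 2"
  shows "partial j (plane_monomial c a b) =
    (if j = 0 then plane_monomial (c * of_nat a) (a - 1) b else plane_monomial (c * of_nat b) a (b - 1))"
  unfolding partial_def using DERIV_imp_deriv[OF plane_monomial_derivative[OF assms]] by (simp add: fun_eq_iff)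

lemma iter_partial_plane_monomial:
  "js \<in> lists {..<2} \<Longrightarrow> \<exists>c' a' b'. iter_partial js (plane_monomial c a b) = plane_monomial c' a' b'"
proof (induction js)
  case Nil
  then show ?case by auto
next
  case (Cons j js)
  then obtain c' a' b' where "iter_partial js (plane_monomial c a b) = plane_monomial c' a' b'" by auto
  then have "iter_partial (j # js) (plane_monomial c a b) = partial j (plane_monomial c' a' b')" by simp
  then show ?case using Cons.prems partial_plane_monomial[of j c' a' b'] by (cases "j = 0") auto
qed

lemma continuous_plane_monomial:
  "continuous_map (affine_topology 2) euclidean (plane_monomial c a b)"
proof -
  have "((\<lambda>w. w j) \<longlongrightarrow> w j) (atin (affine_topology 2) w)" if "w \<in> topspace (affine_topology 2)" "j < 2" for w j
    using continuous_map_product_projection[of j "{..<2}" "\<lambda>_. euclidean :: complex topology"] that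
    by (simp add: continuous_map_atin)
  then show ?thesis unfolding continuous_map_atin limitin_canonical_iff
    by (intro ballI tendsto_mult tendsto_power tendsto_const) auto
qed

lemma holomorphic_plane_monomial:
  "holomorphic_several 2 (topspace (affine_topology 2)) (plane_monomial c a b)"
  unfolding holomorphic_several_def
proof (intro ballI conjI allI impI)
  fix js assume "js \<in> lists {..<2::nat}"
  then obtain c' a' b' where *: "iter_partial js (plane_monomial c a b) = plane_monomial c' a' b'"
    using iter_partial_plane_monomial by blast
  show "continuous_map (subtopology (affine_topology 2) (topspace (affine_topology 2))) euclidean
      (iter_partial js (plane_monomial c a b))"
    unfolding * subtopology_topspace by (rule continuous_plane_monomial)
  show "(\<lambda>t. iter_partial js (plane_monomial c a b) (w(j := t))) field_differentiable at (w j)" if "j < 2" for w j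
    unfolding * using plane_monomial_derivative[OF that, where c = c' and a = a' and b = b' and w = w] by (auto simp: field_differentiable_def)
qed

text \<open>Injectivity and immersion are read off from the three coordinates \<open>x 0 ^ d\<close>
  and \<open>x 0 ^ (d - 1) * x i\<close>. The neighbourhood \<open>N\<close> is the locus where the
  first of them is nonzero, since every point of the surface there comes from the chart.\<close>

lemma local_parametrization_veronese:
  assumes "d \<ge> 1"
  shows "local_parametrization (veronese_index 2 d) (veronese_variety 2 d) 2 (topspace (affine_topology 2))
    (\<lambda>w. veronese_map 2 d (affine_chart w))"
proof -
  let ?I = "veronese_index 2 d" and ?W = "topspace (affine_topology 2)"
  define \<phi> where "\<phi> w = veronese_map 2 d (affine_chart w)" for w
  define \<alpha>0 where "\<alpha>0 = single (0::nat) d"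
  define \<alpha>i where "\<alpha>i i = single (0::nat) (d - 1) + single i 1" for i
  have I: "\<alpha>0 \<in> ?I" "\<alpha>i 1 \<in> ?I" "\<alpha>i 2 \<in> ?I"
    using assms by (auto simp: \<alpha>0_def \<alpha>i_def monomials_altdef mdeg_add keys_add_nat split: if_splits)
  have \<phi>_eq: "(\<lambda>w. \<phi> w \<alpha>) = plane_monomial (if \<alpha> \<in> ?I then 1 else 0)
     (lookup \<alpha> 1) (lookup \<alpha> 2)" for \<alpha>
    unfolding \<phi>_def by (rule veronese_map_affine_chart)
  have look: "lookup \<alpha>0 1 = 0" "lookup \<alpha>0 2 = 0"
    "lookup (\<alpha>i 1) 1 = 1" "lookup (\<alpha>i 1) 2 = 0"
    "lookup (\<alpha>i 2) 1 = 0" "lookup (\<alpha>i 2) 2 = 1"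
    by (simp_all add: \<alpha>0_def \<alpha>i_def lookup_add lookup_single)
  have val: "\<phi> w \<alpha>0 = 1" "\<phi> w (\<alpha>i 1) = w 0" "\<phi> w (\<alpha>i 2) = w 1" for w
    using fun_cong[OF \<phi>_eq[of \<alpha>0], of w] fun_cong[OF \<phi>_eq[of "\<alpha>i 1"], of w] fun_cong[OF \<phi>_eq[of "\<alpha>i 2"], of w] I
    by (simp_all only: look if_True power_0 power_one_right mult_1 mult_1_right)
  have nonzero: "\<phi> w \<noteq> 0" for w using val(1)[of w] by (metis zero_fun_apply zero_neq_one)
  show ?thesis
    unfolding local_parametrization_def \<phi>_def[symmetric]
  proof (intro conjI allI ballI impI)
    show "openin (affine_topology 2) ?W" by (rule openin_topspace)
    show "holomorphic_several 2 ?W (\<lambda>w. \<phi> w i)" for i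
      unfolding \<phi>_eq by (rule holomorphic_plane_monomial)
    show "\<phi> w \<in> coord_space ?I" for w unfolding \<phi>_def by (rule veronese_map_coord)
    show "\<phi> w \<noteq> 0" for w by (rule nonzero)
    show "cfun.span {\<phi> w} \<in> veronese_variety 2 d" for w
      unfolding \<phi>_def by (rule veronese_point) (simp_all add: affine_chart)
    show "inj_on (\<lambda>w. cfun.span {\<phi> w}) ?W"
    proof (rule inj_onI)
      fix w w' assume w: "w \<in> ?W" "w' \<in> ?W" "cfun.span {\<phi> w} = cfun.span {\<phi> w'}"
      then have "\<phi> w \<in> cfun.span {\<phi> w'}" using cfun.span_base[of "\<phi> w" "{\<phi> w}"] by simp
      then obtain c where c: "\<phi> w = (\<lambda>i. c * \<phi> w' i)" by (auto simp: line_altdef)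
      from fun_cong[OF this, of \<alpha>0] have "c = 1" by (simp add: val)
      with fun_cong[OF c, of "\<alpha>i 1"] fun_cong[OF c, of "\<alpha>i 2"] have "w 0 = w' 0" "w 1 = w' 1"
        by (simp_all only: val mult_1)
      with w(1,2) show "w = w'"
        by (intro PiE_ext[of w "{..<2}" "\<lambda>_. UNIV" w']) (auto simp: less_2_cases_iff)
    qed
  next
    fix w b c
    assume eq: "\<forall>i. b * \<phi> w i + (\<Sum>j<2. c j * partial j (\<lambda>u. \<phi> u i) w) = 0"
    have p: "b * \<phi> w i + c 0 * partial 0 (\<lambda>u. \<phi> u i) w + c 1 * partial 1 (\<lambda>u. \<phi> u i) w = 0" for i
      using eq[rule_format, of i] by (simp add: numeral_2_eq_2 add.assoc)
    have pd: "partial j (\<lambda>u. \<phi> u \<alpha>) w = (if j = 0 then plane_monomial (lookup \<alpha> 1)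
        (lookup \<alpha> 1 - 1) (lookup \<alpha> 2) w else plane_monomial (lookup \<alpha> 2)
        (lookup \<alpha> 1) (lookup \<alpha> 2 - 1) w)" if "\<alpha> \<in> ?I" "j < 2" for \<alpha> j
      unfolding \<phi>_eq partial_plane_monomial[OF that(2)] using that(1) by simp
    have "partial 0 (\<lambda>u. \<phi> u \<alpha>0) w = 0" "partial 1 (\<lambda>u. \<phi> u \<alpha>0) w = 0"
      "partial 0 (\<lambda>u. \<phi> u (\<alpha>i 1)) w = 1" "partial 1 (\<lambda>u. \<phi> u (\<alpha>i 1)) w = 0"
      "partial 0 (\<lambda>u. \<phi> u (\<alpha>i 2)) w = 0" "partial 1 (\<lambda>u. \<phi> u (\<alpha>i 2)) w = 1"
      by (simp_all add: pd I look del: One_nat_def)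
    with p[of \<alpha>0] p[of "\<alpha>i 1"] p[of "\<alpha>i 2"] val[of w] have *: "b = 0" "c 0 = 0" "c 1 = 0" by simp_all
    show "b = 0" by (rule *)
    show "c j = 0" if "j < 2" for j using that * by (auto simp: less_2_cases_iff)
  next
    fix w assume "w \<in> ?W"
    define N where "N = {v :: (nat \<Rightarrow>\<^sub>0 nat) \<Rightarrow> complex. v \<alpha>0 \<noteq> 0}"
    have "continuous_on UNIV (\<lambda>v :: (nat \<Rightarrow>\<^sub>0 nat) \<Rightarrow> complex. v \<alpha>0)"
      by (rule continuous_on_product_coordinates)
    then have "open N" unfolding N_def
      by (intro open_Collect_neq continuous_on_const)
    moreover have "\<phi> w \<in> N" by (simp add: N_def val)
    moreover have "\<exists>u\<in>?W. cfun.span {v} = cfun.span {\<phi> u}"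
      if v: "v \<in> N \<inter> coord_space ?I" "cfun.span {v} \<in> veronese_variety 2 d" for v
    proof -
      obtain y where "cfun.span {v} = cfun.span {veronese_map 2 d y}" using v(2) by (auto simp: veronese_variety_def)
      then have "v \<in> cfun.span {veronese_map 2 d y}" using cfun.span_base[of v "{v}"] by simp
      then obtain c where c: "v = (\<lambda>\<alpha>. c * veronese_map 2 d y \<alpha>)" by (auto simp: line_altdef)
      have "v \<alpha>0 = c * y 0 ^ d" unfolding c \<alpha>0_def veronese_map_pure ..
      moreover have "v \<alpha>0 \<noteq> 0" using v(1) by (simp add: N_def)
      ultimately have nz: "c * y 0 ^ d \<noteq> 0" "y 0 \<noteq> 0" using assms by auto
      define u where "u = (\<lambda>j\<in>{..<2}. y (j + 1) / y 0)"
      have "veronese_map 2 d y \<alpha> = y 0 ^ d * \<phi> u \<alpha>" for \<alpha>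
        unfolding \<phi>_def u_def by (rule fun_cong[OF veronese_map_eq_chart[of y d, OF nz(2)]])
      then have "v = (\<lambda>\<alpha>. (c * y 0 ^ d) * \<phi> u \<alpha>)" unfolding c by (simp only: mult.assoc)
      then have "cfun.span {v} = cfun.span {\<phi> u}" by (simp only: line_scale[OF nz(1)])
      moreover have "u \<in> ?W" by (simp add: u_def)
      ultimately show ?thesis by blast
    qed
    ultimately show "\<exists>N. open N \<and> \<phi> w \<in> N \<and> (\<forall>v\<in>N \<inter> coord_space ?I. cfun.span {v} \<in> veronese_variety 2 d \<longrightarrow>
        (\<exists>u\<in>?W. cfun.span {v} = cfun.span {\<phi> u}))" by blast
  qed
qed

lemma veronese_point_mem_osculating_space:
  assumes "d \<ge> 1" "x \<in> coord_space {..2}" "x 0 \<noteq> 0"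
  shows "cfun.span {veronese_map 2 d x} \<in>
    osculating_space (veronese_index 2 d) m (veronese_variety 2 d) (cfun.span {veronese_map 2 d x})"
proof -
  let ?I = "veronese_index 2 d" and ?W = "topspace (affine_topology 2)"
  define u where "u = (\<lambda>j\<in>{..<2}. x (j + 1) / x 0)"
  have "u \<in> ?W" by (simp add: u_def)
  have "veronese_map 2 d x = (\<lambda>\<alpha>. x 0 ^ d * veronese_map 2 d (affine_chart u) \<alpha>)"
    unfolding u_def by (rule veronese_map_eq_chart[of x d, OF assms(3)])
  then have eq: "cfun.span {veronese_map 2 d x} = cfun.span {veronese_map 2 d (affine_chart u)}"
    using line_scale[of "x 0 ^ d" "veronese_map 2 d (affine_chart u)"] assms(3) by simp
  let ?S = "{\<lambda>i. iter_partial js (\<lambda>w. veronese_map 2 d (affine_chart w) i) u | js.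
    js \<in> lists {..<2} \<and> length js \<le> m}"
  have "veronese_map 2 d (affine_chart u) \<in> ?S"
    by (rule CollectI, rule exI[of _ "[]"]) simp
  then have "cfun.span {veronese_map 2 d x} \<subseteq> cfun.span ?S" unfolding eq by (intro cfun.span_mono) simp
  then have mem: "cfun.span {veronese_map 2 d x} \<in> proj_span ?I ?S"
    using veronese_point[OF assms(2,3)] by (simp add: proj_span_def)
  show ?thesis unfolding osculating_space_def
    by (rule UnionI[OF _ mem], rule CollectI, rule exI[of _ 2], rule exI[of _ ?W],
        rule exI[of _ "\<lambda>w. veronese_map 2 d (affine_chart w)"], rule exI[of _ u])
      (intro conjI refl local_parametrization_veronese assms(1) \<open>u \<in> ?W\<close> eq)
qed

lemma forms_veronese:
  assumes "f \<in> forms (veronese_index 2 d) e"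
  shows "(\<lambda>x. f (veronese_map 2 d x)) \<in> polyfuns UNIV"
proof (rule polyfuns_compose[OF assms, of _ "\<lambda>_. UNIV"])
  fix \<alpha> :: "nat \<Rightarrow>\<^sub>0 nat"
  show "(\<lambda>x. veronese_map 2 d x \<alpha>) \<in> polyfuns UNIV"
    using polyfuns_monomial[of \<alpha> UNIV 1] by (cases "\<alpha> \<in> veronese_index 2 d") (simp_all add: veronese_map_def polyfuns_0)
qed auto

text \<open>One fixed point lies in all the closures. Otherwise a form \<open>f\<close> vanishes on
  a closed set containing the union but not at that point, while a form \<open>g\<close> vanishes on
  \<open>Z\<close> but not on the whole surface. Pulled back to three-space, \<open>f\<close>,
  \<open>g\<close> and \<open>x 0\<close> are simultaneously nonzero somewhere, and the image of
  that vector contradicts the choice of \<open>f\<close>.\<close>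

lemma osculating_veronese_nonempty:
  assumes "d \<ge> 1"
  shows "osculating_veronese d m \<noteq> {}"
proof -
  let ?I = "veronese_index 2 d" and ?V = "veronese_variety 2 d"
  let ?p = "\<lambda>x. cfun.span {veronese_map 2 d x}"
  have "?p origin \<in> zariski_closure ?I (\<Union>p\<in>?V - Z. osculating_space ?I m ?V p)"
    if Z: "zariski_closed ?I Z" "?V - Z \<noteq> {}" for Z
    unfolding hull_def
  proof (intro InterI, clarify)
    fix T assume T: "zariski_closed ?I T" "(\<Union>p\<in>?V - Z. osculating_space ?I m ?V p) \<subseteq> T"
    show "?p origin \<in> T"
    proof (rule ccontr)
      assume nT: "?p origin \<notin> T"
      have p0: "?p origin \<in> proj_space ?I" by (rule veronese_point) (simp_all add: origin)
      have base: "veronese_map 2 d x \<in> ?p x" for x by (rule cfun.span_base) simp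
      obtain a f v where f: "f \<in> forms ?I a" "vanishes f T" "v \<in> ?p origin" "f v \<noteq> 0"
        using zariski_closed_separate[OF T(1) p0 nT] .
      have nz: "h (veronese_map 2 d x) \<noteq> 0" if "h \<in> forms ?I b" "v \<in> ?p x" "h v \<noteq> 0" for h b v x
        using that forms_scale[OF that(1)] by (auto simp: line_altdef)
      obtain p where p: "p \<in> ?V" "p \<notin> Z" using Z(2) by blast
      then obtain y where y: "p = ?p y" "y \<in> coord_space {..2}" by (auto simp: veronese_variety_def)
      have pP: "p \<in> proj_space ?I" by (rule subsetD[OF veronese_variety_subset p(1)])
      obtain b g w where g: "g \<in> forms ?I b" "vanishes g Z" "w \<in> p" "g w \<noteq> 0"
        using zariski_closed_separate[OF Z(1) pP p(2)] .
      have F: "(\<lambda>x. f (veronese_map 2 d x)) \<in> polyfuns UNIV" "(\<lambda>x. g (veronese_map 2 d x)) \<in> polyfuns UNIV"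
        using forms_veronese f(1) g(1) by auto
      have 0: "f (veronese_map 2 d origin) \<noteq> 0" "g (veronese_map 2 d y) \<noteq> 0"
        using nz[OF f(1,3,4)] nz[OF g(1) _ g(4), of y] g(3) y(1) by auto
      define z where "z t = (\<lambda>i. origin i + t * (y i - origin i))" for t
      obtain t where t: "f (veronese_map 2 d (z t)) * g (veronese_map 2 d (z t)) \<noteq> 0"
        using polyfuns_no_zero_divisors[of "\<lambda>x. f (veronese_map 2 d x)" _ "\<lambda>x. g (veronese_map 2 d x)" _
            origin y, OF F 0] unfolding z_def by blast
      have zc: "z t \<in> coord_space {..2}" using origin(1) y(2) by (simp add: z_def coord_space_def)
      have FG: "(\<lambda>x. f (veronese_map 2 d x) * g (veronese_map 2 d x)) \<in> polyfuns UNIV"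
        by (rule polyfuns_mult[OF F]) simp
      have H: "(\<lambda>x :: nat \<Rightarrow> complex. x 0) \<in> polyfuns UNIV"
        using polyfuns_monomial[of "single (0::nat) 1" UNIV 1] by simp
      have o: "origin 0 \<noteq> (0 :: complex)" by (simp add: origin)
      \<comment> \<open>The joint nonvanishing is reached in two moves, both inside
        \<open>coord_space {..2}\<close>: first \<open>f\<close> and \<open>g\<close>, then also the
        coordinate \<open>x 0\<close>, so that the point lies in the chart.\<close>
      obtain s where s: "f (veronese_map 2 d (\<lambda>i. z t i + s * (origin i - z t i))) *
          g (veronese_map 2 d (\<lambda>i. z t i + s * (origin i - z t i))) * (z t 0 + s * (origin 0 - z t 0)) \<noteq> 0"
        using polyfuns_no_zero_divisors[of "\<lambda>x. f (veronese_map 2 d x) * g (veronese_map 2 d x)" _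
            "\<lambda>x. x 0" _ "z t" origin, OF FG H t o] by blast
      define x where "x = (\<lambda>i. z t i + s * (origin i - z t i))"
      have x: "x \<in> coord_space {..2}" "x 0 \<noteq> 0" "f (veronese_map 2 d x) \<noteq> 0" "g (veronese_map 2 d x) \<noteq> 0"
        using s zc origin(1) by (auto simp: x_def coord_space_def)
      have "?p x \<notin> Z" using g(2) x(4) base[of x] by (auto simp: vanishes_def)
      then have "?p x \<in> T"
        using T(2) veronese_point_mem_osculating_space[OF assms x(1,2), of m] veronese_point(1)[OF x(1,2)] by blast
      with f(2) x(3) base[of x] show False by (auto simp: vanishes_def)
    qed
  qed
  then have "?p origin \<in> osculating_veronese d m"
    unfolding osculating_veronese_def osculating_variety_def by blast
  then show ?thesis by blast
qed

section \<open>Secant varieties\<close>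

lemma homogeneous_components:
  assumes "f \<in> polys I D"
  shows "\<exists>g. (\<forall>k. g k \<in> forms I k) \<and> (\<forall>v. f v = (\<Sum>k\<le>D. g k v))"
  using assms
proof (induction rule: polyfuns_induct)
  case (monomial c \<alpha>)
  define g where "g k = (if k = mdeg \<alpha> then (\<lambda>v. c * eval_monomial \<alpha> v) else (\<lambda>v. 0))" for k
  have "g k \<in> forms I k" for k
    using monomial by (auto simp: g_def monomials_altdef polyfuns_0 intro!: polyfuns_monomial)
  moreover have "c * eval_monomial \<alpha> v = (\<Sum>k\<le>D. g k v)" for v
    using monomial by (subst sum.remove[of _ "mdeg \<alpha>"]) (auto simp: g_def)
  ultimately show ?case by blast
next
  case zero
  show ?case by (intro exI[of _ "\<lambda>_ _. 0"]) (auto simp: polyfuns_0)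
next
  case (add f g)
  then obtain f' g' where "\<forall>k. f' k \<in> forms I k" "\<forall>v. f v = (\<Sum>k\<le>D. f' k v)"
    "\<forall>k. g' k \<in> forms I k" "\<forall>v. g v = (\<Sum>k\<le>D. g' k v)" by blast
  then show ?case by (intro exI[of _ "\<lambda>k v. f' k v + g' k v"]) (auto simp: sum.distrib intro: polyfuns_add)
qed

text \<open>Along the multiples of \<open>v\<close> the sum is a polynomial in \<open>t\<close> with
  coefficients \<open>g k v\<close>.\<close>

lemma homogeneous_components_eq_0:
  assumes g: "\<And>k. g k \<in> forms I k" and zero: "\<And>t. (\<Sum>k\<le>D. g k (\<lambda>i. t * v i)) = 0" and "k \<le> D"
  shows "g k v = 0"
proof -
  have "(\<Sum>k\<le>D. g k v * t ^ k) = 0" for t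
    using zero[of t] by (simp add: forms_scale[OF g] mult.commute)
  then show ?thesis using polyfun_eq_0[of "\<lambda>k. g k v" D] \<open>k \<le> D\<close> by blast
qed

lemma forms_translate:
  assumes "f \<in> forms I e"
  shows "(\<lambda>v. f (\<lambda>i. v i + w i)) \<in> polys I e"
proof (rule polyfuns_compose[OF assms, of _ "\<lambda>e. {\<kappa>. keys \<kappa> \<subseteq> I \<and> mdeg \<kappa> \<le> e}"])
  fix \<alpha> i assume *: "\<alpha> \<in> monomials I e" "i \<in> keys \<alpha>"
  then have "single i 1 \<in> {\<kappa>. keys \<kappa> \<subseteq> I \<and> mdeg \<kappa> \<le> 1}"
    by (auto simp: monomials_altdef)
  from polyfuns_monomial[OF this, of 1] show "(\<lambda>v. v i + w i) \<in> polys I 1"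
    by (intro polyfuns_add polyfuns_const) simp_all
qed (auto simp: monomials_altdef keys_add_nat mdeg_add)

text \<open>The summands are replaced one at a time: for fixed other summands each homogeneous component
  in the remaining summand vanishes on the cone.\<close>

lemma form_vanishes_on_join:
  fixes C :: "('i \<Rightarrow> complex) set" and Y :: "'i pt set" and h :: nat
  assumes f: "f \<in> forms I e"
    and C: "\<And>v t. v \<in> C \<Longrightarrow> (\<lambda>i. t * v i) \<in> C"
    and Y: "\<And>k g. g \<in> forms I k \<Longrightarrow> (\<And>v. v \<in> C \<Longrightarrow> g v = 0) \<Longrightarrow> vanishes g Y"
    and zero: "\<And>V. (\<And>l. l \<le> h \<Longrightarrow> V l \<in> C) \<Longrightarrow> f (\<lambda>i. \<Sum>l\<le>h. V l i) = 0"
    and V: "\<And>l. l \<le> h \<Longrightarrow> \<exists>q\<in>Y. V l \<in> q"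
  shows "f (\<lambda>i. \<Sum>l\<le>h. V l i) = 0"
proof -
  \<comment> \<open>Here \<open>j\<close> counts the summands already taken from points of
    \<open>Y\<close>; the others still lie in the cone \<open>C\<close>.\<close>
  have "f (\<lambda>i. \<Sum>l\<le>h. V l i) = 0"
    if "j \<le> h + 1" "\<And>l. l < j \<Longrightarrow> \<exists>q\<in>Y. V l \<in> q" "\<And>l. j \<le> l \<Longrightarrow> l \<le> h \<Longrightarrow> V l \<in> C" for j and V :: "nat \<Rightarrow> 'i \<Rightarrow> complex"
    using that
  proof (induction j arbitrary: V)
    case 0
    then show ?case by (intro zero) auto
  next
    case (Suc j)
    define w where "w i = (\<Sum>l\<in>{..h} - {j}. V l i)" for i
    have split: "(\<lambda>i. \<Sum>l\<le>h. (V(j := v)) l i) = (\<lambda>i. v i + w i)" for v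
      using Suc.prems(1) by (auto simp: w_def sum.remove[of "{..h}" j] intro!: sum.cong)
    obtain g where g: "\<And>k. g k \<in> forms I k" "\<And>v. f (\<lambda>i. v i + w i) = (\<Sum>k\<le>e. g k v)"
      using homogeneous_components[OF forms_translate[OF f, of w]] by blast
    have "g k v = 0" if "k \<le> e" "v \<in> C" for k v
    proof (rule homogeneous_components_eq_0[where g = g and D = e, OF g(1) _ that(1)])
      fix t
      have "f (\<lambda>i. \<Sum>l\<le>h. (V(j := (\<lambda>i. t * v i))) l i) = 0"
        by (rule Suc.IH) (use Suc.prems C[OF that(2)] in auto)
      then show "(\<Sum>k\<le>e. g k (\<lambda>i. t * v i)) = 0" unfolding split g(2) .
    qed
    then have van: "vanishes (g k) Y" if "k \<le> e" for k using Y[OF g(1)] that by blast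
    obtain q where "q \<in> Y" "V j \<in> q" using Suc.prems(2)[of j] by auto
    with van have "g k (V j) = 0" if "k \<le> e" for k using that by (auto simp: vanishes_def)
    then have "f (\<lambda>i. V j i + w i) = 0" by (simp add: g(2))
    then show ?case using split[of "V j"] by simp
  qed
  from this[of "h + 1" V] V show ?thesis by simp
qed

lemma proj_space_line:
  assumes "q \<in> proj_space I" "u \<in> q" "v \<in> q"
  shows "u + v \<in> q" "(\<lambda>i. c * v i) \<in> q" "0 \<in> q"
proof -
  obtain w where q: "q = cfun.span {w}" using assms(1) by (auto simp: proj_space_def)
  show "u + v \<in> q" "(\<lambda>i. c * v i) \<in> q" "0 \<in> q"
    using assms(2,3) unfolding q by (auto intro: cfun.span_add cfun.span_scale cfun.span_zero)
qed

lemma span_union_points: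
  assumes "\<And>l. l \<le> h \<Longrightarrow> q l \<in> proj_space I" "v \<in> cfun.span (\<Union>l\<le>h::nat. q l)"
  shows "\<exists>V. (\<forall>l\<le>h. V l \<in> q l) \<and> v = (\<lambda>i. \<Sum>l\<le>h. V l i)"
  using assms(2)
proof (induction rule: cfun.span_induct_alt)
  case base
  have "\<forall>l\<le>h. 0 \<in> q l"
  proof (intro allI impI)
    fix l assume "l \<le> h"
    from assms(1)[OF this] obtain w where "w \<in> q l" by (meson proj_spaceE)
    with assms(1)[OF \<open>l \<le> h\<close>] show "0 \<in> q l" using proj_space_line(3) by blast
  qed
  then show ?case by (intro exI[of _ "\<lambda>_ _. 0"]) (simp add: zero_fun_def)
next
  case (step c x y)
  then obtain V l where V: "\<forall>l\<le>h. V l \<in> q l" "y = (\<lambda>i. \<Sum>l\<le>h. V l i)" and l: "l \<le> h" "x \<in> q l" by auto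
  define V' where "V' = V(l := (\<lambda>i. c * x i) + V l)"
  have "V' k \<in> q k" if "k \<le> h" for k
    using V(1) that proj_space_line(1,2)[OF assms(1)[OF l(1)]] l by (auto simp: V'_def)
  moreover have "(\<lambda>i. c * x i) + y = (\<lambda>i. \<Sum>l\<le>h. V' l i)"
  proof
    fix i
    have "(\<Sum>l\<in>{..h} - {l}. V' l i) = (\<Sum>l\<in>{..h} - {l}. V l i)" by (intro sum.cong) (auto simp: V'_def)
    then show "((\<lambda>i. c * x i) + y) i = (\<Sum>l\<le>h. V' l i)"
      using l(1) by (simp add: V(2) sum.remove[of "{..h}" l] V'_def)
  qed
  ultimately show ?case by blast
qed

section \<open>A parametrization that controls the secant variety\<close>

type_synonym parameter = "nat \<times> bool + nat \<times> (bool \<Rightarrow>\<^sub>0 nat)"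

text \<open>The points \<open>p\<^sub>l\<close> have affine coordinates \<open>u (Inl (l, b))\<close>, and \<open>u (Inr (l, \<beta>))\<close> is the
  coefficient of the osculating vector of order \<open>\<beta>\<close> at \<open>p\<^sub>l\<close>; \<open>R\<close> is the set of pairs used.\<close>

definition secant_map ::
  "nat \<Rightarrow> (nat \<times> (bool \<Rightarrow>\<^sub>0 nat)) set \<Rightarrow> (parameter \<Rightarrow> complex) \<Rightarrow> (nat \<Rightarrow>\<^sub>0 nat) \<Rightarrow> complex" where
  "secant_map d R u = (\<lambda>\<alpha>. \<Sum>(l, \<beta>)\<in>R. u (Inr (l, \<beta>)) * osculating_vector d \<beta> (\<lambda>b. u (Inl (l, b))) \<alpha>)"

abbreviation all_pairs :: "nat \<Rightarrow> nat \<Rightarrow> (nat \<times> (bool \<Rightarrow>\<^sub>0 nat)) set" where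
  "all_pairs h m \<equiv> {..h} \<times> exponents_below (m + 1)"

abbreviation point_parameters :: "nat \<Rightarrow> parameter set" where
  "point_parameters h \<equiv> Inl ` ({..h} \<times> UNIV)"

text \<open>From here on only forms on the image of \<open>secant_map\<close> matter. Of all open
  sets in the definition the whole product is used, and \<open>form_vanishes_on_join\<close> absorbs
  the closures already taken in the osculating variety.\<close>

lemma secant_veronese:
  assumes "d \<ge> 1" and f: "f \<in> forms (veronese_index 2 d) e"
    and zero: "\<And>u. f (secant_map d (all_pairs h m) u) = 0"
  shows "vanishes f (secant_variety (veronese_index 2 d) h (osculating_veronese d m))"
    and "secant_variety (veronese_index 2 d) h (osculating_veronese d m) \<subseteq> proj_space (veronese_index 2 d)"
proof -
  let ?I = "veronese_index 2 d" and ?Y = "osculating_veronese d m"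
  define C where "C = (\<Union>p. osculating_cone d m p)"
  have Yproj: "?Y \<subseteq> proj_space ?I"
    using vanishes_osculating_variety(2)[OF assms(1), of "\<lambda>_. 0" 0 m] by (simp add: polyfuns_0)
  have join: "f (\<lambda>i. \<Sum>l\<le>h. V l i) = 0" if V: "\<And>l. l \<le> h \<Longrightarrow> \<exists>q\<in>?Y. V l \<in> q" for V
  proof (rule form_vanishes_on_join[OF f, of C ?Y])
    show "(\<lambda>i. t * v i) \<in> C" if v: "v \<in> C" for v t
    proof -
      obtain p where "v \<in> osculating_cone d m p" using v by (auto simp: C_def)
      then have "(\<lambda>i. t * v i) \<in> osculating_cone d m p"
        by (rule cfun.subspace_scale[OF subspace_osculating_cone])
      then show ?thesis unfolding C_def by blast
    qed
    show "vanishes g ?Y" if "g \<in> forms ?I k" "\<And>v. v \<in> C \<Longrightarrow> g v = 0" for k g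
      using that by (intro vanishes_osculating_variety(1)[OF assms(1) that(1)]) (auto simp: C_def)
    show "f (\<lambda>i. \<Sum>l\<le>h. V l i) = 0" if V: "\<And>l. l \<le> h \<Longrightarrow> V l \<in> C" for V
    proof -
      have "\<forall>l\<in>{..h}. \<exists>pb. V l = (\<lambda>\<alpha>. \<Sum>\<beta>\<in>exponents_below (m + 1). snd pb \<beta> * osculating_vector d \<beta> (fst pb) \<alpha>)"
        using V by (fastforce simp: C_def osculating_cone_def)
      from bchoice[OF this] obtain pb where pb: "\<And>l. l \<le> h \<Longrightarrow>
        V l = (\<lambda>\<alpha>. \<Sum>\<beta>\<in>exponents_below (m + 1). snd (pb l) \<beta> * osculating_vector d \<beta> (fst (pb l)) \<alpha>)" by blast
      define u where "u = case_sum (\<lambda>(l, b). fst (pb l) b) (\<lambda>(l, \<beta>). snd (pb l) \<beta>)"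
      have "(\<lambda>i. \<Sum>l\<le>h. V l i) = secant_map d (all_pairs h m) u"
        unfolding secant_map_def sum.cartesian_product[symmetric]
        by (intro ext sum.cong refl) (simp add: pb u_def)
      then show ?thesis using zero by simp
    qed
  qed (rule V)
  define U where "U = ({..h} \<rightarrow>\<^sub>E ?Y)"
  have "U \<noteq> {}" unfolding U_def using osculating_veronese_nonempty[OF assms(1)] by (simp add: PiE_eq_empty_iff)
  moreover have "multi_zariski_closed ?I h {}"
  proof -
    \<comment> \<open>The constant 1, of multidegree 0, has the empty set as its zero locus, so the
      whole product is an admissible open set.\<close>
    define one :: "(nat \<times> (nat \<Rightarrow>\<^sub>0 nat)) cpoly" where "one = single 0 1"
    have "multihomogeneous ?I h (\<lambda>_. 0) one" by (simp add: multihomogeneous_def one_def)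
    moreover have "{q \<in> {..h} \<rightarrow>\<^sub>E proj_space ?I. \<forall>v. (\<forall>j\<le>h. v j \<in> q j) \<longrightarrow> eval_poly one (\<lambda>(j, i). v j i) = 0} = {}"
    proof -
      have "\<exists>v. \<forall>j\<le>h. v j \<in> q j" if q: "q \<in> {..h} \<rightarrow>\<^sub>E proj_space ?I" for q
      proof -
        have "\<forall>j\<in>{..h}. \<exists>v. v \<in> q j"
        proof
          fix j assume "j \<in> {..h}"
          with q have "q j \<in> proj_space ?I" by auto
          then show "\<exists>v. v \<in> q j" by (meson proj_spaceE)
        qed
        from bchoice[OF this] show ?thesis by auto
      qed
      moreover have "eval_poly one w = 1" for w by (simp add: one_def del: single_one)
      ultimately show ?thesis by simp
    qed
    ultimately show ?thesis unfolding multi_zariski_closed_def by (intro exI[of _ "{one}"]) auto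
  qed
  ultimately have sub: "secant_variety ?I h ?Y \<subseteq> zariski_closure ?I (\<Union>q\<in>U. proj_span ?I (\<Union>j\<le>h. q j))"
    unfolding secant_variety_def U_def by (intro Inter_lower) blast
  have subproj: "(\<Union>q\<in>U. proj_span ?I (\<Union>j\<le>h. q j)) \<subseteq> proj_space ?I" by (auto simp: proj_span_def)
  from zariski_closure_subset[OF this] sub show "secant_variety ?I h ?Y \<subseteq> proj_space ?I" by blast
  have "vanishes f (\<Union>q\<in>U. proj_span ?I (\<Union>j\<le>h. q j))"
    unfolding vanishes_def
  proof (intro ballI)
    fix r v assume "r \<in> (\<Union>q\<in>U. proj_span ?I (\<Union>j\<le>h. q j))" "v \<in> r"
    then obtain q where q: "q \<in> U" "v \<in> cfun.span (\<Union>j\<le>h. q j)" by (auto simp: proj_span_def)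
    then have qY: "q l \<in> ?Y" if "l \<le> h" for l using that by (auto simp: U_def)
    with Yproj span_union_points[of h q ?I v] q(2) obtain V where V: "\<forall>l\<le>h. V l \<in> q l" "v = (\<lambda>i. \<Sum>l\<le>h. V l i)"
      by blast
    then show "f v = 0" using join[of V] qY by blast
  qed
  from vanishes_hull[OF f this subproj] sub
  show "vanishes f (secant_variety ?I h ?Y)" by (auto simp: vanishes_def)
qed

lemma secant_map_polyfuns:
  assumes "d \<ge> 1" "finite R" "R \<subseteq> {..h} \<times> UNIV" "\<alpha> \<in> veronese_index 2 d"
  shows "(\<lambda>u. secant_map d R u \<alpha>) \<in> polyfuns (graded_box (point_parameters h \<union> Inr ` R) (Inr ` R) d 1)"
proof -
  let ?k = "dehomogenize \<alpha>"
  have k: "lookup ?k b \<le> d" for b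
    using dehomogenize_mem[OF assms(4)] by (cases b) (auto simp: exponents_below_def mdeg_bool)
  have *: "(\<lambda>u. u (Inr (l, \<beta>)) * osculating_vector d \<beta> (\<lambda>b. u (Inl (l, b))) \<alpha>) \<in>
    polyfuns (graded_box (point_parameters h \<union> Inr ` R) (Inr ` R) d 1)" if "(l, \<beta>) \<in> R" for l \<beta>
  proof -
    define e where "e b = lookup ?k b - lookup \<beta> b" for b
    define c where "c = (\<Prod>b\<in>UNIV. of_nat (lookup ?k b choose lookup \<beta> b) :: complex)"
    define \<kappa> :: "parameter \<Rightarrow>\<^sub>0 nat" where "\<kappa> = single (Inr (l, \<beta>)) 1 +
      (single (Inl (l, False)) (e False) + single (Inl (l, True)) (e True))"
    have "u (Inr (l, \<beta>)) * osculating_vector d \<beta> (\<lambda>b. u (Inl (l, b))) \<alpha> = c * eval_monomial \<kappa> u" for u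
      using assms(4) by (simp add: osculating_vector_def taylor_coeff_def c_def \<kappa>_def eval_monomial_add e_def
          UNIV_bool mult_ac)
    moreover have "\<kappa> \<in> graded_box (point_parameters h \<union> Inr ` R) (Inr ` R) d 1"
    proof -
      have "e b \<le> d" for b using k[of b] by (simp add: e_def)
      then have "lookup \<kappa> x \<le> d * 1" for x
        using assms(1) by (cases x) (auto simp: \<kappa>_def lookup_add lookup_single when_def)
      moreover have "keys \<kappa> \<subseteq> point_parameters h \<union> Inr ` R"
        using that assms(3) by (auto simp: \<kappa>_def keys_add_nat split: if_splits)
      moreover have "(\<Sum>x\<in>Inr ` R. lookup \<kappa> x) = 1"
      proof -
        have "(\<Sum>x\<in>Inr ` R. lookup \<kappa> x) = (\<Sum>r\<in>R. if r = (l, \<beta>) then 1 else 0)"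
          by (subst sum.reindex) (auto simp: \<kappa>_def lookup_add lookup_single when_def intro!: sum.cong)
        also have "\<dots> = 1" using that assms(2) by simp
        finally show ?thesis .
      qed
      ultimately show ?thesis by (simp add: graded_box_def)
    qed
    ultimately show ?thesis by (simp only: polyfuns_monomial)
  qed
  show ?thesis unfolding secant_map_def case_prod_unfold
  proof (rule polyfuns_sum)
    fix r assume "r \<in> R"
    with *[of "fst r" "snd r"] show "(\<lambda>u. u (Inr (fst r, snd r)) *
      osculating_vector d (snd r) (\<lambda>b. u (Inl (fst r, b))) \<alpha>) \<in>
      polyfuns (graded_box (point_parameters h \<union> Inr ` R) (Inr ` R) d 1)" by simp
  qed
qed

section \<open>Dependent osculating spaces\<close>

lemma card_point_parameters: "card (point_parameters h) = 2 * (h + 1)"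
  by (simp add: card_image card_cartesian_product)

text \<open>A multiple of the relation is subtracted to make the coefficient at
  \<open>(l0, \<beta>0)\<close> zero; the points stay fixed.\<close>

lemma secant_map_drop:
  assumes R: "finite R" "(l0, \<beta>0) \<in> R" and a: "a (l0, \<beta>0) \<noteq> 0"
    and rel: "\<And>\<alpha>. (\<Sum>(l, \<beta>)\<in>R. a (l, \<beta>) * osculating_vector d \<beta> (\<lambda>b. u (Inl (l, b))) \<alpha>) = 0"
  shows "\<exists>u'. secant_map d R u = secant_map d (R - {(l0, \<beta>0)}) u'"
proof -
  define c where "c = u (Inr (l0, \<beta>0)) / a (l0, \<beta>0)"
  define u' where "u' = case_sum (\<lambda>x. u (Inl x)) (\<lambda>r. u (Inr r) - c * a r)"
  have "secant_map d R u \<alpha> = secant_map d (R - {(l0, \<beta>0)}) u' \<alpha>" for \<alpha>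
  proof -
    define w where "w r = osculating_vector d (snd r) (\<lambda>b. u (Inl (fst r, b))) \<alpha>" for r
    have "secant_map d R u \<alpha> = (\<Sum>r\<in>R. u (Inr r) * w r) - c * (\<Sum>r\<in>R. a r * w r)"
      using rel[of \<alpha>] by (simp add: secant_map_def w_def case_prod_unfold)
    also have "\<dots> = (\<Sum>r\<in>R. (u (Inr r) - c * a r) * w r)"
      by (simp add: left_diff_distrib sum_subtractf sum_distrib_left mult.assoc)
    also have "\<dots> = (\<Sum>r\<in>R - {(l0, \<beta>0)}. (u (Inr r) - c * a r) * w r)"
      using R a by (subst sum.remove[OF R]) (simp add: c_def)
    also have "\<dots> = secant_map d (R - {(l0, \<beta>0)}) u' \<alpha>"
      by (simp add: secant_map_def u'_def w_def case_prod_unfold)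
    finally show ?thesis .
  qed
  then show ?thesis by blast
qed

text \<open>Which pair is redundant depends on the points, so the maps with one pair \<tau> removed
  are used for all \<tau> together. One unit of the -2 is the dropped coefficient, the other comes
  from homogeneity in the remaining ones.\<close>

lemma proj_dim_secant_dependent:
  assumes "d \<ge> 1" "h \<ge> 1"
    and dep: "\<And>p :: nat \<Rightarrow> bool \<Rightarrow> complex. \<exists>a l \<beta>. l \<le> h \<and> \<beta> \<in> exponents_below (m + 1) \<and> a (l, \<beta>) \<noteq> 0 \<and>
      (\<forall>\<kappa>\<in>exponents_below (d + 1). (\<Sum>(l, \<beta>)\<in>all_pairs h m. a (l, \<beta>) * taylor_coeff \<beta> \<kappa> (p l)) = 0)"
  shows "proj_dim (veronese_index 2 d) (secant_variety (veronese_index 2 d) h (osculating_veronese d m))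
    \<le> enat (2 * (h + 1) + (h + 1) * card (exponents_below (m + 1)) - 2)"
proof -
  let ?I = "veronese_index 2 d" and ?Q = "(h + 1) * card (exponents_below (m + 1))"
  define R where "R = all_pairs h m"
  have R: "finite R" "card R = ?Q" "R \<subseteq> {..h} \<times> UNIV" by (auto simp: R_def card_cartesian_product)
  have "0 \<in> exponents_below (m + 1)" by (simp add: exponents_below_def)
  \<comment> \<open>Two pairs ensure that a linear parameter remains after any single pair has been
    dropped.\<close>
  then have elems: "(0, 0) \<in> R" "(1, 0) \<in> R" using assms(2) by (auto simp: R_def)
  have "card {(0 :: nat, 0 :: bool \<Rightarrow>\<^sub>0 nat), (1, 0)} \<le> card R" using elems R(1) by (intro card_mono) auto
  then have Q: "?Q \<ge> 2" by (simp add: R(2))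
  show ?thesis
  proof (rule proj_dim_le_parameters[where X = R and J = "\<lambda>\<tau>. point_parameters h \<union> Inr ` (R - {\<tau>})"
        and S = "\<lambda>\<tau>. Inr ` (R - {\<tau>})" and D = d and \<Phi> = "\<lambda>\<tau>. secant_map d (R - {\<tau>})"])
    show "finite R" by (rule R)
    show "finite (point_parameters h \<union> Inr ` (R - {\<tau>})) \<and>
      Inr ` (R - {\<tau>}) \<subseteq> point_parameters h \<union> Inr ` (R - {\<tau>}) \<and> Inr ` (R - {\<tau>}) \<noteq> {} \<and>
      card (point_parameters h \<union> Inr ` (R - {\<tau>})) \<le> 2 * (h + 1) + ?Q - 2 + 1" if "\<tau> \<in> R" for \<tau>
    proof (intro conjI)
      show "Inr ` (R - {\<tau>}) \<noteq> {}" using elems by (cases "\<tau> = (0, 0)") auto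
      have "card (point_parameters h \<union> Inr ` (R - {\<tau>})) \<le> card (point_parameters h) + card (Inr ` (R - {\<tau>}) :: parameter set)"
        by (rule card_Un_le)
      also have "card (Inr ` (R - {\<tau>}) :: parameter set) = ?Q - 1"
        using R that by (subst card_image) (auto simp: card_Diff_singleton)
      finally show "card (point_parameters h \<union> Inr ` (R - {\<tau>})) \<le> 2 * (h + 1) + ?Q - 2 + 1"
        using Q by (simp add: card_point_parameters)
    qed (use R(1) in auto)
    show "(\<lambda>u. secant_map d (R - {\<tau>}) u i) \<in>
      polyfuns (graded_box (point_parameters h \<union> Inr ` (R - {\<tau>})) (Inr ` (R - {\<tau>})) d 1)" if "i \<in> ?I" for \<tau> i
      by (rule secant_map_polyfuns[OF assms(1) _ _ that]) (use R in auto)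
    show "vanishes f (secant_variety ?I h (osculating_veronese d m))"
      if f: "f \<in> forms ?I e" and zero: "\<And>\<tau> u. \<tau> \<in> R \<Longrightarrow> f (secant_map d (R - {\<tau>}) u) = 0" for e f
    proof (rule secant_veronese(1)[OF assms(1) f])
      fix u :: "parameter \<Rightarrow> complex"
      obtain a l \<beta> where a: "l \<le> h" "\<beta> \<in> exponents_below (m + 1)" "a (l, \<beta>) \<noteq> 0"
        "\<And>\<kappa>. \<kappa> \<in> exponents_below (d + 1) \<Longrightarrow>
          (\<Sum>(l, \<beta>)\<in>R. a (l, \<beta>) * taylor_coeff \<beta> \<kappa> (\<lambda>b. u (Inl (l, b)))) = 0"
        using dep[of "\<lambda>l b. u (Inl (l, b))"] unfolding R_def by blast
      have "(\<Sum>(l, \<beta>)\<in>R. a (l, \<beta>) * osculating_vector d \<beta> (\<lambda>b. u (Inl (l, b))) \<alpha>) = 0" for \<alpha>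
        using a(4)[OF dehomogenize_mem, of \<alpha>] by (cases "\<alpha> \<in> ?I") (simp_all add: osculating_vector_def)
      moreover have "(l, \<beta>) \<in> R" using a by (simp add: R_def)
      ultimately obtain u' where "secant_map d R u = secant_map d (R - {(l, \<beta>)}) u'"
        using secant_map_drop[of R l \<beta> a d u, OF R(1) _ a(3)] by blast
      then show "f (secant_map d (all_pairs h m) u) = 0"
        using zero[OF \<open>(l, \<beta>) \<in> R\<close>, of u'] unfolding R_def by (simp only:)
    qed
  qed
qed

section \<open>Degenerate differentials\<close>

lemma taylor_term_derivative:
  "((\<lambda>t. of_nat (k choose i) * (x + t * y) ^ (k - i)) has_field_derivative
    of_nat (Suc i) * y * (of_nat (k choose Suc i) * x ^ (k - Suc i))) (at 0)"
  for x y :: complex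
proof -
  have "Suc i * (k choose Suc i) = (k - i) * (k choose i)"
    by (simp only: binomial_absorption binomial_absorb_comp)
  then have eq: "of_nat (k - i) * of_nat (k choose i) = (of_nat (Suc i) * of_nat (k choose Suc i) :: complex)"
    by (simp only: of_nat_mult[symmetric])
  have "((\<lambda>t. of_nat (k choose i) * (x + t * y) ^ (k - i)) has_field_derivative
    of_nat (k choose i) * (of_nat (k - i) * (y * (x + 0 * y) ^ (k - i - Suc 0)))) (at 0)"
    by (intro DERIV_cmult DERIV_power) (auto intro!: derivative_eq_intros)
  also have "of_nat (k choose i) * (of_nat (k - i) * (y * (x + 0 * y) ^ (k - i - Suc 0))) =
    (of_nat (k - i) * of_nat (k choose i)) * y * x ^ (k - Suc i)"
    by simp
  finally show ?thesis unfolding eq by (simp add: mult_ac)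
qed

text \<open>For divided derivatives, moving the base point raises the order by 1 and produces the
  factor \<open>lookup \<beta> b + 1\<close>.\<close>

lemma taylor_coeff_derivative:
  "((\<lambda>t. taylor_coeff \<beta> \<kappa> (\<lambda>b. p b + t * q b)) has_field_derivative
    (\<Sum>b\<in>UNIV. of_nat (Suc (lookup \<beta> b)) * q b * taylor_coeff (\<beta> + single b 1) \<kappa> p)) (at 0)"
proof -
  define F where "F b t = of_nat (lookup \<kappa> b choose lookup \<beta> b) *
    (p b + t * q b) ^ (lookup \<kappa> b - lookup \<beta> b)" for b t
  define G where "G b = of_nat (lookup \<kappa> b choose Suc (lookup \<beta> b)) *
    p b ^ (lookup \<kappa> b - Suc (lookup \<beta> b))" for b
  define D where "D b = of_nat (Suc (lookup \<beta> b)) * q b * G b" for b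
  have F: "(F b has_field_derivative D b) (at 0)" for b
    unfolding F_def[abs_def] D_def G_def by (rule taylor_term_derivative)
  have taylor: "taylor_coeff \<beta> \<kappa> (\<lambda>b. p b + t * q b) = F False t * F True t" for t
    by (simp add: taylor_coeff_def UNIV_bool F_def)
  have next_order: "taylor_coeff (\<beta> + single False 1) \<kappa> p = G False * F True 0"
    "taylor_coeff (\<beta> + single True 1) \<kappa> p = F False 0 * G True"
    by (simp_all add: taylor_coeff_def UNIV_bool F_def G_def lookup_add lookup_single)
  have "(\<Sum>b\<in>UNIV. of_nat (Suc (lookup \<beta> b)) * q b * taylor_coeff (\<beta> + single b 1) \<kappa> p) =
    D False * F True 0 + D True * F False 0"
    by (simp only: UNIV_bool) (simp add: next_order[simplified] D_def)
  then show ?thesis unfolding taylor by (simp only: DERIV_mult[OF F F])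
qed

text \<open>\<open>G\<close> consists of the coefficients of the curve. Its pairing with
  \<open>secant_map\<close> is a sum of linear parameters times Taylor coefficients
  \<open>E \<beta>\<close> of the curve at the points, and both \<open>E \<beta>\<close> and its
  first derivatives vanish there.\<close>

lemma secant_map_degenerate:
  assumes "has_curve h (\<lambda>l b. u (Inl (l, b))) d (\<lambda>_. m + 2)"
  shows "\<exists>G. (\<exists>\<alpha>\<in>veronese_index 2 d. G \<alpha> \<noteq> 0) \<and>
    (\<forall>\<xi>. ((\<lambda>t. \<Sum>\<alpha>\<in>veronese_index 2 d. G \<alpha> * secant_map d (all_pairs h m) (\<lambda>j. u j + t * \<xi> j) \<alpha>)
      has_field_derivative 0) (at 0))"
proof -
  let ?I = "veronese_index 2 d" and ?p = "\<lambda>l b. u (Inl (l, b))"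
  define T where "T = exponents_below (d + 1)"
  obtain f v where f: "f \<in> polyfuns T" "f v \<noteq> 0" "\<And>l. l \<le> h \<Longrightarrow> mult_ge f (?p l) (m + 2)"
    using assms by (auto simp: has_curve_def T_def)
  have "finite T" by (simp add: T_def)
  with f(1) obtain c where c: "\<And>v. f v = (\<Sum>\<kappa>\<in>T. c \<kappa> * eval_monomial \<kappa> v)"
    by (rule polyfuns_expand) (rule that)
  define E where "E \<beta> p = (\<Sum>\<kappa>\<in>T. c \<kappa> * taylor_coeff \<beta> \<kappa> p)" for \<beta> p
  have E0: "E \<beta> (?p l) = 0" if "l \<le> h" "\<beta> \<in> exponents_below (m + 2)" for l \<beta>
    using f(3)[OF that(1)] that(2) unfolding T_def E_def
    by (simp only: mult_ge_iff[where D = "d + 1" and G = c, OF c[unfolded T_def]])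
  \<comment> \<open>Moving a point turns order at most \<open>m\<close> into order at most
    \<open>m + 1\<close>; this is why multiplicity \<open>m + 2\<close> is required.\<close>
  have E': "((\<lambda>t. E \<beta> (\<lambda>b. ?p l b + t * \<xi> b)) has_field_derivative 0) (at 0)"
    if "l \<le> h" "\<beta> \<in> exponents_below (m + 1)" for l \<beta> \<xi>
  proof -
    have "((\<lambda>t. E \<beta> (\<lambda>b. ?p l b + t * \<xi> b)) has_field_derivative (\<Sum>\<kappa>\<in>T. c \<kappa> *
      (\<Sum>b\<in>UNIV. of_nat (Suc (lookup \<beta> b)) * \<xi> b * taylor_coeff (\<beta> + single b 1) \<kappa> (?p l)))) (at 0)"
      unfolding E_def by (intro DERIV_sum DERIV_cmult taylor_coeff_derivative)
    also have "(\<Sum>\<kappa>\<in>T. c \<kappa> *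
      (\<Sum>b\<in>UNIV. of_nat (Suc (lookup \<beta> b)) * \<xi> b * taylor_coeff (\<beta> + single b 1) \<kappa> (?p l))) =
      (\<Sum>b\<in>UNIV. of_nat (Suc (lookup \<beta> b)) * \<xi> b * E (\<beta> + single b 1) (?p l))"
      unfolding E_def sum_distrib_left by (subst sum.swap) (simp only: mult.left_commute mult.assoc)
    also have "\<dots> = 0"
      using that by (intro sum.neutral ballI) (simp add: E0 exponents_below_def mdeg_add)
    finally show ?thesis .
  qed
  define G where "G \<alpha> = c (dehomogenize \<alpha>)" for \<alpha>
  have "\<exists>\<kappa>\<in>T. c \<kappa> \<noteq> 0"
  proof (rule ccontr)
    assume "\<not> ?thesis"
    then have "f v = 0" unfolding c by simp
    with f(2) show False by simp
  qed
  then have "\<exists>\<alpha>\<in>?I. G \<alpha> \<noteq> 0"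
    using bij_betw_imp_surj_on[OF bij_betw_dehomogenize[of d]] unfolding T_def G_def by (metis imageE)
  moreover have "((\<lambda>t. \<Sum>\<alpha>\<in>?I. G \<alpha> * secant_map d (all_pairs h m) (\<lambda>j. u j + t * \<xi> j) \<alpha>)
      has_field_derivative 0) (at 0)" for \<xi>
  proof -
    have eq: "(\<Sum>\<alpha>\<in>?I. G \<alpha> * secant_map d (all_pairs h m) w \<alpha>) =
      (\<Sum>r\<in>all_pairs h m. w (Inr r) * E (snd r) (\<lambda>b. w (Inl (fst r, b))))" for w
    proof -
      have "(\<Sum>\<alpha>\<in>?I. G \<alpha> * secant_map d (all_pairs h m) w \<alpha>) =
        (\<Sum>\<alpha>\<in>?I. \<Sum>r\<in>all_pairs h m. c (dehomogenize \<alpha>) * (w (Inr r) *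
          taylor_coeff (snd r) (dehomogenize \<alpha>) (\<lambda>b. w (Inl (fst r, b)))))"
        by (intro sum.cong refl)
          (simp add: G_def secant_map_def osculating_vector_def sum_distrib_left case_prod_unfold)
      also have "\<dots> = (\<Sum>\<kappa>\<in>T. \<Sum>r\<in>all_pairs h m. c \<kappa> * (w (Inr r) *
          taylor_coeff (snd r) \<kappa> (\<lambda>b. w (Inl (fst r, b)))))"
        unfolding T_def by (rule sum_veronese_index)
      also have "\<dots> = (\<Sum>r\<in>all_pairs h m. w (Inr r) * E (snd r) (\<lambda>b. w (Inl (fst r, b))))"
        by (subst sum.swap) (simp add: E_def sum_distrib_left mult.left_commute)
      finally show ?thesis .
    qed
    have "((\<lambda>t. \<Sum>r\<in>all_pairs h m. (u (Inr r) + t * \<xi> (Inr r)) *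
        E (snd r) (\<lambda>b. ?p (fst r) b + t * \<xi> (Inl (fst r, b)))) has_field_derivative (\<Sum>r\<in>all_pairs h m. 0)) (at 0)"
    proof (rule DERIV_sum)
      fix r assume r: "r \<in> all_pairs h m"
      then have lr: "fst r \<le> h" "snd r \<in> exponents_below (m + 1)" "snd r \<in> exponents_below (m + 2)"
        by (auto simp: exponents_below_def)
      have "((\<lambda>t. u (Inr r) + t * \<xi> (Inr r)) has_field_derivative \<xi> (Inr r)) (at 0)"
        by (auto intro!: derivative_eq_intros)
      from DERIV_mult[OF this E'[OF lr(1,2), of "\<lambda>b. \<xi> (Inl (fst r, b))"]] E0[OF lr(1,3)]
      show "((\<lambda>t. (u (Inr r) + t * \<xi> (Inr r)) * E (snd r) (\<lambda>b. ?p (fst r) b + t * \<xi> (Inl (fst r, b))))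
        has_field_derivative 0) (at 0)" by simp
    qed
    then show ?thesis unfolding eq sum.neutral_const .
  qed
  ultimately show ?thesis by blast
qed

lemma secant_map_scale:
  "secant_map d R (case_sum (\<lambda>x. u (Inl x)) (\<lambda>r. t * u (Inr r))) = (\<lambda>\<alpha>. t * secant_map d R u \<alpha>)"
  by (simp add: secant_map_def fun_eq_iff case_prod_unfold sum_distrib_left mult.assoc)

text \<open>The relation found by the Jacobian criterion may be inhomogeneous. Since the image of
  \<open>secant_map\<close> is stable under scaling, each homogeneous component vanishes on it, and
  a nonzero component is the equation of a hypersurface.\<close>

lemma proj_dim_secant_degenerate:
  assumes "d \<ge> 1" and curve: "\<And>p. has_curve h p d (\<lambda>_. m + 2)"
  shows "proj_dim (veronese_index 2 d) (secant_variety (veronese_index 2 d) h (osculating_veronese d m))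
    \<le> enat (card (veronese_index 2 d) - 2)"
proof -
  let ?I = "veronese_index 2 d"
  let ?J = "point_parameters h \<union> Inr ` all_pairs h m"
  have "alg_dependent (\<lambda>\<alpha> u. secant_map d (all_pairs h m) u \<alpha>) ?I"
  proof (rule alg_dependent_jacobian[where J = ?J and E = d])
    show "(\<lambda>u. secant_map d (all_pairs h m) u \<alpha>) \<in> polyfuns (cube ?J d)" if "\<alpha> \<in> ?I" for \<alpha>
    proof -
      have "(\<lambda>u. secant_map d (all_pairs h m) u \<alpha>) \<in> polyfuns (graded_box ?J (Inr ` all_pairs h m) d 1)"
        by (rule secant_map_polyfuns[OF assms(1) _ _ that]) auto
      then show ?thesis
        by (rule subsetD[OF polyfuns_mono, rotated]) (auto simp: graded_box_def)
    qed
  qed (simp_all only: finite_veronese_index secant_map_degenerate[OF curve], simp)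
  then obtain D P v where P: "P \<in> polys ?I D" "P v \<noteq> 0" "\<And>u. P (secant_map d (all_pairs h m) u) = 0"
    unfolding alg_dependent_def by auto
  obtain g where g: "\<And>k. g k \<in> forms ?I k" "\<And>v. P v = (\<Sum>k\<le>D. g k v)"
    using homogeneous_components[OF P(1)] by blast
  from P(2) have "\<exists>k\<in>{..D}. g k v \<noteq> 0" unfolding g(2) by (meson sum.neutral)
  then obtain k where k: "k \<le> D" "g k v \<noteq> 0" by auto
  have zero: "g k (secant_map d (all_pairs h m) u) = 0" for u
  proof (rule homogeneous_components_eq_0[where g = g and D = D, OF g(1) _ k(1)])
    fix t
    show "(\<Sum>k\<le>D. g k (\<lambda>i. t * secant_map d (all_pairs h m) u i)) = 0"
      unfolding g(2)[symmetric] secant_map_scale[symmetric] by (rule P(3))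
  qed
  have "card ?I \<ge> 2"
  proof -
    have "2 * 3 \<le> (d + 1) * (d + 2)" using assms(1) by (intro mult_le_mono) auto
    then show ?thesis using card_veronese_index[of d] by simp
  qed
  then show ?thesis
    using secant_veronese[OF assms(1) g(1) zero]
    by (intro proj_dim_hypersurface_le[where f = "g k" and e = k and v = v] finite_veronese_index g(1) k(2))
qed

theorem proposition1:
  fixes d h m :: nat
  assumes "d \<ge> 1" and "h \<ge> 1" and "m \<ge> 1"
  shows
    "((real d + 2) * (real d + 1) / 2
        \<le> 2 * (real h + 1) + (real h + 1) * ((real m + 2) * (real m + 1) / 2) \<longrightarrow>
      (h = 1 \<and> real m + 2 \<le> real d \<and> real d \<le> 2 * real m + 2) \<or>
      (h = 2 \<and> 3 * (real m + 2) / 2 \<le> real d \<and> real d \<le> 2 * real m + 2) \<or>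
      (h = 4 \<and> 2 * real m + 4 \<le> real d \<and> real d \<le> (5 * real m + 8) / 2) \<or>
      (h = 5 \<and> 12 * (real m + 2) / 5 \<le> real d \<and> real d \<le> (5 * real m + 8) / 2) \<or>
      (h = 6 \<and> 21 * (real m + 2) / 8 \<le> real d \<and> real d \<le> (8 * real m + 14) / 3) \<or>
      (h = 7 \<and> 48 * (real m + 2) / 17 \<le> real d \<and> real d \<le> (17 * real m + 32) / 6) \<longrightarrow>
      defective d m h)
   \<and>
     ((real d + 2) * (real d + 1) / 2
        \<ge> 2 * (real h + 1) + (real h + 1) * ((real m + 2) * (real m + 1) / 2) \<longrightarrow>
      (h = 1 \<and> real m + 1 \<le> real d \<and> real d \<le> 2 * real m) \<or>
      (h = 2 \<and> 3 * (real m + 1) / 2 \<le> real d \<and> real d \<le> 2 * real m) \<or>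
      (h = 4 \<and> 2 * real m + 2 \<le> real d \<and> real d \<le> (5 * real m + 3) / 2) \<or>
      (h = 5 \<and> 12 * (real m + 1) / 5 \<le> real d \<and> real d \<le> (5 * real m + 3) / 2) \<or>
      (h = 6 \<and> 21 * (real m + 1) / 8 \<le> real d \<and> real d \<le> (8 * real m + 6) / 3) \<or>
      (h = 7 \<and> 48 * (real m + 1) / 17 \<le> real d \<and> real d \<le> (17 * real m + 15) / 6) \<longrightarrow>
      defective d m h)"
proof -
  let ?I = "veronese_index 2 d"
  define N B where "N = card ?I" and "B = card (exponents_below (m + 1))"
  have N: "2 * N = (d + 2) * (d + 1)" using card_veronese_index[of d] by (simp add: N_def mult.commute)
  have B: "2 * B = (m + 2) * (m + 1)" using card_exponents_below[of "m + 1"] by (simp add: B_def mult.commute)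
  have N_div: "(d + 2) * (d + 1) div 2 = N" and B_div: "(m + 2) * (m + 1) div 2 = B"
    unfolding N[symmetric] B[symmetric] by simp_all
  have N_real: "(real d + 2) * (real d + 1) / 2 = real N"
    using arg_cong[OF N, of real] by (simp add: field_simps)
  have "(real m + 2) * (real m + 1) / 2 = real B"
    using arg_cong[OF B, of real] by (simp add: field_simps)
  then have B_real: "2 * (real h + 1) + (real h + 1) * ((real m + 2) * (real m + 1) / 2) =
      real (2 * (h + 1) + (h + 1) * B)"
    by (simp add: algebra_simps)
  have expdim: "expected_dim d m h = min (2 * (h + 1) + (h + 1) * B - 1) (N - 1)"
    unfolding expected_dim_def N_div B_div ..
  have I: "defective d m h"
    if le: "N \<le> 2 * (h + 1) + (h + 1) * B"
      and cases: "h = 1 \<and> m + 2 \<le> d \<or> h = 2 \<and> 3 * (m + 2) \<le> 2 * d \<or> h = 4 \<and> 2 * (m + 2) \<le> d \<or>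
        h = 5 \<and> 12 * (m + 2) \<le> 5 * d \<or> h = 6 \<and> 21 * (m + 2) \<le> 8 * d \<or> h = 7 \<and> 48 * (m + 2) \<le> 17 * d"
  proof -
    have "2 * 3 \<le> (d + 1) * (d + 2)" using assms(1) by (intro mult_le_mono) auto
    \<comment> \<open>This keeps the truncated difference \<open>N - 2\<close> strictly below
      \<open>N - 1\<close>, which is the minimum in \<open>expdim\<close> here.\<close>
    then have "N \<ge> 2" using N by simp
    then have "enat (N - 2) < enat (expected_dim d m h)" using le by (simp add: expdim)
    with proj_dim_secant_degenerate[OF assms(1) has_curve_cases[OF cases]]
    show ?thesis unfolding defective_def N_def by (rule le_less_trans)
  qed
  \<comment> \<open>With \<open>M = m + 1\<close> the upper bounds take the form D.C \<le> -2; for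
    instance \<open>d \<le> 2 * m\<close> becomes \<open>d + 2 \<le> 2 * (m + 1)\<close>.\<close>
  have II: "defective d m h"
    if le: "2 * (h + 1) + (h + 1) * B \<le> N"
      and cases: "h = 1 \<and> m + 1 \<le> d \<and> d + 2 \<le> 2 * (m + 1) \<or>
       h = 2 \<and> 3 * (m + 1) \<le> 2 * d \<and> d + 2 \<le> 2 * (m + 1) \<or>
       h = 4 \<and> 2 * (m + 1) \<le> d \<and> 2 * d + 2 \<le> 5 * (m + 1) \<or>
       h = 5 \<and> 12 * (m + 1) \<le> 5 * d \<and> 2 * d + 2 \<le> 5 * (m + 1) \<or>
       h = 6 \<and> 21 * (m + 1) \<le> 8 * d \<and> 3 * d + 2 \<le> 8 * (m + 1) \<or>
       h = 7 \<and> 48 * (m + 1) \<le> 17 * d \<and> 6 * d + 2 \<le> 17 * (m + 1)"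
  proof -
    have dep: "\<exists>a l \<beta>. l \<le> h \<and> \<beta> \<in> exponents_below (m + 1) \<and> a (l, \<beta>) \<noteq> 0 \<and>
      (\<forall>\<kappa>\<in>exponents_below (d + 1). (\<Sum>(l, \<beta>)\<in>all_pairs h m. a (l, \<beta>) * taylor_coeff \<beta> \<kappa> (p l)) = 0)"
      for p :: "nat \<Rightarrow> bool \<Rightarrow> complex"
      by (rule taylor_coeffs_dependent_cases[OF cases, of p]) (use assms(3) in \<open>simp, blast\<close>)
    \<comment> \<open>In this regime the parameter count is the smaller term of the minimum, and the
      bound lies one below it.\<close>
    have "enat (2 * (h + 1) + (h + 1) * B - 2) < enat (expected_dim d m h)" using le by (simp add: expdim)
    with proj_dim_secant_dependent[OF assms(1,2) dep] show ?thesis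
      unfolding defective_def B_def by (rule le_less_trans)
  qed
  show ?thesis
    unfolding N_real B_real of_nat_le_iff
  proof (intro conjI impI, goal_cases)
    case 1
    from 1(2) show ?case by (intro I[OF 1(1)]) (elim disjE conjE; simp; linarith?)
  next
    case 2
    from 2(2) show ?case by (intro II[OF 2(1)]) (elim disjE conjE; simp; linarith?)
  qed
qed

end
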